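(* Let $V_+$ be a finite-dimensional vector space over $\Bbbk$. Then the representation $(GL(V_+):\mathcal S^2V_+\oplus(\mathcal S^2V_+)^* )$ has GNIB.
   Context: The ground field $\Bbbk$ is algebraically closed of characteristic zero; $\mathcal S^2V_+$ is the symmetric square. For a Lie algebra $\mathfrak q$ and a finite-dimensional $\mathfrak q$-module $U$, the index is $\mathrm{ind}(\mathfrak q,U)=\dim U-\max_{\xi\in U^*}\dim(\mathfrak q\cdot\xi)$. For a rational representation $(G:U)$ of a reductive group $G$ with Lie algebra $\mathfrak g$, a vector $v\in U$ is nilpotent if $0\in\overline{G\cdot v}$; $\mathfrak g_v$ is the stabiliser of $v$ in $\mathfrak g$, and $U/\mathfrak g\cdot v$ is a $\mathfrak g_v$-module. $(G:U)$ has good nilpotent index behaviour (GNIB) if $\mathrm{ind}(\mathfrak g,U^* )=\mathrm{ind}(\mathfrak g_v,(U/\mathfrak g\cdot v)^* )$ for every nilpotent $v\in U$. (With $n=\dim V_+$, the representation in question is the isotropy representation of the symmetric pair $(Sp_{2n},GL_n)$, where $GL_n$ is the stabiliser of a Lagrangian decomposition $\Bbbk^{2n}=V_+\oplus V_-$, $V_-\simeq V_+^*$.) *)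

theory Defs
  imports "Jordan_Normal_Form.VS_Connect" "HOL-Algebra.AbelCoset" "HOL-Algebra.Bij"
begin

text \<open>
  Vector spaces over the field \<open>'k\<close> are \<open>('k, 'v) module\<close> records over \<^term>\<open>class_ring\<close>, so that
  dimension, span and direct sum are the library notions; linear maps between carriers are
  extensional functions. As in the library, the multiplicative record fields of a vector space
  carry no information.
\<close>

abbreviation vdim :: "('k::field, 'v) module \<Rightarrow> nat" where
  "vdim V \<equiv> vectorspace.dim class_ring V"

definition dual :: "('k::field, 'v) module \<Rightarrow> ('k, 'v \<Rightarrow> 'k) module" where
  "dual V = (ring.func_space class_ring (carrier V))
     \<lparr>carrier := {\<xi> \<in> extensional (carrier V).
        (\<forall>u\<in>carrier V. \<forall>v\<in>carrier V. \<xi> (u \<oplus>\<^bsub>V\<^esub> v) = \<xi> u + \<xi> v) \<and>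
        (\<forall>c. \<forall>v\<in>carrier V. \<xi> (c \<odot>\<^bsub>V\<^esub> v) = c * \<xi> v)}\<rparr>"

text \<open>Here \<^term>\<open>the_elem\<close> extracts the common value of a function that is constant on a coset.\<close>

definition quot_space :: "('k::field, 'v) module \<Rightarrow> 'v set \<Rightarrow> ('k, 'v set) module" where
  "quot_space V W = \<lparr>carrier = a_rcosets\<^bsub>V\<^esub> W, mult = (\<lambda>X Y. W), one = W, zero = W,
     add = set_add V,
     smult = (\<lambda>c X. the_elem ((\<lambda>v. W +>\<^bsub>V\<^esub> (c \<odot>\<^bsub>V\<^esub> v)) ` X))\<rparr>"


subsection \<open>Index\<close>

text \<open>
  A module \<open>U\<close> over a Lie algebra is given by the carrier \<open>q\<close> of the Lie algebra and the action
  \<open>act x u\<close> of \<open>x \<in> q\<close> on \<open>u \<in> U\<close>; the Lie bracket does not enter the definition of the index.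
  For finite-dimensional \<open>U\<close> the maximum is over a nonempty finite set of natural numbers.
\<close>

definition lie_orbit :: "'x set \<Rightarrow> ('x \<Rightarrow> 'u \<Rightarrow> 'u) \<Rightarrow> 'u \<Rightarrow> 'u set" where
  "lie_orbit q act u = (\<lambda>x. act x u) ` q"

definition lie_stabiliser ::
    "'x set \<Rightarrow> ('k::field, 'u) module \<Rightarrow> ('x \<Rightarrow> 'u \<Rightarrow> 'u) \<Rightarrow> 'u \<Rightarrow> 'x set" where
  "lie_stabiliser q U act u = {x \<in> q. act x u = \<zero>\<^bsub>U\<^esub>}"

definition dual_lie_action ::
    "('k::field, 'u) module \<Rightarrow> ('x \<Rightarrow> 'u \<Rightarrow> 'u) \<Rightarrow> 'x \<Rightarrow> ('u \<Rightarrow> 'k) \<Rightarrow> ('u \<Rightarrow> 'k)" where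
  "dual_lie_action U act x \<xi> = (\<lambda>u\<in>carrier U. - \<xi> (act x u))"

definition quot_lie_action ::
    "('k::field, 'u) module \<Rightarrow> 'u set \<Rightarrow> ('x \<Rightarrow> 'u \<Rightarrow> 'u) \<Rightarrow> 'x \<Rightarrow> 'u set \<Rightarrow> 'u set" where
  "quot_lie_action U W act x X = the_elem ((\<lambda>u. W +>\<^bsub>U\<^esub> act x u) ` X)"

definition index :: "'x set \<Rightarrow> ('k::field, 'u) module \<Rightarrow> ('x \<Rightarrow> 'u \<Rightarrow> 'u) \<Rightarrow> int" where
  "index q U act = int (vdim U) -
     int (Max ((\<lambda>\<xi>. vdim ((dual U)\<lparr>carrier := lie_orbit q (dual_lie_action U act) \<xi>\<rparr>))
                 ` carrier (dual U)))"


subsection \<open>Nilpotent vectors and good nilpotent index behaviour\<close>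

inductive_set poly_functions :: "('k::field, 'u) module \<Rightarrow> ('u \<Rightarrow> 'k) set"
  for U :: "('k::field, 'u) module" where
  const: "(\<lambda>u. c) \<in> poly_functions U"
| linear: "\<xi> \<in> carrier (dual U) \<Longrightarrow> \<xi> \<in> poly_functions U"
| add: "p \<in> poly_functions U \<Longrightarrow> q \<in> poly_functions U \<Longrightarrow> (\<lambda>u. p u + q u) \<in> poly_functions U"
| mult: "p \<in> poly_functions U \<Longrightarrow> q \<in> poly_functions U \<Longrightarrow> (\<lambda>u. p u * q u) \<in> poly_functions U"

definition zariski_closure :: "('k::field, 'u) module \<Rightarrow> 'u set \<Rightarrow> 'u set" where
  "zariski_closure U S =
     {u \<in> carrier U. \<forall>p\<in>poly_functions U. (\<forall>s\<in>S. p s = 0) \<longrightarrow> p u = 0}"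

definition nilpotent_vector ::
    "('g, 'm) monoid_scheme \<Rightarrow> ('g \<Rightarrow> 'u \<Rightarrow> 'u) \<Rightarrow> ('k::field, 'u) module \<Rightarrow> 'u \<Rightarrow> bool" where
  "nilpotent_vector G \<rho> U v \<longleftrightarrow>
     v \<in> carrier U \<and> \<zero>\<^bsub>U\<^esub> \<in> zariski_closure U ((\<lambda>g. \<rho> g v) ` carrier G)"

text \<open>
  \<open>\<rho>\<close> is the action of the group \<open>G\<close> on \<open>U\<close>, and \<open>d\<rho>\<close> is its differential, the action of the
  Lie algebra \<open>g\<close> of \<open>G\<close> on \<open>U\<close>.
\<close>

definition GNIB ::
    "('g, 'm) monoid_scheme \<Rightarrow> ('g \<Rightarrow> 'u \<Rightarrow> 'u) \<Rightarrow> 'x set \<Rightarrow> ('x \<Rightarrow> 'u \<Rightarrow> 'u) \<Rightarrow>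
     ('k::field, 'u) module \<Rightarrow> bool" where
  "GNIB G \<rho> g d\<rho> U \<longleftrightarrow>
     (\<forall>v. nilpotent_vector G \<rho> U v \<longrightarrow>
        (let gv = lie_orbit g d\<rho> v; N = quot_space U gv in
          index g (dual U) (dual_lie_action U d\<rho>) =
          index (lie_stabiliser g U d\<rho> v) (dual N)
            (dual_lie_action N (quot_lie_action U gv d\<rho>))))"


subsection \<open>The symmetric square\<close>

text \<open>
  The quotient of the free vector space on \<open>V \<times> V\<close> by the relations saying that the class of
  \<open>(u, v)\<close> is symmetric and bilinear in \<open>u\<close> and \<open>v\<close>.
\<close>

definition free_space :: "'s set \<Rightarrow> ('k::field, 's \<Rightarrow> 'k) module" where
  "free_space S = (ring.func_space class_ring S)
     \<lparr>carrier := {f \<in> extensional S. finite {s \<in> S. f s \<noteq> 0}}\<rparr>"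

definition free_gen :: "'s set \<Rightarrow> 's \<Rightarrow> 's \<Rightarrow> 'k::field" where
  "free_gen S s = (\<lambda>t\<in>S. if t = s then 1 else 0)"

definition free_lift :: "'s set \<Rightarrow> ('k::field, 'w) module \<Rightarrow> ('s \<Rightarrow> 'w) \<Rightarrow> ('s \<Rightarrow> 'k) \<Rightarrow> 'w" where
  "free_lift S W b f = (\<Oplus>\<^bsub>W\<^esub>s\<in>{s \<in> S. f s \<noteq> 0}. f s \<odot>\<^bsub>W\<^esub> b s)"

definition sym_relations :: "('k::field, 'v) module \<Rightarrow> ('v \<times> 'v \<Rightarrow> 'k) set" where
  "sym_relations V =
    (let S = carrier V \<times> carrier V; F = free_space S; e = (\<lambda>u v. free_gen S (u, v)) in
      LinearCombinations.module.span class_ring F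
       ({e (u \<oplus>\<^bsub>V\<^esub> u') v \<ominus>\<^bsub>F\<^esub> (e u v \<oplus>\<^bsub>F\<^esub> e u' v) | u u' v.
           u \<in> carrier V \<and> u' \<in> carrier V \<and> v \<in> carrier V} \<union>
        {e (c \<odot>\<^bsub>V\<^esub> u) v \<ominus>\<^bsub>F\<^esub> (c \<odot>\<^bsub>F\<^esub> e u v) | c u v. u \<in> carrier V \<and> v \<in> carrier V} \<union>
        {e u v \<ominus>\<^bsub>F\<^esub> e v u | u v. u \<in> carrier V \<and> v \<in> carrier V}))"

definition sym_square :: "('k::field, 'v) module \<Rightarrow> ('k, ('v \<times> 'v \<Rightarrow> 'k) set) module" where
  "sym_square V = quot_space (free_space (carrier V \<times> carrier V)) (sym_relations V)"

definition sym_mult :: "('k::field, 'v) module \<Rightarrow> 'v \<Rightarrow> 'v \<Rightarrow> ('v \<times> 'v \<Rightarrow> 'k) set" where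
  "sym_mult V u v = sym_relations V +>\<^bsub>free_space (carrier V \<times> carrier V)\<^esub>
     free_gen (carrier V \<times> carrier V) (u, v)"

text \<open>The linear map on the symmetric square induced by a symmetric bilinear map \<open>b\<close>.\<close>

definition sym_lift :: "('k::field, 'v) module \<Rightarrow> ('k, 'w) module \<Rightarrow> ('v \<Rightarrow> 'v \<Rightarrow> 'w) \<Rightarrow>
    ('v \<times> 'v \<Rightarrow> 'k) set \<Rightarrow> 'w" where
  "sym_lift V W b X = the_elem (free_lift (carrier V \<times> carrier V) W (\<lambda>(u, v). b u v) ` X)"


subsection \<open>The general linear group and its representations\<close>

definition gl :: "('k::field, 'v) module \<Rightarrow> ('v \<Rightarrow> 'v) set" where
  "gl V = LinearCombinations.module_hom class_ring V V \<inter> extensional (carrier V)"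

definition GL :: "('k::field, 'v) module \<Rightarrow> ('v \<Rightarrow> 'v) monoid" where
  "GL V = (BijGroup (carrier V))\<lparr>carrier := Bij (carrier V) \<inter> gl V\<rparr>"

definition sym_square_GL_action ::
    "('k::field, 'v) module \<Rightarrow> ('v \<Rightarrow> 'v) \<Rightarrow> ('v \<times> 'v \<Rightarrow> 'k) set \<Rightarrow> ('v \<times> 'v \<Rightarrow> 'k) set" where
  "sym_square_GL_action V g =
     sym_lift V (sym_square V) (\<lambda>u v. sym_mult V (g u) (g v))"

text \<open>The differential of the action of \<open>GL(V)\<close>: \<open>x\<close> acts as a derivation, \<open>x(uv) = (xu)v + u(xv)\<close>.\<close>

definition sym_square_gl_action ::
    "('k::field, 'v) module \<Rightarrow> ('v \<Rightarrow> 'v) \<Rightarrow> ('v \<times> 'v \<Rightarrow> 'k) set \<Rightarrow> ('v \<times> 'v \<Rightarrow> 'k) set" where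
  "sym_square_gl_action V x =
     sym_lift V (sym_square V)
       (\<lambda>u v. sym_mult V (x u) v \<oplus>\<^bsub>sym_square V\<^esub> sym_mult V u (x v))"

definition dual_group_action :: "('g, 'm) monoid_scheme \<Rightarrow> ('k::field, 'u) module \<Rightarrow>
    ('g \<Rightarrow> 'u \<Rightarrow> 'u) \<Rightarrow> 'g \<Rightarrow> ('u \<Rightarrow> 'k) \<Rightarrow> ('u \<Rightarrow> 'k)" where
  "dual_group_action G U \<rho> g \<xi> = (\<lambda>u\<in>carrier U. \<xi> (\<rho> (inv\<^bsub>G\<^esub> g) u))"

definition sum_action ::
    "('g \<Rightarrow> 'u \<Rightarrow> 'u) \<Rightarrow> ('g \<Rightarrow> 'w \<Rightarrow> 'w) \<Rightarrow> 'g \<Rightarrow> 'u \<times> 'w \<Rightarrow> 'u \<times> 'w" where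
  "sum_action \<rho> \<sigma> g = map_prod (\<rho> g) (\<sigma> g)"

end

theory Submission
  imports "Jordan_Normal_Form.Char_Poly" "HOL-Library.Function_Algebras"
    "HOL-Library.Product_Plus" Defs
begin

text \<open>
  Write \<open>v = (A, B)\<close> with \<open>A \<in> S\<^sup>2V\<close> and \<open>B \<in> S\<^sup>2V\<^sup>*\<close> as an odd skew operator on the graded
  symplectic space \<open>V \<oplus> V\<^sup>*\<close>; the Lie algebra \<open>gl(V)\<close> acts by commutators with even skew
  operators. If some \<open>u\<close> in a module \<open>M\<close> of a Lie algebra \<open>q\<close> has trivial stabiliser, the index of
  \<open>(q, M\<^sup>*)\<close> is \<open>dim M - dim q\<close>. Since \<open>dim U/gv - dim g\<^sub>v = dim U - dim g\<close>, it suffices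
  to find, for each nilpotent \<open>v\<close>, some \<open>w \<in> U\<close> such that \<open>x \<in> g\<^sub>v\<close> and \<open>x w \<in> g v\<close> force
  \<open>x = 0\<close>; the case \<open>v = 0\<close> yields the index of \<open>(g, U\<^sup>*)\<close>.

  Such a \<open>w\<close> is built by splitting off Jordan blocks \<open>N = k[v]u + k[v]u'\<close> of maximal nilpotency
  order \<open>L\<close>. On \<open>N\<close> take \<open>w y = c (\<langle>y, u\<rangle>u + \<langle>y, u'\<rangle>u')\<close>. If \<open>[x, v] = 0\<close> and
  \<open>[x, w] = [\<psi>, v]\<close>, then \<open>x\<close> commutes with the coefficient \<open>E\<close> of \<open>t\<close> in \<open>(v + t w)\<^sup>L\<close>, because
  \<open>v\<^sup>L = 0\<close>. The square of \<open>E\<close> is \<open>c\<^sup>2\<kappa>\<close> plus a nilpotent operator on \<open>N\<close>, with \<open>\<kappa> \<noteq> 0\<close>, and for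
  generic \<open>c\<close> the scalar \<open>c\<^sup>2\<kappa>\<close> is not an eigenvalue of \<open>E\<^sup>2\<close> on the orthogonal complement of \<open>N\<close>.
  Hence \<open>x\<close> preserves \<open>N\<close> and its complement, where induction applies. On \<open>N\<close>, parity and skewness
  give \<open>\<langle>x u, v\<^sup>jE\<^sup>i u\<rangle> = 0\<close>, and these vectors span \<open>N\<close>.
\<close>

subsection \<open>Nilpotent skew operators on graded symplectic spaces\<close>

text \<open>The obstacle is that \<open>\<psi>\<close> is arbitrary, so the tangent directions
  \<open>[\<psi>, v]\<close> have to be made invisible. The coefficient of \<open>t\<close> in
  \<open>(v + t w) ^ L\<close> is the derivative of the \<open>L\<close>-th power at
  \<open>v\<close> in the direction \<open>w\<close>; in the direction \<open>[\<psi>, v]\<close> it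
  equals \<open>[\<psi>, v ^ L] = 0\<close>. Hence \<open>L\<close> has to be the order of
  nilpotency on the whole space still to be treated, not only on the block: \<open>x\<close> must
  commute with \<open>E\<close> on the complement too. A block has one generator or two because
  \<open>form (v ^ (L - 1) y) z\<close> is symmetric in \<open>y\<close>, \<open>z\<close> for even
  \<open>L\<close> and alternating for odd \<open>L\<close>. Nilpotency of a vector enters through
  \<open>det (t - A B)\<close>: its values are invariant polynomials, so at a nilpotent vector they
  agree with those at the origin, \<open>t ^ n\<close>. Thus \<open>A B\<close>, which is
  \<open>v ^ 2\<close> on \<open>V\<close>, is nilpotent. The operators act on a whole type, whereas
  the statement speaks of carrier records; symmetric \<open>n\<close> by \<open>n\<close> matrices
  are the common ground.\<close>

definition additive_homogeneous :: "('k \<Rightarrow> 'a \<Rightarrow> 'a::ab_group_add) \<Rightarrow> ('a \<Rightarrow> 'a) \<Rightarrow> bool" where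
  "additive_homogeneous sc f \<longleftrightarrow> (\<forall>a b. f (a + b) = f a + f b) \<and> (\<forall>c a. f (sc c a) = sc c (f a))"

text \<open>The grading operator \<open>s\<close> is 1 on \<open>V\<close> and -1 on the dual;
  \<open>form_s\<close> says that both eigenspaces are isotropic, \<open>s_v\<close> that
  \<open>v\<close> is odd, \<open>form_v\<close> that it is skew. Nondegeneracy and finite dimension
  are asked later of a subspace \<open>M\<close>, because the induction moves to orthogonal
  complements inside the same type.\<close>

locale graded_symplectic = vector_space scale
  for scale :: "'k::field_char_0 \<Rightarrow> 'a::ab_group_add \<Rightarrow> 'a" (infixr "*s" 75) +
  fixes form :: "'a \<Rightarrow> 'a \<Rightarrow> 'k" and s v :: "'a \<Rightarrow> 'a"
  assumes form_add_left: "form (a + b) c = form a c + form b c"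
    and form_scale_left: "form (r *s a) c = r * form a c"
    and form_swap: "form a b = - form b a"
    and v_add: "v (a + b) = v a + v b"
    and v_scale: "v (r *s a) = r *s v a"
    and form_v: "form (v a) b = - form a (v b)"
    and s_add: "s (a + b) = s a + s b"
    and s_scale: "s (r *s a) = r *s s a"
    and s_s: "s (s a) = a"
    and s_v: "s (v a) = - v (s a)"
    and form_s: "form (s a) (s b) = - form a b"
begin

abbreviation "linear_op \<equiv> additive_homogeneous scale"

lemma linear_opD:
  assumes "linear_op f"
  shows "f (a + b) = f a + f b" "f (r *s a) = r *s f a" "f 0 = 0" "f (- a) = - f a"
    "f (a - b) = f a - f b" "f (sum g A) = (\<Sum>x\<in>A. f (g x))"
proof -
  show add: "f (a + b) = f a + f b" and sc: "f (r *s a) = r *s f a" for a b r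
    using assms by (auto simp: additive_homogeneous_def)
  show z: "f 0 = 0" using sc[of 0 0] by simp
  show neg: "f (- a) = - f a" for a using sc[of "-1" a] by simp
  show "f (a - b) = f a - f b" using add[of a "-b"] neg[of b] by simp
  show "f (sum g A) = (\<Sum>x\<in>A. f (g x))"
    by (induct A rule: infinite_finite_induct) (auto simp: z add)
qed

lemma linear_v: "linear_op v" and linear_s: "linear_op s"
  by (auto simp: additive_homogeneous_def v_add v_scale s_add s_scale)

lemma linear_comp: "linear_op f \<Longrightarrow> linear_op g \<Longrightarrow> linear_op (\<lambda>y. f (g y))"
  by (simp add: additive_homogeneous_def)

lemma linear_funpow: "linear_op f \<Longrightarrow> linear_op (f ^^ j)"
  by (induct j) (auto simp: additive_homogeneous_def)

lemmas linear_vj = linear_funpow[OF linear_v]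
lemmas vD = linear_opD[OF linear_v] and sD = linear_opD[OF linear_s]
  and vjD = linear_opD[OF linear_vj]

lemma form_add_right: "form c (a + b) = form c a + form c b"
  by (metis form_swap form_add_left minus_add_distrib)

lemma form_scale_right: "form c (r *s a) = r * form c a"
  by (metis form_swap form_scale_left mult_minus_right)

lemma form_zero [simp]: "form 0 a = 0" "form a 0 = 0"
  using form_scale_left[of 0 0 a] form_scale_right[of a 0 0] by auto

lemma form_minus_left: "form (- a) b = - form a b"
  using form_scale_left[of "-1" a b] by simp

lemma form_minus_right: "form a (- b) = - form a b"
  using form_scale_right[of a "-1" b] by simp

lemma form_diff_left: "form (a - b) c = form a c - form b c"
  using form_add_left[of a "-b" c] by (simp add: form_minus_left)

lemma form_diff_right: "form c (a - b) = form c a - form c b"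
  using form_add_right[of c a "-b"] by (simp add: form_minus_right)

lemma form_sum_left: "form (sum g A) c = (\<Sum>x\<in>A. form (g x) c)"
  by (induct A rule: infinite_finite_induct) (auto simp: form_add_left)

lemma form_sum_right: "form c (sum g A) = (\<Sum>x\<in>A. form c (g x))"
  by (induct A rule: infinite_finite_induct) (auto simp: form_add_right)

lemmas form_simps = form_add_left form_add_right form_scale_left form_scale_right
  form_minus_left form_minus_right form_diff_left form_diff_right

lemma form_vj: "form ((v ^^ j) a) b = (-1) ^ j * form a ((v ^^ j) b)"
proof (induct j arbitrary: b)
  case (Suc j)
  then show ?case by (simp add: form_v funpow_swap1[where f=v, symmetric])
qed simp

lemma s_vj: "s ((v ^^ j) a) = (-1) ^ j *s (v ^^ j) (s a)"
  by (induct j) (auto simp: s_v v_scale)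

lemma vj_vj: "(v ^^ i) ((v ^^ j) a) = (v ^^ (i + j)) a"
  by (simp add: funpow_add)

lemma v_vj: "v ((v ^^ j) a) = (v ^^ Suc j) a" by simp

lemma vj_v: "(v ^^ j) (v a) = (v ^^ Suc j) a" by (simp add: funpow_swap1)

text \<open>
  The coefficient of \<open>t\<close> in \<open>(v + t f) ^ L\<close>.
\<close>

definition deriv_pow :: "nat \<Rightarrow> ('a \<Rightarrow> 'a) \<Rightarrow> 'a \<Rightarrow> 'a" where
  "deriv_pow L f y = (\<Sum>j<L. (v ^^ j) (f ((v ^^ (L - 1 - j)) y)))"

lemma linear_deriv_pow: "linear_op f \<Longrightarrow> linear_op (deriv_pow L f)"
  unfolding additive_homogeneous_def deriv_pow_def
  by (auto simp: vjD scale_sum_right sum.distrib)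

text \<open>Only the summand \<open>j = 0\<close> does not begin with a factor \<open>v\<close>.
  Modulo the image of \<open>v\<close>, the operator is therefore governed by \<open>f\<close> at
  the bottom of the Jordan blocks.\<close>

lemma deriv_pow_leading:
  assumes "L > 0"
  shows "deriv_pow L f y = f ((v ^^ (L - 1)) y) +
    v (\<Sum>j<L - 1. (v ^^ j) (f ((v ^^ (L - 1 - Suc j)) y)))"
proof -
  obtain k where "L = Suc k" using assms by (cases L) auto
  then show ?thesis
    by (simp add: deriv_pow_def sum.lessThan_Suc_shift vD del: sum.lessThan_Suc)
qed

text \<open>The Leibniz rule for the commutator of \<open>f\<close> with the power
  \<open>v ^^ L\<close>: consecutive summands cancel, and only the two ends of the telescope
  survive.\<close>

lemma deriv_pow_commutator:
  "deriv_pow L (\<lambda>z. f (v z) - v (f z)) y = f ((v ^^ L) y) - (v ^^ L) (f y)"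
proof -
  have "(v ^^ j) (f (v ((v ^^ (L - 1 - j)) y)) - v (f ((v ^^ (L - 1 - j)) y))) =
      (v ^^ j) (f ((v ^^ (L - j)) y)) - (v ^^ Suc j) (f ((v ^^ (L - Suc j)) y))" if "j < L" for j
  proof -
    have "v ((v ^^ (L - 1 - j)) y) = (v ^^ (L - j)) y"
      unfolding v_vj using that by (simp add: Suc_diff_Suc)
    then show ?thesis by (simp add: vjD vj_v del: funpow.simps)
  qed
  then have "deriv_pow L (\<lambda>z. f (v z) - v (f z)) y =
      (\<Sum>j<L. (v ^^ j) (f ((v ^^ (L - j)) y)) - (v ^^ Suc j) (f ((v ^^ (L - Suc j)) y)))"
    unfolding deriv_pow_def by (intro sum.cong) auto
  also have "\<dots> = f ((v ^^ L) y) - (v ^^ L) (f y)"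
    by (subst sum_lessThan_telescope') simp
  finally show ?thesis .
qed

lemma deriv_pow_cong:
  assumes "\<And>z. z \<in> M \<Longrightarrow> f z = g z" "\<And>z. z \<in> M \<Longrightarrow> v z \<in> M" "y \<in> M"
  shows "deriv_pow L f y = deriv_pow L g y"
proof -
  have "(v ^^ j) y \<in> M" for j by (induct j) (use assms in auto)
  then show ?thesis unfolding deriv_pow_def by (intro sum.cong) (auto simp: assms)
qed

definition invariant :: "('a \<Rightarrow> 'a) \<Rightarrow> 'a set \<Rightarrow> bool" where
  "invariant f M \<longleftrightarrow> (\<forall>a\<in>M. f a \<in> M)"

lemma invariantD: "invariant f M \<Longrightarrow> a \<in> M \<Longrightarrow> f a \<in> M"
  by (simp add: invariant_def)

lemma invariant_funpow: "invariant f M \<Longrightarrow> invariant (f ^^ j) M"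
  by (induct j) (auto simp: invariant_def)

lemma invariant_deriv_pow:
  "subspace M \<Longrightarrow> invariant v M \<Longrightarrow> invariant f M \<Longrightarrow> invariant (deriv_pow L f) M"
  unfolding deriv_pow_def
  by (auto simp: invariant_def intro!: subspace_sum invariantD[OF invariant_funpow])

definition skew_on :: "'a set \<Rightarrow> ('a \<Rightarrow> 'a) \<Rightarrow> bool" where
  "skew_on M f \<longleftrightarrow> (\<forall>a\<in>M. \<forall>b\<in>M. form (f a) b = - form a (f b))"

text \<open>Each summand is a product of \<open>L\<close> skew factors, one \<open>w\<close> and
  \<open>L - 1\<close> copies of \<open>v\<close>. Passing to the adjoint gives \<open>L\<close>
  signs and reverses the product, which exchanges \<open>j\<close> with
  \<open>L - 1 - j\<close>.\<close>

lemma deriv_pow_adjoint: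
  assumes M: "invariant v M" "invariant w M" and sk: "skew_on M w"
    and ab: "a \<in> M" "b \<in> M"
  shows "form (deriv_pow L w a) b = (-1) ^ L * form a (deriv_pow L w b)"
proof -
  have m: "(v ^^ j) y \<in> M" if "y \<in> M" for j y
    using that invariant_funpow[OF M(1)] by (auto dest: invariantD)
  have "form (deriv_pow L w a) b = (\<Sum>j<L. form ((v ^^ j) (w ((v ^^ (L - 1 - j)) a))) b)"
    by (simp add: deriv_pow_def form_sum_left)
  also have "\<dots> = (\<Sum>j<L. (-1) ^ L * form a ((v ^^ (L - 1 - j)) (w ((v ^^ j) b))))"
  proof (intro sum.cong refl)
    fix j assume j: "j \<in> {..<L}"
    have "form ((v ^^ j) (w ((v ^^ (L - 1 - j)) a))) b
      = (-1) ^ j * (- ((-1) ^ (L - 1 - j) * form a ((v ^^ (L - 1 - j)) (w ((v ^^ j) b)))))"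
      using sk m ab by (simp add: form_vj skew_on_def)
    also have "\<dots> = (-1) ^ (j + 1 + (L - 1 - j)) * form a ((v ^^ (L - 1 - j)) (w ((v ^^ j) b)))"
      by (simp add: power_add)
    also have "j + 1 + (L - 1 - j) = L" using j by auto
    finally show "form ((v ^^ j) (w ((v ^^ (L - 1 - j)) a))) b
      = (-1) ^ L * form a ((v ^^ (L - 1 - j)) (w ((v ^^ j) b)))" .
  qed
  also have "\<dots> = (\<Sum>j<L. (-1) ^ L * form a ((v ^^ j) (w ((v ^^ (L - 1 - j)) b))))"
    by (subst sum.nat_diff_reindex[symmetric]) (auto intro!: sum.cong)
  finally show ?thesis
    by (simp add: deriv_pow_def form_sum_right sum_distrib_left)
qed

text \<open>Each of the \<open>L\<close> factors is odd and gives one sign. That this is the same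
  sign as for the adjoint is what \<open>commuting_skew_form_zero\<close> exploits.\<close>

lemma deriv_pow_parity:
  assumes "invariant v M" "\<And>a. a \<in> M \<Longrightarrow> w (s a) = - s (w a)" "linear_op w"
    and "a \<in> M" "invariant s M"
  shows "s (deriv_pow L w a) = (-1) ^ L *s deriv_pow L w (s a)"
proof -
  have m: "(v ^^ j) y \<in> M" if "y \<in> M" for j y
    using that invariant_funpow[OF assms(1)] by (auto dest: invariantD)
  have "s ((v ^^ j) (w ((v ^^ (L - 1 - j)) a))) = (-1) ^ L *s (v ^^ j) (w ((v ^^ (L - 1 - j)) (s a)))"
    if "j < L" for j
  proof -
    have "s ((v ^^ j) (w ((v ^^ (L - 1 - j)) a))) = (-1) ^ j *s (v ^^ j) (- w (s ((v ^^ (L - 1 - j)) a)))"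
      using assms(2)[OF m[OF assms(4)]] by (simp add: s_vj)
    also have "\<dots> = (-1) ^ (j + 1 + (L - 1 - j)) *s (v ^^ j) (w ((v ^^ (L - 1 - j)) (s a)))"
      by (simp add: s_vj linear_opD[OF assms(3)] vjD power_add)
    also have "j + 1 + (L - 1 - j) = L" using that by auto
    finally show ?thesis .
  qed
  then show ?thesis
    by (simp add: deriv_pow_def sD scale_sum_right)
qed

end

section \<open>A single block: nondegeneracy, orthogonal projection, and the commutant of
  \<open>v\<close> and \<open>E\<close>\<close>

text \<open>The first alternative of \<open>pairing\<close> is one Jordan block in duality with
  itself, the second two blocks in duality with each other. Allowing \<open>u = u'\<close> lets one
  set of formulas serve both. The signs \<open>e\<close> and \<open>e'\<close> are the parities of
  the generators.\<close>

locale symplectic_block = graded_symplectic +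
  fixes u u' :: 'b and L :: nat and e e' :: 'a
  assumes L_pos: "L > 0"
    and top: "(v ^^ L) u = 0" "(v ^^ L) u' = 0"
    and hom: "s u = e *s u" "s u' = e' *s u'" "e * e = 1" "e' * e' = 1"
    and pairing: "u = u' \<and> form ((v ^^ (L - 1)) u) u \<noteq> 0 \<or>
      form ((v ^^ (L - 1)) u) u = 0 \<and> form ((v ^^ (L - 1)) u') u' = 0 \<and>
      form ((v ^^ (L - 1)) u) u' \<noteq> 0 \<and> form ((v ^^ (L - 1)) u') u \<noteq> 0"
begin

text \<open>Skew operators correspond to the symmetric square of the symplectic space, and this one
  to the sum of the squares of \<open>u\<close> and \<open>u'\<close>. It is odd because
  \<open>u\<close> and \<open>u'\<close> are homogeneous.\<close>

definition w1 :: "'b \<Rightarrow> 'b" where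
  "w1 y = form y u *s u + form y u' *s u'"

definition N :: "'b set" where
  "N = span (range (\<lambda>j. (v ^^ j) u) \<union> range (\<lambda>j. (v ^^ j) u'))"

lemma w1_linear: "linear_op w1"
  by (auto simp: additive_homogeneous_def w1_def form_simps scale_left_distrib
      scale_right_distrib)

lemma w1_skew: "form (w1 a) b = - form a (w1 b)"
  unfolding w1_def using form_swap[of u b] form_swap[of u' b] by (simp add: form_simps)

lemma neg_one_power_cancel: "(- 1) ^ j * ((- 1) ^ j * r) = (r :: 'a)"
  by (cases "even j") auto

lemma form_s_hom: "s a = c *s a \<Longrightarrow> c * c = 1 \<Longrightarrow> form (s y) a = - (c * form y a)"
proof -
  assume a: "s a = c *s a" "c * c = 1"
  have "form (s y) a = (c * c) * form (s y) a" by (simp add: a(2))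
  also have "\<dots> = c * (c * form (s y) a)" by (rule mult.assoc)
  also have "c * form (s y) a = form (s y) (s a)" by (simp add: a(1) form_scale_right)
  finally show ?thesis by (simp add: form_s)
qed

lemma w1_odd: "w1 (s y) = - s (w1 y)"
  unfolding w1_def
  by (simp add: form_s_hom[OF hom(1,3)] form_s_hom[OF hom(2,4)] sD hom(1,2) mult.commute)

text \<open>The bottom of a block is sent back to a generator, since it pairs with exactly one of
  them. For \<open>u = u'\<close> the two terms of \<open>w1\<close> coincide, whence the factor 2,
  which is nonzero in characteristic 0.\<close>

lemma ex_d: "\<exists>d d'. d \<noteq> 0 \<and> d' \<noteq> 0 \<and> w1 ((v ^^ (L - 1)) u) = d *s u' \<and>
    w1 ((v ^^ (L - 1)) u') = d' *s u"
  using pairing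
proof
  assume a: "u = u' \<and> form ((v ^^ (L - 1)) u) u \<noteq> 0"
  then have eq: "u' = u" by simp
  have "w1 ((v ^^ (L - 1)) u) = (2 * form ((v ^^ (L - 1)) u) u) *s u"
    by (subst w1_def) (simp only: eq mult_2 scale_left_distrib)
  with a show ?thesis
    by (intro exI[of _ "2 * form ((v ^^ (L - 1)) u) u"] conjI) auto
next
  assume "form ((v ^^ (L - 1)) u) u = 0 \<and> form ((v ^^ (L - 1)) u') u' = 0 \<and>
      form ((v ^^ (L - 1)) u) u' \<noteq> 0 \<and> form ((v ^^ (L - 1)) u') u \<noteq> 0"
  then show ?thesis
    by (intro exI[of _ "form ((v ^^ (L - 1)) u) u'"] exI[of _ "form ((v ^^ (L - 1)) u') u"])
      (auto simp: w1_def)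
qed

lemma subspace_N: "subspace N"
  by (simp add: N_def)

lemma vj_u_N: "(v ^^ j) u \<in> N" "(v ^^ j) u' \<in> N"
  by (auto simp: N_def intro: span_base)

lemma u_N: "u \<in> N" "u' \<in> N" "p *s u + q *s u' \<in> N"
  using vj_u_N[of 0] by (auto intro!: subspace_add[OF subspace_N] subspace_scale[OF subspace_N])

lemma w1_N: "w1 y \<in> N"
  unfolding w1_def by (rule u_N)

lemma N_induct [consumes 1, case_names subspace gen]:
  assumes "n \<in> N" "subspace {y. P y}" "\<And>j t. t = u \<or> t = u' \<Longrightarrow> P ((v ^^ j) t)"
  shows "P n"
  using span_induct[OF assms(1)[unfolded N_def], of P] assms(2,3) by auto

lemma v_N: "invariant v N"
  unfolding invariant_def
proof
  fix a assume "a \<in> N"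
  then show "v a \<in> N"
  proof (induct rule: N_induct)
    case subspace
    then show ?case
      by (auto simp: subspace_def vD intro: subspace_add[OF subspace_N]
          subspace_scale[OF subspace_N] subspace_0[OF subspace_N])
  next
    case (gen j t)
    then show ?case using vj_u_N[of "Suc j"] by auto
  qed
qed

lemma s_N: "invariant s N"
  unfolding invariant_def
proof
  fix a assume "a \<in> N"
  then show "s a \<in> N"
  proof (induct rule: N_induct)
    case subspace
    then show ?case
      by (auto simp: subspace_def sD intro: subspace_add[OF subspace_N]
          subspace_scale[OF subspace_N] subspace_0[OF subspace_N])
  next
    case (gen j t)
    then show ?case using vj_u_N[of "j"] hom
      by (auto simp: s_vj vjD intro!: subspace_scale[OF subspace_N])
  qed
qed

lemma N_decomp: "n \<in> N \<Longrightarrow> \<exists>p q. \<exists>n'\<in>N. n = p *s u + q *s u' + v n'"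
proof (induct rule: N_induct)
  case subspace
  have 1: "\<exists>p q. \<exists>n'\<in>N. 0 = p *s u + q *s u' + v n'"
    by (intro exI[of _ 0] bexI[of _ 0]) (auto simp: vD subspace_0[OF subspace_N])
  have 2: "\<exists>p q. \<exists>n'\<in>N. x + y = p *s u + q *s u' + v n'"
    if "\<exists>p q. \<exists>n'\<in>N. x = p *s u + q *s u' + v n'" "\<exists>p q. \<exists>n'\<in>N. y = p *s u + q *s u' + v n'"
    for x y
  proof -
    from that obtain p q n p' q' n' where "n \<in> N" "n' \<in> N" "x = p *s u + q *s u' + v n"
      "y = p' *s u + q' *s u' + v n'" by blast
    then show ?thesis
      by (intro exI[of _ "p + p'"] exI[of _ "q + q'"] bexI[of _ "n + n'"])
        (auto simp: vD scale_left_distrib intro: subspace_add[OF subspace_N])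
  qed
  have 3: "\<exists>p q. \<exists>n'\<in>N. c *s x = p *s u + q *s u' + v n'"
    if x: "\<exists>p q. \<exists>n'\<in>N. x = p *s u + q *s u' + v n'" for c x
  proof -
    from x obtain p q n where "n \<in> N" "x = p *s u + q *s u' + v n" by blast
    then show ?thesis
      by (intro exI[of _ "c * p"] exI[of _ "c * q"] bexI[of _ "c *s n"])
        (auto simp: vD scale_right_distrib intro: subspace_scale[OF subspace_N])
  qed
  show ?case unfolding subspace_def using 1 2 3 by simp
next
  case (gen j t)
  show ?case
  proof (cases j)
    case 0
    have "\<exists>p q. t = p *s u + q *s u' + v 0"
    proof (cases "t = u")
      case True
      then show ?thesis by (intro exI[of _ 1] exI[of _ 0]) (simp add: vD)
    next
      case False
      then show ?thesis using gen by (intro exI[of _ 0] exI[of _ 1]) (simp add: vD)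
    qed
    then show ?thesis using 0 subspace_0[OF subspace_N] by auto
  next
    case (Suc i)
    show ?thesis
      by (intro exI[of _ 0] bexI[of _ "(v ^^ i) t"]) (use gen Suc vj_u_N in auto)
  qed
qed

lemma N_top: "n \<in> N \<Longrightarrow> (v ^^ L) n = 0"
proof (induct rule: N_induct)
  case subspace
  then show ?case by (auto simp: subspace_def vjD)
next
  case (gen j t)
  have "(v ^^ L) ((v ^^ j) t) = (v ^^ j) ((v ^^ L) t)"
    by (simp add: vj_vj add.commute)
  then show ?case using gen top by (auto simp: vjD)
qed

lemma orthI:
  assumes "\<And>j t. j < L \<Longrightarrow> t = u \<or> t = u' \<Longrightarrow> form y ((v ^^ j) t) = 0" and "n \<in> N"
  shows "form y n = 0"
  using assms(2)
proof (induct rule: N_induct)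
  case subspace
  then show ?case by (auto simp: subspace_def form_simps)
next
  case (gen j t)
  show ?case
  proof (cases "j < L")
    case False
    then have "(v ^^ j) t = (v ^^ (j - L)) ((v ^^ L) t)" by (simp add: vj_vj)
    then show ?thesis using gen top by (auto simp: vjD)
  qed (use assms gen in auto)
qed

lemma form_uu:
  "form u ((v ^^ (L - 1)) u) = - form ((v ^^ (L - 1)) u) u"
  "form u ((v ^^ (L - 1)) u') = - form ((v ^^ (L - 1)) u') u"
  "form u' ((v ^^ (L - 1)) u) = - form ((v ^^ (L - 1)) u) u'"
  "form u' ((v ^^ (L - 1)) u') = - form ((v ^^ (L - 1)) u') u'"
  by (rule form_swap)+

lemmas form_uu_Suc = form_uu[unfolded One_nat_def]

text \<open>The Gram matrix of the top layer \<open>u\<close>, \<open>u'\<close> against the bottom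
  layer of the block is a nonzero scalar or an antidiagonal matrix with nonzero entries, hence
  invertible. For \<open>u = u'\<close> only \<open>p + q\<close> matters.\<close>

lemma pair_inj:
  assumes "form (p *s u + q *s u') ((v ^^ (L - 1)) u) = 0"
    and "form (p *s u + q *s u') ((v ^^ (L - 1)) u') = 0"
  shows "p *s u + q *s u' = 0"
  using pairing
proof
  assume a: "u = u' \<and> form ((v ^^ (L - 1)) u) u \<noteq> 0"
  then have "p * form u ((v ^^ (L - 1)) u) + q * form u ((v ^^ (L - 1)) u) = 0"
    using assms(1) by (simp only: form_simps)
  then have "(p + q) * form ((v ^^ (L - 1)) u) u = 0"
    unfolding form_uu by (simp add: distrib_right neg_eq_iff_add_eq_0)
  then have "p + q = 0" using conjunct2[OF a] by (metis mult_eq_0_iff)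
  then show ?thesis using a by (simp flip: scale_left_distrib)
next
  assume "form ((v ^^ (L - 1)) u) u = 0 \<and> form ((v ^^ (L - 1)) u') u' = 0 \<and>
      form ((v ^^ (L - 1)) u) u' \<noteq> 0 \<and> form ((v ^^ (L - 1)) u') u \<noteq> 0"
  then show ?thesis using assms by (simp add: form_simps form_uu_Suc)
qed

lemma pair_surj:
  "\<exists>p q. form (p *s u + q *s u') ((v ^^ (L - 1)) u) = f u \<and>
    form (p *s u + q *s u') ((v ^^ (L - 1)) u') = f u'"
  using pairing
proof
  assume a: "u = u' \<and> form ((v ^^ (L - 1)) u) u \<noteq> 0"
  have "form ((- f u / form ((v ^^ (L - 1)) u) u) *s u + 0 *s u) ((v ^^ (L - 1)) u) = f u"
    using conjunct2[OF a] unfolding form_add_left form_scale_left form_uu(1) by simp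
  with a show ?thesis by metis
next
  assume "form ((v ^^ (L - 1)) u) u = 0 \<and> form ((v ^^ (L - 1)) u') u' = 0 \<and>
      form ((v ^^ (L - 1)) u) u' \<noteq> 0 \<and> form ((v ^^ (L - 1)) u') u \<noteq> 0"
  then show ?thesis
    by (rule_tac exI[of _ "- f u' / form ((v ^^ (L - 1)) u') u"],
        rule_tac exI[of _ "- f u / form ((v ^^ (L - 1)) u) u'"])
      (auto simp: form_simps form_uu_Suc)
qed

text \<open>An orthogonal \<open>y\<close> can be divided by \<open>v\<close> again and again: if
  \<open>y = (v ^^ j) n\<close>, pairing with \<open>(v ^^ (L - 1 - j)) t\<close> for a generator
  \<open>t\<close> sees only the top layer of \<open>n\<close>, which must vanish, so
  \<open>n\<close> lies in \<open>v N\<close>. After \<open>L\<close> divisions \<open>y\<close> is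
  0.\<close>

lemma nondegenerate_N:
  assumes y: "y \<in> N" and orth: "\<And>n. n \<in> N \<Longrightarrow> form y n = 0"
  shows "y = 0"
proof -
  have "\<exists>n\<in>N. y = (v ^^ j) n" if "j \<le> L" for j
    using that
  proof (induct j)
    case 0
    then show ?case using y by auto
  next
    case (Suc j)
    then obtain n where n: "n \<in> N" "y = (v ^^ j) n" by auto
    from N_decomp[OF n(1)] obtain p q n' where n': "n' \<in> N" "n = p *s u + q *s u' + v n'" by auto
    have z: "form (p *s u + q *s u') ((v ^^ (L - 1)) t) = 0" if t: "t = u \<or> t = u'" for t
    proof -
      have sum: "j + (L - 1 - j) = L - 1" using Suc by simp
      have "0 = form y ((v ^^ (L - 1 - j)) t)" using orth t vj_u_N by metis
      also have "y = (v ^^ j) (p *s u + q *s u' + v n')" using n n' by simp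
      also have "form \<dots> ((v ^^ (L - 1 - j)) t) = (-1) ^ j * form (p *s u + q *s u' + v n') ((v ^^ (L - 1)) t)"
        by (simp only: form_vj vj_vj sum)
      also have "form (p *s u + q *s u' + v n') ((v ^^ (L - 1)) t) =
          form (p *s u + q *s u') ((v ^^ (L - 1)) t) - form n' ((v ^^ L) t)"
        using L_pos by (simp add: form_add_left form_v v_vj del: funpow.simps)
      also have "(v ^^ L) t = 0" using t top by auto
      finally show ?thesis by simp
    qed
    have "p *s u + q *s u' = 0" by (intro pair_inj z) auto
    then have "y = (v ^^ Suc j) n'" using n n' by (simp add: vj_v del: funpow.simps)
    then show ?case using n' by auto
  qed
  from this[of L] show ?thesis using N_top by auto
qed

text \<open>Elimination from the bottom layer upwards: a correction \<open>(v ^^ j) k\<close> with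
  \<open>k\<close> in the top layer repairs the pairings with layer \<open>L - 1 - j\<close>. It
  leaves the lower layers alone, because \<open>v ^^ (j + i)\<close> kills the generators once
  \<open>i + j \<ge> L\<close>.\<close>

lemma ex_proj: "\<exists>n\<in>N. \<forall>m\<in>N. form (y - n) m = 0"
proof -
  have "\<exists>n\<in>N. \<forall>i t. i + j \<ge> L \<longrightarrow> i < L \<longrightarrow> t = u \<or> t = u' \<longrightarrow> form (y - n) ((v ^^ i) t) = 0"
    if "j \<le> L" for j
    using that
  proof (induct j)
    case 0
    then show ?case using u_N by auto
  next
    case (Suc j)
    then obtain n where n: "n \<in> N"
      "\<And>i t. i + j \<ge> L \<Longrightarrow> i < L \<Longrightarrow> t = u \<or> t = u' \<Longrightarrow> form (y - n) ((v ^^ i) t) = 0" by force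
    define f where "f t = (-1) ^ j * form (y - n) ((v ^^ (L - 1 - j)) t)" for t
    obtain p q where pq: "form (p *s u + q *s u') ((v ^^ (L - 1)) u) = f u"
      "form (p *s u + q *s u') ((v ^^ (L - 1)) u') = f u'" using pair_surj by blast
    define k where "k = p *s u + q *s u'"
    have k: "form k ((v ^^ (L - 1)) t) = f t" if "t = u \<or> t = u'" for t
      using pq that by (auto simp: k_def)
    have "form (y - (n + (v ^^ j) k)) ((v ^^ i) t) = 0"
      if i: "i + Suc j \<ge> L" "i < L" and t: "t = u \<or> t = u'" for i t
    proof (cases "i + j \<ge> L")
      case True
      then have "(v ^^ (j + i)) t = (v ^^ (j + i - L)) ((v ^^ L) t)" by (simp add: vj_vj)
      then have "(v ^^ (j + i)) t = 0" using t top by (auto simp: vjD)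
      moreover have "form (y - n) ((v ^^ i) t) = 0" using n True i t by blast
      ultimately show ?thesis
        by (simp add: form_vj vj_vj form_diff_left form_add_left)
    next
      case False
      then have "i = L - 1 - j" "j + i = L - 1" using i by auto
      then show ?thesis using k[OF t]
        by (simp add: form_vj vj_vj form_diff_left form_add_left f_def neg_one_power_cancel)
    qed
    moreover have "n + (v ^^ j) k \<in> N"
      using n u_N invariantD[OF invariant_funpow[OF v_N]] subspace_add[OF subspace_N] by (simp add: k_def)
    ultimately show ?case by blast
  qed
  from this[of L] obtain n where n: "n \<in> N"
    "\<And>i t. i < L \<Longrightarrow> t = u \<or> t = u' \<Longrightarrow> form (y - n) ((v ^^ i) t) = 0" by force
  then show ?thesis using orthI by blast
qed


definition pr :: "'b \<Rightarrow> 'b" where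
  "pr y = (THE n. n \<in> N \<and> (\<forall>m\<in>N. form (y - n) m = 0))"

lemma pr_unique:
  assumes "n \<in> N" "\<And>m. m \<in> N \<Longrightarrow> form (y - n) m = 0"
  shows "pr y = n"
  unfolding pr_def
proof (rule the_equality)
  fix n' assume n': "n' \<in> N \<and> (\<forall>m\<in>N. form (y - n') m = 0)"
  have "n' - n = 0"
  proof (rule nondegenerate_N)
    show "n' - n \<in> N" using n' assms subspace_diff[OF subspace_N] by auto
    fix m assume m: "m \<in> N"
    have "form (y - n) m = 0" "form (y - n') m = 0" using assms n' m by auto
    then show "form (n' - n) m = 0" by (simp add: form_diff_left)
  qed
  then show "n' = n" by simp
qed (use assms in auto)

lemma pr_N: "pr y \<in> N" and pr_orth: "m \<in> N \<Longrightarrow> form (y - pr y) m = 0"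
  using ex_proj[of y] pr_unique by metis+

lemma pr_linear: "linear_op pr"
  unfolding additive_homogeneous_def
proof (intro conjI allI)
  fix a b c
  show "pr (a + b) = pr a + pr b"
  proof (rule pr_unique)
    fix m assume "m \<in> N"
    from pr_orth[OF this, of a] pr_orth[OF this, of b]
    show "form (a + b - (pr a + pr b)) m = 0" by (simp add: form_diff_left form_add_left)
  qed (use pr_N subspace_add[OF subspace_N] in auto)
  show "pr (c *s a) = c *s pr a"
  proof (rule pr_unique)
    fix m assume "m \<in> N"
    from pr_orth[OF this, of a]
    show "form (c *s a - c *s pr a) m = 0" by (simp add: form_diff_left form_scale_left)
  qed (use pr_N subspace_scale[OF subspace_N] in auto)
qed

lemma pr_v: "pr (v y) = v (pr y)"
proof (rule pr_unique)
  fix m assume "m \<in> N"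
  with pr_orth[of "v m" y] v_N show "form (v y - v (pr y)) m = 0"
    by (simp add: form_v invariant_def flip: vD)
qed (use pr_N v_N in \<open>auto simp: invariant_def\<close>)

lemma pr_s: "pr (s y) = s (pr y)"
proof (rule pr_unique)
  fix m assume "m \<in> N"
  with pr_orth[of "s m" y] s_N have "form (y - pr y) (s m) = 0"
    by (simp add: invariant_def)
  then show "form (s y - s (pr y)) m = 0"
    using form_s[of "y - pr y" "s m"] by (simp add: s_s flip: sD)
qed (use pr_N s_N in \<open>auto simp: invariant_def\<close>)

lemma pr_id: "n \<in> N \<Longrightarrow> pr n = n"
  by (rule pr_unique) auto

lemma pr_orth_zero: "(\<And>m. m \<in> N \<Longrightarrow> form y m = 0) \<Longrightarrow> pr y = 0"
  by (rule pr_unique) (auto simp: subspace_0[OF subspace_N])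

definition E1 :: "'b \<Rightarrow> 'b" where "E1 = deriv_pow L w1"

lemma E1_linear: "linear_op E1"
  unfolding E1_def by (rule linear_deriv_pow[OF w1_linear])

lemma E1_N: "invariant E1 N"
  unfolding E1_def
  by (rule invariant_deriv_pow[OF subspace_N v_N]) (simp add: invariant_def w1_N)

text \<open>The derivative in the direction of the commutator of \<open>w1\<close> and
  \<open>v\<close> is on the one hand the commutator of \<open>E1\<close> and \<open>v\<close>, on
  the other hand the telescoped \<open>w1 v^L - v^L w1\<close>, which vanishes on
  \<open>N\<close>.\<close>

lemma E1_v: "n \<in> N \<Longrightarrow> E1 (v n) = v (E1 n)"
proof -
  assume n: "n \<in> N"
  have "deriv_pow L (\<lambda>z. w1 (v z) - v (w1 z)) n = 0"
    using n by (simp add: deriv_pow_commutator N_top w1_N linear_opD[OF w1_linear])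
  moreover have "deriv_pow L (\<lambda>z. w1 (v z) - v (w1 z)) n = E1 (v n) - v (E1 n)"
    by (simp add: E1_def deriv_pow_def vjD vD sum_subtractf funpow_swap1[where f=v])
  ultimately show ?thesis by simp
qed

lemma E1_vj: "n \<in> N \<Longrightarrow> E1 ((v ^^ j) n) = (v ^^ j) (E1 n)"
  by (induct j) (auto simp: E1_v invariantD[OF invariant_funpow[OF v_N]])

lemma E1_leading: "\<exists>n\<in>N. E1 y = w1 ((v ^^ (L - 1)) y) + v n"
proof -
  have "E1 y = w1 ((v ^^ (L - 1)) y) + v (\<Sum>j<L - 1. (v ^^ j) (w1 ((v ^^ (L - 1 - Suc j)) y)))"
    unfolding E1_def by (rule deriv_pow_leading[OF L_pos])
  then show ?thesis
    by (intro bexI[of _ "\<Sum>j<L - 1. (v ^^ j) (w1 ((v ^^ (L - 1 - Suc j)) y))"])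
      (auto intro!: subspace_sum[OF subspace_N] invariantD[OF invariant_funpow[OF v_N]] w1_N)
qed

text \<open>Modulo \<open>v N\<close>, \<open>E1\<close> exchanges the generators up to the factors
  of \<open>ex_d\<close>, so its square is the product of these factors; this is the scalar
  \<open>\<kappa>\<close>. The last conjunct is kept to replace \<open>u'\<close> by
  \<open>E1 u\<close> when spanning \<open>N\<close>.\<close>

lemma ex_E1_square:
  "\<exists>d. d \<noteq> 0 \<and> (\<forall>n\<in>N. \<exists>n'\<in>N. E1 (E1 n) - d *s n = v n') \<and>
     (\<exists>d1. d1 \<noteq> 0 \<and> (\<exists>n\<in>N. E1 u = d1 *s u' + v n))"
proof -
  obtain d d' where d: "d \<noteq> 0" "d' \<noteq> 0" "w1 ((v ^^ (L - 1)) u) = d *s u'"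
    "w1 ((v ^^ (L - 1)) u') = d' *s u" using ex_d by blast
  obtain n n' where n: "n \<in> N" "n' \<in> N" "E1 u = d *s u' + v n" "E1 u' = d' *s u + v n'"
    using E1_leading[of u] E1_leading[of u'] d by auto
  have vN: "subspace {y. \<exists>n'\<in>N. y = v n'}"
  proof -
    have "{y. \<exists>n'\<in>N. y = v n'} = v ` N" by auto
    moreover have "subspace (v ` N)"
      unfolding subspace_def
      by (auto simp: image_iff intro: bexI[of _ 0] bexI[of _ "_ + _"] bexI[of _ "_ *s _"]
          simp: vD subspace_0[OF subspace_N] subspace_add[OF subspace_N] subspace_scale[OF subspace_N]
          simp flip: vD(1,2))
    ultimately show ?thesis by simp
  qed
  have "\<exists>n'\<in>N. E1 (E1 m) - (d * d') *s m = v n'" if "m \<in> N" for m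
    using that
  proof (induct rule: N_induct)
    case subspace
    have eq: "E1 (E1 (a + b)) - (d * d') *s (a + b) =
        (E1 (E1 a) - (d * d') *s a) + (E1 (E1 b) - (d * d') *s b)"
      "E1 (E1 (c *s a)) - (d * d') *s (c *s a) = c *s (E1 (E1 a) - (d * d') *s a)"
      "E1 (E1 0) - (d * d') *s 0 = 0" for a b c
      by (simp_all add: linear_opD[OF E1_linear] scale_right_distrib scale_right_diff_distrib
          mult.commute)
    show ?case
      unfolding subspace_def mem_Collect_eq eq
      using vN unfolding subspace_def mem_Collect_eq by blast
  next
    case (gen j t)
    \<comment> \<open>Applying \<open>E1\<close> to \<open>E1 u = d u' + v n\<close> gives
      \<open>d d' u + d v n' + v (E1 n)\<close>, which explains the witness.\<close>
    have "\<exists>m\<in>N. E1 (E1 u) - (d * d') *s u = v m"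
      using n invariantD[OF E1_N] subspace_add[OF subspace_N] subspace_scale[OF subspace_N]
      by (intro bexI[of _ "d *s n' + E1 n"])
        (auto simp: linear_opD[OF E1_linear] E1_v vD scale_right_distrib)
    moreover have "\<exists>m\<in>N. E1 (E1 u') - (d * d') *s u' = v m"
      using n invariantD[OF E1_N] subspace_add[OF subspace_N] subspace_scale[OF subspace_N]
      by (intro bexI[of _ "d' *s n + E1 n'"])
        (auto simp: linear_opD[OF E1_linear] E1_v vD scale_right_distrib mult.commute)
    ultimately obtain m where m: "m \<in> N" "E1 (E1 t) - (d * d') *s t = v m" using gen by auto
    have t: "t \<in> N" "E1 t \<in> N" using gen u_N E1_N by (auto simp: invariant_def)
    have "E1 (E1 ((v ^^ j) t)) - (d * d') *s (v ^^ j) t = (v ^^ j) (E1 (E1 t) - (d * d') *s t)"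
      using t by (simp add: E1_vj vjD)
    also have "\<dots> = v ((v ^^ j) m)" using m by (simp add: funpow_swap1)
    finally show ?case using m invariantD[OF invariant_funpow[OF v_N]] by blast
  qed
  then show ?thesis using d n by (intro exI[of _ "d * d'"]) auto
qed


text \<open>Let \<open>k\<close> be the value in question. Moving \<open>x\<close> across the form,
  commuting it with \<open>F\<close> and moving \<open>F\<close> back gives \<open>k = r k\<close>;
  inserting \<open>s\<close> in both arguments gives \<open>- k = r k\<close>, since the parity of
  \<open>u\<close> enters twice. The argument needs the same sign \<open>r\<close> for the adjoint
  and for the parity of \<open>F\<close>.\<close>

lemma commuting_skew_form_zero:
  assumes "r * r = 1"
    and "\<And>a b. a \<in> N \<Longrightarrow> b \<in> N \<Longrightarrow> form (F a) b = r * form a (F b)"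
    and "\<And>a. a \<in> N \<Longrightarrow> s (F a) = r *s F (s a)"
    and "linear_op F"
    and "linear_op x" "invariant x N" "skew_on N x" "\<And>a. a \<in> N \<Longrightarrow> x (s a) = s (x a)"
    and "\<And>a. a \<in> N \<Longrightarrow> x (F a) = F (x a)" "invariant F N"
  shows "form (x u) (F u) = 0"
proof -
  define k where "k = form (x u) (F u)"
  have u: "u \<in> N" "x u \<in> N" "F u \<in> N" using u_N assms(6,10) by (auto simp: invariant_def)
  have "k = - form u (F (x u))"
    using assms(7,9) u by (simp add: k_def skew_on_def)
  also have "form u (F (x u)) = r * form (F u) (x u)"
    using assms(2)[of u "x u"] u assms(1) by (simp flip: mult.assoc)
  also have "form (F u) (x u) = - k" unfolding k_def by (rule form_swap)
  finally have 1: "k = r * k" by simp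
  have "form (s (x u)) (s (F u)) = - k" by (simp add: form_s k_def)
  moreover have "s (x u) = e *s x u"
    using assms(8)[of u] u hom by (simp add: linear_opD[OF assms(5)])
  moreover have "s (F u) = (r * e) *s F u"
    using assms(3)[of u] u hom by (simp add: linear_opD[OF assms(4)])
  ultimately have "- k = (e * e) * (r * k)" by (simp add: form_simps k_def mult_ac)
  then have "- k = k" using hom 1 by simp
  then show ?thesis unfolding k_def[symmetric] by simp
qed

text \<open>The preceding lemma with \<open>F = v^j\<close> and \<open>F = v^j E1\<close> makes
  \<open>x u\<close> orthogonal to vectors that span \<open>N\<close>, so \<open>x u = 0\<close>.
  The same vectors are images of \<open>u\<close> under operators commuting with \<open>x\<close>,
  so \<open>x\<close> kills them all.\<close>

lemma commutant_zero:
  assumes x: "linear_op x" "invariant x N" "skew_on N x" "\<And>a. a \<in> N \<Longrightarrow> x (s a) = s (x a)"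
    and xv: "\<And>a. a \<in> N \<Longrightarrow> x (v a) = v (x a)"
    and xE: "\<And>a. a \<in> N \<Longrightarrow> x (E1 a) = E1 (x a)"
    and n: "n \<in> N"
  shows "x n = 0"
proof -
  have vjN: "(v ^^ j) a \<in> N" if "a \<in> N" for j a
    using that invariantD[OF invariant_funpow[OF v_N]] by simp
  have xvj: "x ((v ^^ j) a) = (v ^^ j) (x a)" if "a \<in> N" for j a
    using that by (induct j) (auto simp: xv vjN)
  have EN: "E1 a \<in> N" if "a \<in> N" for a using that E1_N by (simp add: invariant_def)
  have w1inv: "invariant w1 N" "skew_on N w1"
    by (auto simp: invariant_def skew_on_def w1_N w1_skew)
  have adj: "form (E1 a) b = (-1) ^ L * form a (E1 b)" if "a \<in> N" "b \<in> N" for a b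
    unfolding E1_def using that by (intro deriv_pow_adjoint[OF v_N w1inv])
  have par: "s (E1 a) = (-1) ^ L *s E1 (s a)" if "a \<in> N" for a
    unfolding E1_def using that
    by (intro deriv_pow_parity[OF v_N _ w1_linear _ s_N]) (auto simp: w1_odd)
  have f1: "form (x u) ((v ^^ j) u) = 0" for j
    by (rule commuting_skew_form_zero[OF _ _ _ linear_vj x, where r = "(-1) ^ j"])
      (auto simp: form_vj s_vj xvj invariant_funpow[OF v_N] simp flip: power_mult_distrib)
  have f2: "form (x u) ((v ^^ j) (E1 u)) = 0" for j
  proof (rule commuting_skew_form_zero[OF _ _ _ linear_comp[OF linear_vj E1_linear] x,
        where r = "(-1) ^ j * (-1) ^ L"])
    show "(-1) ^ j * (-1) ^ L * ((-1) ^ j * (-1) ^ L) = (1 :: 'a)"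
      by (cases "even j"; cases "even L") auto
    show "form ((v ^^ j) (E1 a)) b = (-1) ^ j * (-1) ^ L * form a ((v ^^ j) (E1 b))"
      if "a \<in> N" "b \<in> N" for a b
      using that adj[OF that(1) vjN[OF that(2), of j]] by (simp add: form_vj E1_vj)
    show "s ((v ^^ j) (E1 a)) = ((-1) ^ j * (-1) ^ L) *s (v ^^ j) (E1 (s a))" if "a \<in> N" for a
      using par[OF that] by (simp add: s_vj vjD)
    show "x ((v ^^ j) (E1 a)) = (v ^^ j) (E1 (x a))" if "a \<in> N" for a
      using that by (simp add: xvj xE EN)
    show "invariant (\<lambda>a. (v ^^ j) (E1 a)) N" by (simp add: invariant_def vjN EN)
  qed
  obtain d1 n1 where d1: "d1 \<noteq> 0" "n1 \<in> N" "E1 u = d1 *s u' + v n1"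
    using ex_E1_square by blast
  have u': "(v ^^ j) u' = inverse d1 *s ((v ^^ j) (E1 u) - (v ^^ Suc j) n1)" for j
    using d1 by (simp add: vjD vj_v del: funpow.simps)
  \<comment> \<open>Descending induction on the power of \<open>v\<close>, starting at
    \<open>v^L N = 0\<close>: modulo \<open>v^(j+1) N\<close>, the space \<open>v^j N\<close> is
    spanned by \<open>v^j u\<close> and \<open>v^j (E1 u)\<close>.\<close>
  have "\<forall>a\<in>N. form (x u) ((v ^^ (L - i)) a) = 0" if "i \<le> L" for i
    using that
  proof (induct i)
    case 0
    then show ?case by (simp add: N_top)
  next
    case (Suc i)
    define j where "j = L - Suc i"
    have IH: "form (x u) ((v ^^ Suc j) a) = 0" if "a \<in> N" for a
      using Suc that by (simp add: j_def Suc_diff_Suc del: funpow.simps)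
    have "form (x u) ((v ^^ j) a) = 0" if a: "a \<in> N" for a
    proof -
      from N_decomp[OF a] obtain p q n' where n': "n' \<in> N" "a = p *s u + q *s u' + v n'" by blast
      have "(v ^^ j) a = p *s (v ^^ j) u + q *s (v ^^ j) u' + (v ^^ Suc j) n'"
        unfolding n'(2) vjD vj_v ..
      moreover have "form (x u) ((v ^^ j) u') = 0"
        unfolding u' form_simps f2 IH[OF d1(2)] by simp
      ultimately show ?thesis
        using IH[OF n'(1)] f1[of j] by (simp add: form_simps del: funpow.simps)
    qed
    then show ?case by (simp add: j_def)
  qed
  from this[of L] have "form (x u) a = 0" if "a \<in> N" for a using that by simp
  then have xu: "x u = 0"
    using nondegenerate_N[of "x u"] x(2) u_N by (auto simp: invariant_def)
  \<comment> \<open>The same descending induction, now for the values of \<open>x\<close>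
    itself.\<close>
  have "\<forall>a\<in>N. x ((v ^^ (L - i)) a) = 0" if "i \<le> L" for i
    using that
  proof (induct i)
    case 0
    then show ?case by (simp add: N_top linear_opD[OF x(1)])
  next
    case (Suc i)
    define j where "j = L - Suc i"
    have IH: "x ((v ^^ Suc j) a) = 0" if "a \<in> N" for a
      using Suc that by (simp add: j_def Suc_diff_Suc del: funpow.simps)
    have z: "x ((v ^^ j) u) = 0" "x ((v ^^ j) (E1 u)) = 0"
      using u_N EN by (simp_all add: xvj xE xu vjD linear_opD[OF E1_linear])
    have "x ((v ^^ j) a) = 0" if a: "a \<in> N" for a
    proof -
      from N_decomp[OF a] obtain p q n' where n': "n' \<in> N" "a = p *s u + q *s u' + v n'" by blast
      have "(v ^^ j) a = p *s (v ^^ j) u + q *s (v ^^ j) u' + (v ^^ Suc j) n'"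
        unfolding n'(2) vjD vj_v ..
      moreover have "x ((v ^^ j) u') = 0"
        unfolding u' linear_opD[OF x(1)] z IH[OF d1(2)] by simp
      ultimately show ?thesis
        using IH[OF n'(1)] z by (simp add: linear_opD[OF x(1)] del: funpow.simps)
    qed
    then show ?case by (simp add: j_def)
  qed
  from this[of L] n show ?thesis by simp
qed

end

section \<open>Eigenvalues, existence of blocks, and the notion of a rigidifying operator\<close>

context graded_symplectic
begin

text \<open>Bounding independent sets, instead of naming a dimension, makes the bound pass to
  subspaces directly and drop by one as soon as a vector of \<open>M\<close> lies outside the
  subspace.\<close>

definition rank_le :: "'a set \<Rightarrow> nat \<Rightarrow> bool" where
  "rank_le M d \<longleftrightarrow> (\<forall>B\<subseteq>M. independent B \<longrightarrow> finite B \<and> card B \<le> d)"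

text \<open>The operator is the product of all \<open>T - k\<close> with \<open>k\<close> in
  \<open>F\<close>, known here only through its effect on eigenvectors.\<close>

lemma ex_annihilator:
  assumes "finite F" and T: "linear_op T"
  shows "\<exists>P. linear_op P \<and> (\<forall>m y. T y = m *s y \<longrightarrow> P y = (\<Prod>k\<in>F. m - k) *s y)"
  using assms(1)
proof induct
  case empty
  then show ?case by (intro exI[of _ "\<lambda>y. y"]) (simp add: additive_homogeneous_def)
next
  case (insert k F)
  then obtain P where P: "linear_op P" "\<And>m y. T y = m *s y \<Longrightarrow> P y = (\<Prod>k\<in>F. m - k) *s y" by blast
  show ?case
  proof (intro exI[of _ "\<lambda>y. T (P y) - k *s P y"] conjI allI impI)
    show "linear_op (\<lambda>y. T (P y) - k *s P y)"
      unfolding additive_homogeneous_def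
      by (simp add: linear_opD[OF P(1)] linear_opD[OF T] scale_right_distrib
          scale_right_diff_distrib mult.commute)
    fix m y assume "T y = m *s y"
    then show "T (P y) - k *s P y = (\<Prod>k\<in>insert k F. m - k) *s y"
      using insert P(2)[of y m]
      by (simp add: linear_opD[OF T] mult.commute left_diff_distrib scale_left_diff_distrib)
  qed
qed

text \<open>The product of \<open>T - k\<close> over the earlier eigenvalues kills the span of the
  earlier eigenvectors but multiplies the new one by a nonzero scalar.\<close>

lemma eigenvectors_independent:
  assumes T: "linear_op T" and "finite F" and "\<And>m. m \<in> F \<Longrightarrow> f m \<noteq> 0 \<and> T (f m) = m *s f m"
  shows "independent (f ` F) \<and> card (f ` F) = card F"
  using assms(2,3)
proof (induct F)
  case empty
  then show ?case by (simp add: independent_empty)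
next
  case (insert k F)
  obtain P where P: "linear_op P" "\<And>m y. T y = m *s y \<Longrightarrow> P y = (\<Prod>k\<in>F. m - k) *s y"
    using ex_annihilator[OF insert(1) T] by blast
  have "P y = 0" if "y \<in> span (f ` F)" for y
    using that
  proof (induct rule: span_induct)
    case base
    then show ?case by (auto simp: subspace_def linear_opD[OF P(1)])
  next
    case (step y)
    then obtain m where m: "m \<in> F" "y = f m" by auto
    have "(\<Prod>k\<in>F. m - k) = 0" using insert(1) m by (auto simp: prod_zero_iff)
    then show ?case using P(2)[of y m] m insert by auto
  qed
  moreover have "P (f k) \<noteq> 0"
    using P(2)[of "f k" k] insert by (auto simp: prod_zero_iff)
  ultimately have "f k \<notin> span (f ` F)" by blast
  moreover from this have "f k \<notin> f ` F" using span_base by blast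
  ultimately show ?case
    using insert by (simp add: independent_insert)
qed

lemma finite_eigenvalues:
  assumes T: "linear_op T" and M: "rank_le M d"
  shows "finite {m. \<exists>y\<in>M. y \<noteq> 0 \<and> T y = m *s y}"
proof (rule ccontr)
  assume inf: "infinite {m. \<exists>y\<in>M. y \<noteq> 0 \<and> T y = m *s y}"
  obtain F where F: "F \<subseteq> {m. \<exists>y\<in>M. y \<noteq> 0 \<and> T y = m *s y}" "finite F" "card F = Suc d"
    using infinite_arbitrarily_large[OF inf, of "Suc d"] by blast
  then have "\<forall>m\<in>F. \<exists>y. y \<in> M \<and> y \<noteq> 0 \<and> T y = m *s y" by blast
  then obtain f where f: "\<And>m. m \<in> F \<Longrightarrow> f m \<in> M \<and> f m \<noteq> 0 \<and> T (f m) = m *s f m" by metis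
  have "independent (f ` F) \<and> card (f ` F) = card F"
    by (rule eigenvectors_independent[OF T F(2)]) (use f in blast)
  moreover have "f ` F \<subseteq> M" using f by blast
  ultimately have "card F \<le> d" using M unfolding rank_le_def by metis
  then show False using F(3) by simp
qed

definition nondegenerate_on :: "'a set \<Rightarrow> bool" where
  "nondegenerate_on M \<longleftrightarrow> (\<forall>y\<in>M. (\<forall>z\<in>M. form y z = 0) \<longrightarrow> y = 0)"

text \<open>Both vectors are split into their even and odd parts \<open>(y + s y) / 2\<close> and
  \<open>(y - s y) / 2\<close>; one of the four resulting values must be nonzero.\<close>

lemma ex_homogeneous:
  assumes "subspace M" "invariant s M" "a \<in> M" "b \<in> M" "form ((v ^^ j) a) b \<noteq> 0"
  shows "\<exists>a b e e'. a \<in> M \<and> b \<in> M \<and> s a = e *s a \<and> s b = e' *s b \<and> e * e = 1 \<and> e' * e' = 1 \<and>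
    form ((v ^^ j) a) b \<noteq> 0"
proof -
  have dec: "\<exists>y1 y2. y1 \<in> M \<and> y2 \<in> M \<and> s y1 = 1 *s y1 \<and> s y2 = (-1) *s y2 \<and> y = y1 + y2"
    if "y \<in> M" for y
  proof (intro exI conjI)
    have sy: "s y \<in> M" using assms(2) that by (rule invariantD)
    show "(1/2) *s (y + s y) \<in> M" "(1/2) *s (y - s y) \<in> M"
      using assms(1) that sy by (auto intro: subspace_scale subspace_add subspace_diff)
    show "s ((1/2) *s (y + s y)) = 1 *s (1/2) *s (y + s y)"
      by (simp only: sD s_s scale_one add.commute)
    have "(1/2) *s (s y - y) = - ((1/2) *s (y - s y))"
      using scale_minus_right[of "1/2" "y - s y"] by simp
    then show "s ((1/2) *s (y - s y)) = (-1) *s (1/2) *s (y - s y)"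
      by (simp only: sD s_s scale_minus_left scale_one)
    have "(1/2) *s (y + s y) + (1/2) *s (y - s y) = (1/2) *s (y + y)"
      unfolding scale_right_distrib[symmetric] by simp
    also have "y + y = 2 *s y" using scale_left_distrib[of 1 1 y] by simp
    finally show "y = (1/2) *s (y + s y) + (1/2) *s (y - s y)" by simp
  qed
  obtain a1 a2 where a: "a1 \<in> M" "a2 \<in> M" "s a1 = 1 *s a1" "s a2 = (-1) *s a2" "a = a1 + a2"
    using dec[OF assms(3)] by blast
  obtain b1 b2 where b: "b1 \<in> M" "b2 \<in> M" "s b1 = 1 *s b1" "s b2 = (-1) *s b2" "b = b1 + b2"
    using dec[OF assms(4)] by blast
  have "form ((v ^^ j) a1) b1 + form ((v ^^ j) a1) b2 + form ((v ^^ j) a2) b1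
      + form ((v ^^ j) a2) b2 \<noteq> 0"
    using assms(5) by (simp add: a(5) b(5) vjD form_simps ac_simps)
  then consider "form ((v ^^ j) a1) b1 \<noteq> 0" | "form ((v ^^ j) a1) b2 \<noteq> 0"
    | "form ((v ^^ j) a2) b1 \<noteq> 0" | "form ((v ^^ j) a2) b2 \<noteq> 0" by force
  then show ?thesis
  proof cases
    case 1
    then show ?thesis using a(1,3) b(1,3)
      by - (rule exI[of _ a1], rule exI[of _ b1], rule exI[of _ "1"], rule exI[of _ "1"], simp)
  next
    case 2
    then show ?thesis using a(1,3) b(2,4)
      by - (rule exI[of _ a1], rule exI[of _ b2], rule exI[of _ "1"], rule exI[of _ "-1"], simp)
  next
    case 3
    then show ?thesis using a(2,4) b(1,3)
      by - (rule exI[of _ a2], rule exI[of _ b1], rule exI[of _ "-1"], rule exI[of _ "1"], simp)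
  next
    case 4
    then show ?thesis using a(2,4) b(2,4)
      by - (rule exI[of _ a2], rule exI[of _ b2], rule exI[of _ "-1"], rule exI[of _ "-1"], simp)
  qed
qed

text \<open>With \<open>L\<close> minimal, nondegeneracy yields two vectors paired nontrivially by
  \<open>v^(L-1)\<close>, which may be taken homogeneous. Whether one of the two kinds of block
  arises is decided by the symmetry of that pairing.\<close>

lemma ex_block:
  assumes M: "subspace M" "invariant v M" "invariant s M" and nd: "nondegenerate_on M"
    and nil: "\<forall>a\<in>M. (v ^^ m) a = 0" and nz: "\<exists>a\<in>M. a \<noteq> 0"
  shows "\<exists>u u' L e e'. u \<in> M \<and> u' \<in> M \<and> symplectic_block scale form s v u u' L e e' \<and>
    (\<forall>a\<in>M. (v ^^ L) a = 0)"
proof -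
  define L where "L = (LEAST L. \<forall>a\<in>M. (v ^^ L) a = 0)"
  have L: "\<forall>a\<in>M. (v ^^ L) a = 0" unfolding L_def by (rule LeastI) (rule nil)
  have L_pos: "L > 0" using L nz by (cases L) auto
  have "\<not> (\<forall>a\<in>M. (v ^^ (L - 1)) a = 0)"
    using not_less_Least[of "L - 1" "\<lambda>L. \<forall>a\<in>M. (v ^^ L) a = 0"] L_pos by (simp add: L_def)
  then obtain a0 where "a0 \<in> M" "(v ^^ (L - 1)) a0 \<noteq> 0" by blast
  then obtain b0 where "b0 \<in> M" "form ((v ^^ (L - 1)) a0) b0 \<noteq> 0"
    using nd invariantD[OF invariant_funpow[OF M(2)]] unfolding nondegenerate_on_def by metis
  then obtain a b e e' where ab: "a \<in> M" "b \<in> M" "s a = e *s a" "s b = e' *s b"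
    "e * e = 1" "e' * e' = 1" and f: "form ((v ^^ (L - 1)) a) b \<noteq> 0"
    using ex_homogeneous[OF M(1,3)] \<open>a0 \<in> M\<close> by blast
  \<comment> \<open>The \<open>L - 1\<close> skew factors and the skew form together give
    \<open>L\<close> signs: symmetric for even \<open>L\<close>, alternating for odd
    \<open>L\<close>.\<close>
  have sw: "form ((v ^^ (L - 1)) y) z = (-1) ^ L * form ((v ^^ (L - 1)) z) y" for y z
  proof -
    have "(-1 :: 'k) ^ L = - ((-1) ^ (L - 1))" using L_pos by (cases L) auto
    then show ?thesis
      using form_vj[of "L - 1" y z] form_swap[of y "(v ^^ (L - 1)) z"] by simp
  qed
  have block: "symplectic_block scale form s v u u' L k k'"
    if "u \<in> M" "u' \<in> M" "s u = k *s u" "s u' = k' *s u'" "k * k = 1" "k' * k' = 1"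
      "u = u' \<and> form ((v ^^ (L - 1)) u) u \<noteq> 0 \<or>
      form ((v ^^ (L - 1)) u) u = 0 \<and> form ((v ^^ (L - 1)) u') u' = 0 \<and>
      form ((v ^^ (L - 1)) u) u' \<noteq> 0 \<and> form ((v ^^ (L - 1)) u') u \<noteq> 0" for u u' k k'
    using that L L_pos
    by (auto simp: symplectic_block_def symplectic_block_axioms_def graded_symplectic_axioms)
  show ?thesis
  proof (cases "even L")
    case True
    \<comment> \<open>For even \<open>L\<close> the power \<open>L - 1\<close> is odd, and its sign
      cancels that of \<open>form_s\<close>. The pairing is thus invariant under \<open>s\<close>,
      so \<open>a\<close> and \<open>b\<close> have equal parity and their sum is
      homogeneous.\<close>
    have "form ((v ^^ (L - 1)) (s a)) (s b) = (e * e') * form ((v ^^ (L - 1)) a) b"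
      by (simp add: ab vjD form_simps)
    moreover have "(v ^^ (L - 1)) (s a) = - s ((v ^^ (L - 1)) a)"
      using s_vj[of "L - 1" a] True L_pos by (simp add: minus_equation_iff)
    ultimately have "e * e' * form ((v ^^ (L - 1)) a) b = form ((v ^^ (L - 1)) a) b"
      by (simp add: form_simps form_s)
    then have "e * e' = 1" using f by (metis mult_cancel_right1)
    then have e: "e' = e" using ab(5) by (metis mult_cancel_left mult_zero_left zero_neq_one)
    \<comment> \<open>Polarisation: if the quadratic form vanished on \<open>a\<close>,
      \<open>b\<close> and \<open>a + b\<close>, the symmetric pairing of \<open>a\<close> and
      \<open>b\<close> would vanish too.\<close>
    have ex: "\<exists>u\<in>M. s u = e *s u \<and> form ((v ^^ (L - 1)) u) u \<noteq> 0"
    proof (rule ccontr)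
      assume "\<not> ?thesis"
      then have z: "form ((v ^^ (L - 1)) u) u = 0" if "u \<in> M" "s u = e *s u" for u
        using that by blast
      have "form ((v ^^ (L - 1)) (a + b)) (a + b) = 0"
        using ab e by (intro z) (auto simp: sD scale_right_distrib intro: subspace_add[OF M(1)])
      moreover have "form ((v ^^ (L - 1)) a) a = 0" "form ((v ^^ (L - 1)) b) b = 0"
        by (rule z; use ab e in simp)+
      ultimately have "form ((v ^^ (L - 1)) a) b + form ((v ^^ (L - 1)) b) a = 0"
        by (simp add: vjD form_simps add.commute)
      then show False using sw[of b a] True f by simp
    qed
    then show ?thesis using block[of _ _ e e] ab(5) L by blast
  next
    case False
    have "form ((v ^^ (L - 1)) y) y = 0" for y
      using sw[of y y] False by simp
    moreover have "form ((v ^^ (L - 1)) b) a \<noteq> 0" using sw[of b a] f False by simp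
    ultimately show ?thesis using block[of a b e e'] ab f L by blast
  qed
qed

text \<open>The map \<open>\<psi>\<close> is any self-map of \<open>M\<close> fixing 0, because the
  telescoping evaluates it only inside differences that end in \<open>\<psi> (v^L y)\<close>. This
  freedom lets \<open>\<psi>\<close> be compressed to a complement in the induction.\<close>

definition rigidifies :: "'a set \<Rightarrow> ('a \<Rightarrow> 'a) \<Rightarrow> bool" where
  "rigidifies M w \<longleftrightarrow> linear_op w \<and> invariant w M \<and> skew_on M w \<and> (\<forall>a\<in>M. w (s a) = - s (w a)) \<and>
    (\<forall>x \<psi>. linear_op x \<and> invariant x M \<and> skew_on M x \<and> (\<forall>a\<in>M. x (s a) = s (x a)) \<and>
      (\<forall>a\<in>M. x (v a) = v (x a)) \<and> invariant \<psi> M \<and> \<psi> 0 = 0 \<and>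
      (\<forall>a\<in>M. x (w a) - w (x a) = \<psi> (v a) - v (\<psi> a)) \<longrightarrow> (\<forall>a\<in>M. x a = 0))"

lemma funpow_commute_on:
  assumes "\<And>y. y \<in> M \<Longrightarrow> x (g y) = g (x y)" "invariant g M" "y \<in> M"
  shows "x ((g ^^ j) y) = (g ^^ j) (x y)"
  by (induct j) (use assms invariantD[OF invariant_funpow[OF assms(2)]] in auto)

text \<open>Since \<open>x\<close> commutes with \<open>v\<close>, its commutator with the
  derivative of the power is the derivative in the direction \<open>[x, w] = [\<psi>, v]\<close>,
  and that one telescopes to 0.\<close>

lemma commutes_deriv_pow:
  assumes M: "invariant v M" "invariant w M" and x: "linear_op x" "invariant x M"
    and xv: "\<And>a. a \<in> M \<Longrightarrow> x (v a) = v (x a)"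
    and xw: "\<And>a. a \<in> M \<Longrightarrow> x (w a) - w (x a) = \<psi> (v a) - v (\<psi> a)"
    and psi: "invariant \<psi> M" "\<psi> 0 = 0" and L: "\<And>a. a \<in> M \<Longrightarrow> (v ^^ L) a = 0"
    and y: "y \<in> M"
  shows "x (deriv_pow L w y) = deriv_pow L w (x y)"
proof -
  have m: "(v ^^ j) a \<in> M" if "a \<in> M" for j a
    using that invariantD[OF invariant_funpow[OF M(1)]] by simp
  have xvj: "x ((v ^^ j) a) = (v ^^ j) (x a)" if "a \<in> M" for j a
    using funpow_commute_on[where x = x and g = v and M = M, OF xv M(1) that] .
  have "x (deriv_pow L w y) - deriv_pow L w (x y) = deriv_pow L (\<lambda>z. x (w z) - w (x z)) y"
    using y m M(2) by (simp add: deriv_pow_def linear_opD[OF x(1)] xvj invariant_def vjD sum_subtractf)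
  also have "\<dots> = deriv_pow L (\<lambda>z. \<psi> (v z) - v (\<psi> z)) y"
    by (rule deriv_pow_cong[where M = M]) (use xw M y in \<open>auto simp: invariant_def\<close>)
  also have "\<dots> = 0"
    using y L psi by (simp add: deriv_pow_commutator invariant_def)
  finally show ?thesis by simp
qed

text \<open>Squares of positive integers are pairwise distinct in characteristic 0, so infinitely
  many values \<open>c * c * k\<close> are available to avoid a finite set. The successor keeps
  \<open>c\<close> nonzero.\<close>

lemma ex_generic_scalar:
  assumes "finite S" "k \<noteq> (0 :: 'k)"
  shows "\<exists>c. c \<noteq> 0 \<and> c * c * k \<notin> S"
proof -
  have "inj (\<lambda>n :: nat. of_nat (Suc n) * of_nat (Suc n) * k)"
  proof (rule injI)
    fix m n :: nat
    assume "of_nat (Suc m) * of_nat (Suc m) * k = of_nat (Suc n) * of_nat (Suc n) * k"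
    then have "of_nat (Suc m * Suc m) = (of_nat (Suc n * Suc n) :: 'k)"
      using assms(2) by (simp only: mult_cancel_right of_nat_mult) simp
    then have "Suc m * Suc m = Suc n * Suc n" by (simp only: of_nat_eq_iff)
    then have "(Suc m)\<^sup>2 = (Suc n)\<^sup>2" by (simp only: power2_eq_square)
    then show "m = n" using power2_eq_imp_eq[of "Suc m" "Suc n"] by simp
  qed
  then have "infinite (range (\<lambda>n :: nat. of_nat (Suc n) * of_nat (Suc n) * k))"
    by (simp add: finite_image_iff)
  then have "\<not> range (\<lambda>n :: nat. of_nat (Suc n) * of_nat (Suc n) * k) \<subseteq> S"
    using finite_subset assms(1) by metis
  then obtain n :: nat where "of_nat (Suc n) * of_nat (Suc n) * k \<notin> S" by blast
  then show ?thesis by (intro exI[of _ "of_nat (Suc n)"]) (auto simp del: of_nat_Suc)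
qed

end

section \<open>The induction step: splitting off one block\<close>

context symplectic_block
begin

lemma ex_rigidifies_step:
  assumes M: "subspace M" "invariant v M" "invariant s M" and L: "\<And>a. a \<in> M \<Longrightarrow> (v ^^ L) a = 0"
    and uM: "u \<in> M" "u' \<in> M"
    and M'_def: "M' = {y \<in> M. \<forall>n\<in>N. form y n = 0}" and rk: "rank_le M' d"
    and w': "rigidifies M' w'"
  shows "\<exists>w. rigidifies M w"
proof -
  have vM: "(v ^^ j) a \<in> M" if "a \<in> M" for j a
    using that invariantD[OF invariant_funpow[OF M(2)]] by simp
  have NM: "N \<subseteq> M"
    unfolding N_def by (rule span_minimal) (use vM uM M in auto)
  have M'M: "M' \<subseteq> M" by (auto simp: M'_def)
  have M': "subspace M'" "invariant v M'" "invariant s M'"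
  proof -
    show "subspace M'"
      using M(1) by (auto simp: M'_def subspace_def form_simps)
    show "invariant v M'"
      using M(2) v_N by (auto simp: M'_def invariant_def form_v)
    have "form (s y) n = - form y (s n)" for y n using form_s[of y "s n"] by (simp add: s_s)
    then show "invariant s M'"
      using M(3) s_N by (auto simp: M'_def invariant_def)
  qed
  have pr'M: "y - pr y \<in> M'" if "y \<in> M" for y
    using that pr_orth pr_N NM subspace_diff[OF M(1)] by (auto simp: M'_def subset_iff)
  have prM': "pr y = 0" if "y \<in> M'" for y using that by (intro pr_orth_zero) (auto simp: M'_def)
  have orth: "form y n = 0" "form n y = 0" if "y \<in> M'" "n \<in> N" for y n
    using that form_swap[of n y] by (auto simp: M'_def)
  have w'D: "linear_op w'" "invariant w' M'" "skew_on M' w'" "\<And>a. a \<in> M' \<Longrightarrow> w' (s a) = - s (w' a)"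
    and rigid': "\<And>x \<psi>. linear_op x \<Longrightarrow> invariant x M' \<Longrightarrow> skew_on M' x \<Longrightarrow>
      (\<forall>a\<in>M'. x (s a) = s (x a)) \<Longrightarrow> (\<forall>a\<in>M'. x (v a) = v (x a)) \<Longrightarrow> invariant \<psi> M' \<Longrightarrow>
      \<psi> 0 = 0 \<Longrightarrow> (\<forall>a\<in>M'. x (w' a) - w' (x a) = \<psi> (v a) - v (\<psi> a)) \<Longrightarrow> (\<forall>a\<in>M'. x a = 0)"
    using w' unfolding rigidifies_def by blast+
  define E' where "E' = deriv_pow L w'"
  have E': "linear_op E'" "invariant E' M'"
    unfolding E'_def using linear_deriv_pow[OF w'D(1)] invariant_deriv_pow[OF M'(1,2) w'D(2)] by auto
  obtain k where k: "k \<noteq> 0" "\<And>n. n \<in> N \<Longrightarrow> \<exists>n'\<in>N. E1 (E1 n) - k *s n = v n'"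
    using ex_E1_square by blast
  \<comment> \<open>The operator \<open>w'\<close> on the complement is already fixed, so the
    squared derivative there has finitely many eigenvalues, and \<open>c\<close> moves the
    eigenvalue of the block away from them.\<close>
  obtain c where c: "c \<noteq> 0" "\<And>y. y \<in> M' \<Longrightarrow> E' (E' y) = (c * c * k) *s y \<Longrightarrow> y = 0"
    using ex_generic_scalar[OF finite_eigenvalues[OF linear_comp[OF E'(1) E'(1)] rk] k(1)] by blast
  \<comment> \<open>Block diagonal for \<open>N\<close> and \<open>M'\<close>: \<open>w1\<close>
    vanishes on vectors orthogonal to \<open>u\<close> and \<open>u'\<close>, and
    \<open>y - pr y\<close> is the component in \<open>M'\<close>.\<close>
  define w where "w y = c *s w1 y + w' (y - pr y)" for y
  have wN: "w y = c *s w1 y" if "y \<in> N" for y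
    using that by (simp add: w_def pr_id linear_opD[OF w'D(1)])
  have wM': "w y = w' y" if "y \<in> M'" for y
    using that orth[OF _ u_N(1)] orth[OF _ u_N(2)] by (simp add: w_def prM' w1_def)
  have w_lin: "linear_op w"
    unfolding additive_homogeneous_def w_def
    by (simp add: linear_opD[OF w'D(1)] linear_opD[OF w1_linear] linear_opD[OF pr_linear]
        scale_right_distrib scale_right_diff_distrib mult.commute)
  have w_inv: "invariant w M"
    unfolding invariant_def w_def
    using w1_N NM pr'M M'M w'D(2)
    by (auto intro!: subspace_add[OF M(1)] subspace_scale[OF M(1)] simp: invariant_def)
  have w_skew: "skew_on M w"
    unfolding skew_on_def
  proof (intro ballI)
    fix a b assume ab: "a \<in> M" "b \<in> M"
    define a' b' where "a' = a - pr a" and "b' = b - pr b"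
    have a': "a' \<in> M'" "b' \<in> M'" "w' a' \<in> M'" "w' b' \<in> M'"
      using ab pr'M w'D(2) by (auto simp: a'_def b'_def invariant_def)
    have "form (w' a') b = form (w' a') b'"
      using orth(1)[OF a'(3) pr_N] by (simp add: b'_def form_simps)
    also have "\<dots> = - form a' (w' b')" using w'D(3) a' by (simp add: skew_on_def)
    also have "form a' (w' b') = form a (w' b')"
      using orth(2)[OF a'(4) pr_N] by (simp add: a'_def form_simps)
    finally show "form (w a) b = - form a (w b)"
      unfolding w_def a'_def[symmetric] b'_def[symmetric] by (simp add: form_simps w1_skew)
  qed
  have w_odd: "\<forall>a\<in>M. w (s a) = - s (w a)"
  proof
    fix a assume "a \<in> M"
    from w'D(4)[OF pr'M[OF this]] show "w (s a) = - s (w a)"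
      by (simp add: w_def w1_odd pr_s sD)
  qed
  define E where "E = deriv_pow L w"
  \<comment> \<open>\<open>G\<close> separates the two summands: it is nilpotent on \<open>N\<close>
    and injective on \<open>M'\<close>.\<close>
  define G where "G y = E (E y) - (c * c * k) *s y" for y
  have E_lin: "linear_op E" and E_inv: "invariant E M"
    unfolding E_def using linear_deriv_pow[OF w_lin] invariant_deriv_pow[OF M(1,2) w_inv] by auto
  have EN: "E y = c *s E1 y" if "y \<in> N" for y
  proof -
    have "E y = deriv_pow L (\<lambda>z. c *s w1 z) y"
      unfolding E_def by (rule deriv_pow_cong[where M = N]) (use wN v_N that in \<open>auto simp: invariant_def\<close>)
    then show ?thesis by (simp add: deriv_pow_def E1_def vjD scale_sum_right)
  qed
  have EM': "E y = E' y" if "y \<in> M'" for y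
    unfolding E_def E'_def
    by (rule deriv_pow_cong[where M = M']) (use wM' M' that in \<open>auto simp: invariant_def\<close>)
  have G_lin: "linear_op G"
    unfolding additive_homogeneous_def G_def
    by (simp add: linear_opD[OF E_lin] scale_right_distrib scale_right_diff_distrib mult.commute)
  have GN: "G n = (c * c) *s (E1 (E1 n) - k *s n)" if "n \<in> N" for n
    using that E1_N
    by (simp add: G_def EN linear_opD[OF E_lin] invariant_def scale_right_diff_distrib)
  have G_vj: "G ((v ^^ j) n) = (v ^^ j) (G n)" if "n \<in> N" for j n
    using that E1_N v_N invariantD[OF invariant_funpow[OF v_N]]
    by (simp add: GN E1_vj invariant_def vjD)
  \<comment> \<open>On \<open>N\<close> the operator \<open>G\<close> commutes with \<open>v\<close>
    and maps into \<open>v N\<close>, so its powers gain at least as many factors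
    \<open>v\<close>.\<close>
  have G_nil: "(G ^^ L) n = 0" if n: "n \<in> N" for n
  proof -
    have "\<exists>m\<in>N. (G ^^ j) n = (v ^^ j) m" for j
    proof (induct j)
      case 0
      then show ?case using n by auto
    next
      case (Suc j)
      then obtain m where m: "m \<in> N" "(G ^^ j) n = (v ^^ j) m" by blast
      obtain m' where m': "m' \<in> N" "E1 (E1 m) - k *s m = v m'" using k(2)[OF m(1)] by blast
      have "(G ^^ Suc j) n = (v ^^ j) (G m)" using m by (simp add: G_vj)
      also have "\<dots> = (v ^^ j) (v ((c * c) *s m'))" using m m' by (simp add: GN vD)
      also have "\<dots> = (v ^^ Suc j) ((c * c) *s m')" by (rule vj_v)
      finally show ?case using m' subspace_scale[OF subspace_N] by blast
    qed
    then show ?thesis using N_top by metis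
  qed
  have G_M': "G y \<in> M'" "G y = 0 \<Longrightarrow> y = 0" if "y \<in> M'" for y
  proof -
    have e: "G y = E' (E' y) - (c * c * k) *s y"
      using that E'(2) by (simp add: G_def EM' invariant_def)
    show "G y \<in> M'" unfolding e
      using that E'(2) by (auto simp: invariant_def intro!: subspace_diff[OF M'(1)] subspace_scale[OF M'(1)])
    show "G y = 0 \<Longrightarrow> y = 0" using c(2)[OF that] e by simp
  qed
  have G_inj: "y = 0" if "y \<in> M'" "(G ^^ j) y = 0" for y j
    using that
  proof (induct j)
    case (Suc j)
    have "(G ^^ j) y \<in> M'" using Suc(2) by (induct j) (auto simp: G_M')
    then show ?case using Suc G_M'(2) by auto
  qed simp
  have "\<forall>a\<in>M. x a = 0"
    if x: "linear_op x" "invariant x M" "skew_on M x" "\<forall>a\<in>M. x (s a) = s (x a)"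
      "\<forall>a\<in>M. x (v a) = v (x a)" and psi: "invariant \<psi> M" "\<psi> 0 = 0"
      "\<forall>a\<in>M. x (w a) - w (x a) = \<psi> (v a) - v (\<psi> a)" for x \<psi>
  proof -
    have xE: "x (E a) = E (x a)" if "a \<in> M" for a
      unfolding E_def
      by (rule commutes_deriv_pow[OF M(2) w_inv x(1,2) _ _ psi(1,2) L that]) (use x psi in auto)
    have xG: "x (G a) = G (x a)" if "a \<in> M" for a
      using that E_inv xE by (simp add: G_def linear_opD[OF x(1)] invariant_def)
    have G_inv: "invariant G M"
      using E_inv by (auto simp: G_def invariant_def intro!: subspace_diff[OF M(1)] subspace_scale[OF M(1)])
    \<comment> \<open>\<open>x\<close> commutes with \<open>G\<close>, so \<open>x n\<close> is
      killed by \<open>G^L\<close>; so is its component in \<open>N\<close>. The remaining component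
      lies in \<open>M'\<close>, where \<open>G\<close> is injective.\<close>
    have xN: "x n \<in> N" if n: "n \<in> N" for n
    proof -
      have nM: "n \<in> M" "x n \<in> M" using n NM x(2) by (auto simp: invariant_def)
      have lin: "linear_op (G ^^ L)" by (rule linear_funpow[OF G_lin])
      have "(G ^^ L) (x n) = x ((G ^^ L) n)"
        using funpow_commute_on[where x = x and g = G and M = M, OF xG G_inv nM(1)] by simp
      then have "(G ^^ L) (x n) = 0" using G_nil[OF n] by (simp add: linear_opD[OF x(1)])
      moreover have "(G ^^ L) (pr (x n)) = 0" by (rule G_nil[OF pr_N])
      ultimately have "(G ^^ L) (x n - pr (x n)) = 0" by (simp add: linear_opD[OF lin])
      then have "x n - pr (x n) = 0" using G_inj pr'M[OF nM(2)] by blast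
      then show ?thesis using pr_N[of "x n"] by simp
    qed
    \<comment> \<open>Skewness turns invariance of \<open>N\<close> into invariance of its
      orthogonal complement.\<close>
    have xM': "x y \<in> M'" if y: "y \<in> M'" for y
    proof -
      have "form (x y) n = 0" if n: "n \<in> N" for n
        using x(3) orth(1)[OF y xN[OF n]] subsetD[OF M'M y] subsetD[OF NM n]
        by (simp add: skew_on_def)
      then show ?thesis using y M'M x(2) by (auto simp: M'_def invariant_def)
    qed
    have psiM: "\<psi> a \<in> M" if "a \<in> M" for a using that psi(1) by (simp add: invariant_def)
    \<comment> \<open>The map \<open>\<psi>\<close> need not preserve \<open>M'\<close>, so it is
      replaced by its component there. The equation survives because its left side lies in
      \<open>M'\<close> and \<open>pr\<close> commutes with \<open>v\<close>.\<close>
    have zM': "\<forall>y\<in>M'. x y = 0"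
    proof (rule rigid'[of x "\<lambda>y. \<psi> y - pr (\<psi> y)"])
      show "invariant (\<lambda>y. \<psi> y - pr (\<psi> y)) M'"
        using psiM pr'M M'M by (auto simp: invariant_def)
      show "\<forall>a\<in>M'. x (w' a) - w' (x a) = \<psi> (v a) - pr (\<psi> (v a)) - v (\<psi> a - pr (\<psi> a))"
      proof
        fix a assume a: "a \<in> M'"
        have eq: "x (w' a) - w' (x a) = \<psi> (v a) - v (\<psi> a)"
          using psi(3) a M'M wM' xM' by (metis subsetD)
        have "x (w' a) - w' (x a) \<in> M'"
          using a xM' w'D(2) by (auto simp: invariant_def intro!: subspace_diff[OF M'(1)])
        then have "pr (\<psi> (v a) - v (\<psi> a)) = 0" unfolding eq by (rule prM')
        then show "x (w' a) - w' (x a) = \<psi> (v a) - pr (\<psi> (v a)) - v (\<psi> a - pr (\<psi> a))"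
          by (simp add: eq linear_opD[OF pr_linear] pr_v vD)
      qed
      show "skew_on M' x" "\<forall>a\<in>M'. x (s a) = s (x a)" "\<forall>a\<in>M'. x (v a) = v (x a)"
        using x(3-5) M'M unfolding skew_on_def by blast+
    qed (use x(1) xM' psi(2) in \<open>auto simp: invariant_def linear_opD[OF pr_linear]\<close>)
    \<comment> \<open>On \<open>N\<close> the operator \<open>E\<close> is \<open>c\<close> times
      \<open>E1\<close>, so commuting with \<open>E\<close> means commuting with
      \<open>E1\<close>.\<close>
    have zN: "x n = 0" if "n \<in> N" for n
    proof (rule commutant_zero[OF x(1) _ _ _ _ _ that])
      show "x (E1 a) = E1 (x a)" if a: "a \<in> N" for a
      proof -
        have "c *s x (E1 a) = c *s E1 (x a)"
          using xE[of a] a NM xN by (auto simp: EN linear_opD[OF x(1)])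
        then show ?thesis using c(1) by simp
      qed
      show "skew_on N x" using x(3) NM unfolding skew_on_def by blast
      show "x (s a) = s (x a)" "x (v a) = v (x a)" if "a \<in> N" for a
        using x(4,5) NM that by blast+
    qed (use xN in \<open>auto simp: invariant_def\<close>)
    show ?thesis
    proof
      fix y assume "y \<in> M"
      have "x y = x (pr y) + x (y - pr y)" by (simp flip: linear_opD(1)[OF x(1)])
      then show "x y = 0" using zN[OF pr_N] zM' pr'M[OF \<open>y \<in> M\<close>] by simp
    qed
  qed
  then have "rigidifies M w"
    unfolding rigidifies_def using w_lin w_inv w_skew w_odd by blast
  then show ?thesis by blast
qed

end

section \<open>The induction on the dimension\<close>

context graded_symplectic
begin

theorem ex_rigidifies:
  assumes "subspace M" "invariant v M" "invariant s M" "nondegenerate_on M"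
    and "\<forall>a\<in>M. (v ^^ m) a = 0" "rank_le M d"
  shows "\<exists>w. rigidifies M w"
  using assms
proof (induct d arbitrary: M)
  case 0
  have "a = 0" if "a \<in> M" for a
  proof (rule ccontr)
    assume "a \<noteq> 0"
    then have "independent {a}" by simp
    moreover have "{a} \<subseteq> M" using that by simp
    ultimately have "card {a} \<le> 0" using 0(6) unfolding rank_le_def by blast
    then show False by simp
  qed
  then have "rigidifies M (\<lambda>y. 0)"
    using 0 by (auto simp: rigidifies_def additive_homogeneous_def invariant_def skew_on_def
        subspace_0 sD)
  then show ?case by blast
next
  case (Suc d)
  show ?case
  proof (cases "\<exists>a\<in>M. a \<noteq> 0")
    case False
    then have "rigidifies M (\<lambda>y. 0)"
      using Suc by (auto simp: rigidifies_def additive_homogeneous_def invariant_def skew_on_def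
          subspace_0 sD)
    then show ?thesis by blast
  next
    case True
    obtain u u' L e e' where u: "u \<in> M" "u' \<in> M" "symplectic_block scale form s v u u' L e e'"
      "\<And>a. a \<in> M \<Longrightarrow> (v ^^ L) a = 0"
      using ex_block[OF Suc(2-6) True] by blast
    interpret B: symplectic_block scale form s v u u' L e e' by (rule u(3))
    define M' where "M' = {y \<in> M. \<forall>n\<in>B.N. form y n = 0}"
    have NM: "B.N \<subseteq> M"
      unfolding B.N_def
      by (rule span_minimal) (use invariantD[OF invariant_funpow[OF Suc(3)]] u Suc in auto)
    have sub: "subspace M'"
      using Suc(2) by (auto simp: M'_def subspace_def form_simps)
    have inv: "invariant v M'"
      using Suc(3) B.v_N by (auto simp: M'_def invariant_def form_v)
    have "form (s y) n = - form y (s n)" for y n using form_s[of y "s n"] by (simp add: s_s)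
    then have invs: "invariant s M'"
      using Suc(4) B.s_N by (auto simp: M'_def invariant_def)
    have nd: "nondegenerate_on M'"
      unfolding nondegenerate_on_def
    proof (intro ballI impI)
      fix y assume y: "y \<in> M'" "\<forall>z\<in>M'. form y z = 0"
      have "form y z = 0" if z: "z \<in> M" for z
      proof -
        have "z - B.pr z \<in> M'"
          using z NM B.pr_N B.pr_orth subspace_diff[OF Suc(2)] by (auto simp: M'_def subset_iff)
        then have "form y (z - B.pr z) = 0" using y by blast
        moreover have "form y (B.pr z) = 0" using y B.pr_N by (auto simp: M'_def)
        ultimately show ?thesis by (simp add: form_simps)
      qed
      then show "y = 0" using Suc(5) y by (auto simp: nondegenerate_on_def M'_def)
    qed
    have rk: "rank_le M' d"
      unfolding rank_le_def
    proof (intro allI impI)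
      fix A assume A: "A \<subseteq> M'" "independent A"
      \<comment> \<open>The bound drops because \<open>u\<close> lies in \<open>M\<close> but not in
        \<open>M'\<close>: a nonzero vector of the nondegenerate \<open>N\<close> cannot be
        orthogonal to \<open>N\<close>. So \<open>u\<close> extends every independent subset of
        \<open>M'\<close>.\<close>
      have "u \<noteq> 0" using B.pairing by (auto simp: vjD)
      moreover have "u = 0" if "u \<in> M'"
        using B.nondegenerate_N[OF B.u_N(1)] that by (auto simp: M'_def)
      moreover have "span A \<subseteq> M'" using A sub by (intro span_minimal)
      ultimately have nu: "u \<notin> span A" by blast
      then have "independent (insert u A)" using A by (simp add: independent_insertI)
      moreover have "insert u A \<subseteq> M" using A u by (auto simp: M'_def)
      ultimately have "finite (insert u A)" "card (insert u A) \<le> Suc d"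
        using Suc(7) unfolding rank_le_def by metis+
      moreover have "u \<notin> A" using nu span_base by blast
      ultimately show "finite A \<and> card A \<le> d" by simp
    qed
    obtain w' where "rigidifies M' w'"
      using Suc(1)[OF sub inv invs nd _ rk] Suc(6) by (auto simp: M'_def)
    then show ?thesis
      using B.ex_rigidifies_step[OF Suc(2-4) u(4,1,2) M'_def rk] by blast
  qed
qed

end

subsection \<open>Pairs of symmetric matrices\<close>

text \<open>Column vectors are functions on \<open>nat\<close> vanishing from \<open>n\<close> on.
  The operator theory lives on a whole type of functions, inside which the coordinate space is the
  subspace of supported ones.\<close>

definition apply_mat :: "nat \<Rightarrow> 'k::field mat \<Rightarrow> (nat \<Rightarrow> 'k) \<Rightarrow> nat \<Rightarrow> 'k" where
  "apply_mat n A f i = (if i < n then \<Sum>j<n. A $$ (i, j) * f j else 0)"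

definition dot :: "nat \<Rightarrow> (nat \<Rightarrow> 'k::field) \<Rightarrow> (nat \<Rightarrow> 'k) \<Rightarrow> 'k" where
  "dot n f g = (\<Sum>i<n. f i * g i)"

definition supported :: "nat \<Rightarrow> (nat \<Rightarrow> 'k::field) \<Rightarrow> bool" where
  "supported n f \<longleftrightarrow> (\<forall>i\<ge>n. f i = 0)"

definition unit_fun :: "nat \<Rightarrow> nat \<Rightarrow> 'k::field" where
  "unit_fun j i = (if i = j then 1 else 0)"

lemma apply_mat_add: "apply_mat n A (f + g) = apply_mat n A f + apply_mat n A g"
  by (auto simp: apply_mat_def distrib_left sum.distrib)

lemma apply_mat_scale: "apply_mat n A (\<lambda>i. c * f i) = (\<lambda>i. c * apply_mat n A f i)"
  by (auto simp: apply_mat_def sum_distrib_left mult_ac)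

lemma apply_mat_uminus: "apply_mat n A (- f) = - apply_mat n A f"
  by (auto simp: apply_mat_def sum_negf)

lemma apply_mat_zero: "apply_mat n A 0 = 0" "apply_mat n A (\<lambda>i. 0) = (\<lambda>i. 0)"
  by (auto simp: apply_mat_def)

lemma apply_mat_zero_mat: "apply_mat n (0\<^sub>m n n) f = 0"
  by (auto simp: apply_mat_def)

lemma apply_mat_one: "supported n f \<Longrightarrow> apply_mat n (1\<^sub>m n) f = f"
  by (auto simp: apply_mat_def supported_def if_distrib if_distribR cong: if_cong)

lemma apply_mat_plus_mat:
  "A \<in> carrier_mat n n \<Longrightarrow> B \<in> carrier_mat n n \<Longrightarrow>
    apply_mat n (A + B) f = apply_mat n A f + apply_mat n B f"
  by (auto simp: apply_mat_def distrib_right sum.distrib)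

lemma apply_mat_mult:
  assumes "A \<in> carrier_mat n n" "B \<in> carrier_mat n n"
  shows "apply_mat n (A * B) f = apply_mat n A (apply_mat n B f)"
proof
  fix i
  show "apply_mat n (A * B) f i = apply_mat n A (apply_mat n B f) i"
  proof (cases "i < n")
    case True
    then have "apply_mat n (A * B) f i = (\<Sum>j<n. \<Sum>k<n. A $$ (i, k) * B $$ (k, j) * f j)"
      using assms by (simp add: apply_mat_def scalar_prod_def sum_distrib_right atLeast0LessThan)
    also have "\<dots> = (\<Sum>k<n. \<Sum>j<n. A $$ (i, k) * B $$ (k, j) * f j)" by (rule sum.swap)
    also have "\<dots> = apply_mat n A (apply_mat n B f) i"
      using True by (simp add: apply_mat_def sum_distrib_left mult.assoc)
    finally show ?thesis .
  qed (simp add: apply_mat_def)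
qed

lemma supported_apply_mat: "supported n (apply_mat n A f)"
  by (simp add: supported_def apply_mat_def)

lemma dot_apply_mat:
  assumes "A \<in> carrier_mat n n"
  shows "dot n (apply_mat n A f) g = dot n f (apply_mat n (transpose_mat A) g)"
proof -
  have "dot n (apply_mat n A f) g = (\<Sum>i<n. \<Sum>j<n. A $$ (i, j) * f j * g i)"
    by (simp add: dot_def apply_mat_def sum_distrib_right)
  also have "\<dots> = (\<Sum>j<n. \<Sum>i<n. A $$ (i, j) * f j * g i)" by (rule sum.swap)
  also have "\<dots> = dot n f (apply_mat n (transpose_mat A) g)"
    using assms by (auto simp: dot_def apply_mat_def sum_distrib_left mult_ac intro!: sum.cong)
  finally show ?thesis .
qed

lemma dot_unit_right: "j < n \<Longrightarrow> dot n f (unit_fun j) = f j"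
  by (simp add: dot_def unit_fun_def if_distrib cong: if_cong)

lemma apply_mat_unit: "j < n \<Longrightarrow> i < n \<Longrightarrow> apply_mat n A (unit_fun j) i = A $$ (i, j)"
  by (simp add: apply_mat_def unit_fun_def if_distrib cong: if_cong)

lemma dot_commute: "dot n f g = dot n g f"
  by (simp add: dot_def mult.commute)

lemma dot_simps:
  "dot n (f + g) h = dot n f h + dot n g h" "dot n h (f + g) = dot n h f + dot n h g"
  "dot n (- f) h = - dot n f h" "dot n h (- f) = - dot n h f"
  "dot n 0 h = 0" "dot n h 0 = 0"
  "dot n (\<lambda>i. c * f i) h = c * dot n f h"
  by (simp_all add: dot_def distrib_left distrib_right sum.distrib sum_negf sum_distrib_left mult_ac)

lemma sum_fun_apply: "sum f A x = (\<Sum>a\<in>A. f a x)"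
  by (induct A rule: infinite_finite_induct) auto

lemma supported_expand: "supported n f \<Longrightarrow> f = (\<Sum>j<n. (\<lambda>i. f j * unit_fun j i))"
proof
  fix i assume f: "supported n f"
  have "(\<Sum>j<n. (\<lambda>i. f j * unit_fun j i)) i = (\<Sum>j<n. f j * unit_fun j i)"
    by (induct n) auto
  also have "\<dots> = f i"
    using f by (auto simp: unit_fun_def supported_def if_distrib cong: if_cong)
  finally show "f i = (\<Sum>j<n. (\<lambda>i. f j * unit_fun j i)) i" by simp
qed

abbreviation pair_scale :: "'k::field \<Rightarrow> (nat \<Rightarrow> 'k) \<times> (nat \<Rightarrow> 'k) \<Rightarrow> (nat \<Rightarrow> 'k) \<times> (nat \<Rightarrow> 'k)" where
  "pair_scale c p \<equiv> ((\<lambda>i. c * fst p i), (\<lambda>i. c * snd p i))"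

definition pair_form :: "nat \<Rightarrow> (nat \<Rightarrow> 'k::field) \<times> (nat \<Rightarrow> 'k) \<Rightarrow> (nat \<Rightarrow> 'k) \<times> (nat \<Rightarrow> 'k) \<Rightarrow> 'k" where
  "pair_form n p q = dot n (fst p) (snd q) - dot n (snd p) (fst q)"

text \<open>The rigidity result in blocks: \<open>v\<close> and \<open>w\<close> have off-diagonal
  blocks \<open>A\<close>, \<open>B\<close> and \<open>P\<close>, \<open>Q\<close>, whereas
  \<open>x\<close> and \<open>\<psi>\<close> are block diagonal with blocks \<open>X\<close> and
  \<open>- transpose_mat X\<close>, respectively \<open>Y\<close> and
  \<open>- transpose_mat Y\<close>. The four equations are the components of
  \<open>[x, v] = 0\<close> and \<open>[x, w] = [\<psi>, v]\<close>.\<close>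

lemma matrix_pair_rigid:
  fixes A B :: "'k::field_char_0 mat"
  assumes A: "A \<in> carrier_mat n n" "transpose_mat A = A"
    and B: "B \<in> carrier_mat n n" "transpose_mat B = B"
    and nil: "(A * B) ^\<^sub>m m = 0\<^sub>m n n"
  shows "\<exists>P Q. P \<in> carrier_mat n n \<and> Q \<in> carrier_mat n n \<and> transpose_mat P = P \<and>
    transpose_mat Q = Q \<and> (\<forall>X\<in>carrier_mat n n. \<forall>Y\<in>carrier_mat n n.
      X * A + A * transpose_mat X = 0\<^sub>m n n \<longrightarrow> transpose_mat X * B + B * X = 0\<^sub>m n n \<longrightarrow>
      X * P + P * transpose_mat X = Y * A + A * transpose_mat Y \<longrightarrow>
      transpose_mat X * Q + Q * X = transpose_mat Y * B + B * Y \<longrightarrow> X = 0\<^sub>m n n)"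
proof -
  define v where "v p = (apply_mat n A (snd p), apply_mat n B (fst p))" for p
  define s where "s p = (fst p, - snd p)" for p :: "(nat \<Rightarrow> 'k) \<times> (nat \<Rightarrow> 'k)"
  interpret G: graded_symplectic pair_scale "pair_form n" s v
  proof unfold_locales
    fix a b c :: "(nat \<Rightarrow> 'k) \<times> (nat \<Rightarrow> 'k)" and q r :: 'k
    show "pair_scale q (a + b) = pair_scale q a + pair_scale q b"
      "pair_scale (q + r) a = pair_scale q a + pair_scale r a"
      "pair_scale q (pair_scale r a) = pair_scale (q * r) a" "pair_scale 1 a = a"
      by (auto simp: prod_eq_iff distrib_left distrib_right fun_eq_iff mult.assoc)
    show "pair_form n (a + b) c = pair_form n a c + pair_form n b c"
      "pair_form n (pair_scale r a) c = r * pair_form n a c"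
      by (simp_all add: pair_form_def dot_simps right_diff_distrib)
    show "pair_form n a b = - pair_form n b a"
      by (simp add: pair_form_def dot_commute)
    show "v (a + b) = v a + v b" "v (pair_scale r a) = pair_scale r (v a)"
      by (simp_all add: v_def apply_mat_add apply_mat_scale)
    show "pair_form n (v a) b = - pair_form n a (v b)"
      by (simp add: pair_form_def v_def dot_apply_mat[OF A(1)] dot_apply_mat[OF B(1)] A B)
    show "s (a + b) = s a + s b" "s (pair_scale r a) = pair_scale r (s a)" "s (s a) = a"
      by (auto simp: s_def prod_eq_iff)
    show "s (v a) = - v (s a)"
      by (simp add: s_def v_def apply_mat_uminus prod_eq_iff)
    show "pair_form n (s a) (s b) = - pair_form n a b"
      by (simp add: s_def pair_form_def dot_simps)
  qed
  define M where "M = {p :: (nat \<Rightarrow> 'k) \<times> (nat \<Rightarrow> 'k). supported n (fst p) \<and> supported n (snd p)}"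
  have M: "G.subspace M" "G.invariant v M" "G.invariant s M"
    by (auto simp: G.subspace_def M_def G.invariant_def supported_apply_mat v_def s_def)
      (auto simp: supported_def)
  have e: "(unit_fun j, 0) \<in> M" "(0, unit_fun j) \<in> M" if "j < n" for j
    using that by (auto simp: M_def supported_def unit_fun_def)
  have nd: "G.nondegenerate_on M"
    unfolding G.nondegenerate_on_def
  proof (intro ballI impI)
    fix y assume y: "y \<in> M" "\<forall>z\<in>M. pair_form n y z = 0"
    have "fst y j = 0 \<and> snd y j = 0" for j
    proof (cases "j < n")
      case True
      then have "pair_form n y (unit_fun j, 0) = 0" "pair_form n y (0, unit_fun j) = 0" using e y by blast+
      then show ?thesis using True by (simp add: pair_form_def dot_simps dot_unit_right)
    qed (use y in \<open>auto simp: M_def supported_def\<close>)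
    then show "y = 0" by (auto simp: prod_eq_iff fun_eq_iff)
  qed
  have AB: "A * B \<in> carrier_mat n n" using A B by simp
  have pow: "apply_mat n ((A * B) ^\<^sub>m k) f = ((\<lambda>g. apply_mat n A (apply_mat n B g)) ^^ k) f"
    if "supported n f" for k f
    using that
  proof (induct k arbitrary: f)
    case 0
    then show ?case using AB A(1) by (simp add: apply_mat_one)
  next
    case (Suc k)
    have "apply_mat n ((A * B) ^\<^sub>m Suc k) f = apply_mat n ((A * B) ^\<^sub>m k) (apply_mat n (A * B) f)"
      using AB by (simp add: apply_mat_mult)
    also have "\<dots> = ((\<lambda>g. apply_mat n A (apply_mat n B g)) ^^ k) (apply_mat n A (apply_mat n B f))"
      using Suc(1)[OF supported_apply_mat] apply_mat_mult[OF A(1) B(1)] by simp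
    finally show ?case by (simp only: funpow_Suc_right comp_apply)
  qed
  have vv: "(v ^^ (2 * k)) (f, 0) = (((\<lambda>g. apply_mat n A (apply_mat n B g)) ^^ k) f, 0)" for k f
    by (induct k) (auto simp: v_def apply_mat_zero)
  \<comment> \<open>The square of \<open>v\<close> is \<open>A * B\<close> on the first summand, and
    one application of \<open>v\<close> carries the second summand into the first.\<close>
  have vnil: "\<forall>a\<in>M. (v ^^ (2 * m + 2)) a = 0"
  proof
    fix a assume a: "a \<in> M"
    have z: "(v ^^ (2 * m)) (f, 0) = 0" if "supported n f" for f
      using pow[OF that, of m] nil by (simp add: vv apply_mat_zero_mat zero_prod_def)
    have "v (0, snd a) = (apply_mat n A (snd a), 0)" by (simp add: v_def apply_mat_zero)
    then have "(v ^^ (2 * m)) (v (0, snd a)) = 0" by (simp only: z supported_apply_mat)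
    then have "(v ^^ (2 * m + 1)) (0, snd a) = 0" by (simp only: G.vj_v Suc_eq_plus1)
    moreover have "a = (fst a, 0) + (0, snd a)" by (simp add: prod_eq_iff)
    ultimately show "(v ^^ (2 * m + 2)) a = 0"
      using z[of "fst a"] a G.vjD(1)[of "2 * m + 2" "(fst a, 0)" "(0, snd a)"]
      by (simp add: M_def G.vD)
  qed
  have rk: "\<exists>d. G.rank_le M d"
  proof -
    define T where "T = (\<lambda>j. (unit_fun j :: nat \<Rightarrow> 'k, 0 :: nat \<Rightarrow> 'k)) ` {..<n} \<union> (\<lambda>j. (0, unit_fun j)) ` {..<n}"
    have "M \<subseteq> G.span T"
    proof
      fix p assume p: "p \<in> M"
      \<comment> \<open>Stated for every upper limit, shadowing the dimension, so that induction on
        the limit leaves \<open>p\<close> fixed.\<close>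
      have "(\<Sum>j<n. pair_scale (fst p j) (unit_fun j, 0)) = (\<Sum>j<n. (\<lambda>i. fst p j * unit_fun j i), 0)"
        for n by (induct n) (auto simp: zero_prod_def zero_fun_def)
      then have 1: "(\<Sum>j<n. pair_scale (fst p j) (unit_fun j, 0)) = (fst p, 0)"
        using supported_expand[of n "fst p"] p by (simp add: M_def)
      have "(\<Sum>j<n. pair_scale (snd p j) (0, unit_fun j)) = (0, \<Sum>j<n. (\<lambda>i. snd p j * unit_fun j i))"
        for n by (induct n) (auto simp: zero_prod_def zero_fun_def)
      then have 2: "(\<Sum>j<n. pair_scale (snd p j) (0, unit_fun j)) = (0, snd p)"
        using supported_expand[of n "snd p"] p by (simp add: M_def)
      have "(fst p, 0) + (0, snd p) \<in> G.span T"
        unfolding 1[symmetric] 2[symmetric]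
        by (intro G.span_add G.span_sum G.span_scale G.span_base) (auto simp: T_def)
      then show "p \<in> G.span T" by simp
    qed
    then have "G.rank_le M (card T)"
      unfolding G.rank_le_def
      using G.independent_span_bound[of T] by (auto simp: T_def)
    then show ?thesis ..
  qed
  then obtain d where "G.rank_le M d" ..
  then obtain w where w: "G.rigidifies M w"
    using G.ex_rigidifies[OF M nd vnil] by blast
  then have wl: "G.linear_op w" and wi: "G.invariant w M" and wsk: "G.skew_on M w"
    and wodd: "\<And>a. a \<in> M \<Longrightarrow> w (s a) = - s (w a)"
    and rigid: "\<And>x \<psi>. G.linear_op x \<Longrightarrow> G.invariant x M \<Longrightarrow> G.skew_on M x \<Longrightarrow>
      (\<forall>a\<in>M. x (s a) = s (x a)) \<Longrightarrow> (\<forall>a\<in>M. x (v a) = v (x a)) \<Longrightarrow> G.invariant \<psi> M \<Longrightarrow>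
      \<psi> 0 = 0 \<Longrightarrow> (\<forall>a\<in>M. x (w a) - w (x a) = \<psi> (v a) - v (\<psi> a)) \<Longrightarrow> (\<forall>a\<in>M. x a = 0)"
    unfolding G.rigidifies_def by blast+
  \<comment> \<open>The off-diagonal blocks of \<open>w\<close>, read off from its values on unit
    vectors.\<close>
  define P where "P = mat n n (\<lambda>(i, j). fst (w (0, unit_fun j)) i)"
  define Q where "Q = mat n n (\<lambda>(i, j). snd (w (unit_fun j, 0)) i)"
  have PQ: "P \<in> carrier_mat n n" "Q \<in> carrier_mat n n" by (auto simp: P_def Q_def)
  \<comment> \<open>Oddness makes the diagonal blocks of \<open>w\<close> equal to their own
    negatives.\<close>
  have w0: "snd (w (0, g)) = 0" "fst (w (g, 0)) = 0" if "supported n g" for g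
  proof -
    have m: "(0, g) \<in> M" "(g, 0) \<in> M" using that by (auto simp: M_def supported_def)
    have "s (0, g) = - (0, g)" "s (g, 0) = (g, 0)" by (auto simp: s_def)
    then have "- w (0, g) = - s (w (0, g))" "w (g, 0) = - s (w (g, 0))"
      using wodd[OF m(1)] wodd[OF m(2)] G.linear_opD(4)[OF wl, of "(0, g)"] by simp_all
    then have 1: "snd (w (0, g)) = - snd (w (0, g))" "fst (w (g, 0)) = - fst (w (g, 0))"
      by (simp_all add: s_def prod_eq_iff)
    then show "snd (w (0, g)) = 0" "fst (w (g, 0)) = 0"
      by (simp_all add: fun_eq_iff eq_neg_iff_add_eq_0 flip: mult_2)
  qed
  have wP: "fst (w (0, g)) = apply_mat n P g" and wQ: "snd (w (g, 0)) = apply_mat n Q g"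
    if g: "supported n g" for g
  proof -
    have "(0, g) = (\<Sum>j<n. pair_scale (g j) (0, unit_fun j))"
    proof -
      have "(\<Sum>j<n. pair_scale (g j) (0, unit_fun j)) = (0, \<Sum>j<n. (\<lambda>i. g j * unit_fun j i))"
        for n by (induct n) (auto simp: zero_prod_def zero_fun_def)
      then show ?thesis using supported_expand[OF g] by simp
    qed
    then have "w (0, g) = (\<Sum>j<n. pair_scale (g j) (w (0, unit_fun j)))"
      by (simp only: G.linear_opD(2,6)[OF wl])
    then have 1: "fst (w (0, g)) i = (\<Sum>j<n. g j * fst (w (0, unit_fun j)) i)" for i
      by (simp add: fst_sum sum_fun_apply)
    have "(g, 0) = (\<Sum>j<n. pair_scale (g j) (unit_fun j, 0))"
    proof -
      have "(\<Sum>j<n. pair_scale (g j) (unit_fun j, 0)) = (\<Sum>j<n. (\<lambda>i. g j * unit_fun j i), 0)"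
        for n by (induct n) (auto simp: zero_prod_def zero_fun_def)
      then show ?thesis using supported_expand[OF g] by simp
    qed
    then have "w (g, 0) = (\<Sum>j<n. pair_scale (g j) (w (unit_fun j, 0)))"
      by (simp only: G.linear_opD(2,6)[OF wl])
    then have 2: "snd (w (g, 0)) i = (\<Sum>j<n. g j * snd (w (unit_fun j, 0)) i)" for i
      by (simp add: snd_sum sum_fun_apply)
    have m: "w (0, g) \<in> M" "w (g, 0) \<in> M"
      using g wi by (auto simp: G.invariant_def M_def supported_def)
    show "fst (w (0, g)) = apply_mat n P g" "snd (w (g, 0)) = apply_mat n Q g"
      using m by (auto simp: fun_eq_iff apply_mat_def P_def Q_def 1 2 mult.commute M_def supported_def)
  qed
  have weq: "w p = (apply_mat n P (snd p), apply_mat n Q (fst p))" if "p \<in> M" for p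
  proof -
    have sp: "supported n (fst p)" "supported n (snd p)" using that by (auto simp: M_def)
    have "w p = w (fst p, 0) + w (0, snd p)"
      using G.linear_opD(1)[OF wl, of "(fst p, 0)" "(0, snd p)"] by simp
    then show ?thesis using w0[OF sp(1)] w0[OF sp(2)] wP[OF sp(2)] wQ[OF sp(1)] by (simp add: prod_eq_iff)
  qed
  \<comment> \<open>For an odd operator, skewness with respect to the form amounts to symmetry of
    both off-diagonal blocks.\<close>
  have "P $$ (i, j) = P $$ (j, i) \<and> Q $$ (i, j) = Q $$ (j, i)" if "i < n" "j < n" for i j
  proof
    have "pair_form n (w (0, unit_fun j)) (0, unit_fun i) = - pair_form n (0, unit_fun j) (w (0, unit_fun i))"
      using wsk e that unfolding G.skew_on_def by blast
    then show "P $$ (i, j) = P $$ (j, i)"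
      using that weq[OF e(2)] by (simp add: pair_form_def dot_simps dot_unit_right dot_commute[of n "unit_fun _"] apply_mat_unit)
    have "pair_form n (w (unit_fun j, 0)) (unit_fun i, 0) = - pair_form n (unit_fun j, 0) (w (unit_fun i, 0))"
      using wsk e that unfolding G.skew_on_def by blast
    then show "Q $$ (i, j) = Q $$ (j, i)"
      using that weq[OF e(1)] by (simp add: pair_form_def dot_simps dot_unit_right dot_commute[of n "unit_fun _"] apply_mat_unit)
  qed
  then have sym: "transpose_mat P = P" "transpose_mat Q = Q"
    using PQ by (auto intro!: eq_matI)
  have "X = 0\<^sub>m n n"
    if X: "X \<in> carrier_mat n n" and Y: "Y \<in> carrier_mat n n"
      and eq: "X * A + A * transpose_mat X = 0\<^sub>m n n" "transpose_mat X * B + B * X = 0\<^sub>m n n"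
      "X * P + P * transpose_mat X = Y * A + A * transpose_mat Y"
      "transpose_mat X * Q + Q * X = transpose_mat Y * B + B * Y" for X Y
  proof -
    \<comment> \<open>The natural action of a matrix on a space together with its dual; it is even
      and skew.\<close>
    define op where "op Z p = (apply_mat n Z (fst p), - apply_mat n (transpose_mat Z) (snd p))"
      for Z :: "'k mat" and p
    have tX: "transpose_mat X \<in> carrier_mat n n" "transpose_mat Y \<in> carrier_mat n n" using X Y by auto
    note mm = apply_mat_mult apply_mat_plus_mat apply_mat_zero_mat
    have e1: "apply_mat n X (apply_mat n A g) + apply_mat n A (apply_mat n (transpose_mat X) g) = 0"
      and e2: "apply_mat n (transpose_mat X) (apply_mat n B g) + apply_mat n B (apply_mat n X g) = 0"
      and e3: "apply_mat n X (apply_mat n P g) + apply_mat n P (apply_mat n (transpose_mat X) g) =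
        apply_mat n Y (apply_mat n A g) + apply_mat n A (apply_mat n (transpose_mat Y) g)"
      and e4: "apply_mat n (transpose_mat X) (apply_mat n Q g) + apply_mat n Q (apply_mat n X g) =
        apply_mat n (transpose_mat Y) (apply_mat n B g) + apply_mat n B (apply_mat n Y g)" for g
      using arg_cong[OF eq(1), of "\<lambda>Z. apply_mat n Z g"] arg_cong[OF eq(2), of "\<lambda>Z. apply_mat n Z g"]
        arg_cong[OF eq(3), of "\<lambda>Z. apply_mat n Z g"] arg_cong[OF eq(4), of "\<lambda>Z. apply_mat n Z g"]
        X Y tX A B PQ
      by (simp_all add: mm)
    have "\<forall>a\<in>M. op X a = 0"
    proof (rule rigid[of _ "op Y"])
      show "G.linear_op (op X)"
        by (auto simp: additive_homogeneous_def op_def apply_mat_add apply_mat_scale prod_eq_iff fun_eq_iff)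
      show "G.invariant (op X) M" "G.invariant (op Y) M"
        by (auto simp: G.invariant_def M_def op_def supported_def apply_mat_def)
      show "G.skew_on M (op X)"
        using X by (simp add: G.skew_on_def op_def pair_form_def dot_simps dot_apply_mat)
      show "\<forall>a\<in>M. op X (s a) = s (op X a)"
        by (simp add: op_def s_def apply_mat_uminus)
      show "\<forall>a\<in>M. op X (v a) = v (op X a)"
        using e1 e2 by (simp add: op_def v_def apply_mat_uminus add_eq_0_iff)
      show "op Y 0 = 0" by (simp add: op_def apply_mat_zero zero_prod_def)
      have "op X p \<in> M" for p
        by (auto simp: M_def op_def supported_def apply_mat_def)
      then show "\<forall>a\<in>M. op X (w a) - w (op X a) = op Y (v a) - v (op Y a)"
        using e3 e4 by (simp add: weq op_def v_def apply_mat_uminus prod_eq_iff)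
          (simp add: algebra_simps)
    qed
    then have "apply_mat n X (unit_fun j) = 0" if "j < n" for j
      using e(1)[OF that] by (auto simp: op_def zero_prod_def)
    then have "X $$ (i, j) = 0" if "i < n" "j < n" for i j
      using that apply_mat_unit[of j n i X] by simp
    then show ?thesis using X by (intro eq_matI) auto
  qed
  then show ?thesis using PQ sym by blast
qed

text \<open>
  The coefficient matrices of the adjugate of \<open>X - M\<close> satisfy a recursion that ends in \<open>M ^ n\<close>.
\<close>

lemma char_poly_monom_imp_nilpotent:
  fixes M :: "'k::field mat"
  assumes M: "M \<in> carrier_mat n n" and cp: "char_poly M = monom 1 n"
  shows "M ^\<^sub>m n = 0\<^sub>m n n"
proof -
  let ?X = "char_poly_matrix M"
  have X: "?X \<in> carrier_mat n n" using M by simp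
  define D where "D = adj_mat ?X"
  have D: "D \<in> carrier_mat n n" and DX: "D * ?X = monom 1 n \<cdot>\<^sub>m 1\<^sub>m n"
    unfolding D_def using adj_mat[OF X] cp by (simp_all add: char_poly_def)
  define C where "C k = mat n n (\<lambda>(i, j). coeff (D $$ (i, j)) k)" for k
  have C: "C k \<in> carrier_mat n n" for k by (simp add: C_def)
  have entry: "[:0, 1:] * D $$ (i, j) - (\<Sum>l<n. Polynomial.smult (M $$ (l, j)) (D $$ (i, l))) =
      (if i = j then monom 1 n else 0)" if ij: "i < n" "j < n" for i j
  proof -
    have "(D * ?X) $$ (i, j) = (\<Sum>l<n. D $$ (i, l) * ?X $$ (l, j))"
      using D X ij by (simp add: scalar_prod_def atLeast0LessThan)
    also have "\<dots> = (\<Sum>l<n. (if l = j then [:0, 1:] * D $$ (i, l) else 0) -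
        Polynomial.smult (M $$ (l, j)) (D $$ (i, l)))"
      using M ij by (intro sum.cong) (auto simp: char_poly_matrix_def mult.commute)
    also have "\<dots> = [:0, 1:] * D $$ (i, j) - (\<Sum>l<n. Polynomial.smult (M $$ (l, j)) (D $$ (i, l)))"
      using ij by (simp add: sum_subtractf)
    also have "(D * ?X) $$ (i, j) = (if i = j then monom 1 n else 0)" using DX ij by simp
    finally show ?thesis by simp
  qed
  have CM: "(C k * M) $$ (i, j) = (\<Sum>l<n. M $$ (l, j) * coeff (D $$ (i, l)) k)"
    if "i < n" "j < n" for i j k
    using that M by (simp add: C_def scalar_prod_def atLeast0LessThan mult.commute)
  \<comment> \<open>Comparison of the coefficients of degree \<open>Suc k\<close> in
    \<open>D * ?X = X^n\<close>; the identity matrix appears only for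
    \<open>Suc k = n\<close>.\<close>
  have rec: "C k = (if Suc k = n then 1\<^sub>m n else 0\<^sub>m n n) + C (Suc k) * M" for k
  proof (rule eq_matI)
    fix i j assume "i < dim_row ((if Suc k = n then 1\<^sub>m n else 0\<^sub>m n n) + C (Suc k) * M)"
      "j < dim_col ((if Suc k = n then 1\<^sub>m n else 0\<^sub>m n n) + C (Suc k) * M)"
    then have ij: "i < n" "j < n" using M carrier_matD[OF C[of "Suc k"]] by (auto split: if_splits)
    have "coeff (D $$ (i, j)) k - (\<Sum>l<n. M $$ (l, j) * coeff (D $$ (i, l)) (Suc k)) =
      coeff (if i = j then monom 1 n else 0) (Suc k)"
      using arg_cong[OF entry[OF ij], of "\<lambda>p. coeff p (Suc k)"] by (simp add: coeff_sum)
    then show "C k $$ (i, j) = ((if Suc k = n then 1\<^sub>m n else 0\<^sub>m n n) + C (Suc k) * M) $$ (i, j)"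
      using ij M C CM[OF ij, of "Suc k"] by (auto simp: C_def algebra_simps)
  qed (use M carrier_matD[OF C[of k]] carrier_matD[OF C[of "Suc k"]] in auto)
  have C0: "C 0 * M = (if n = 0 then 1\<^sub>m n else 0\<^sub>m n n)"
  proof (rule eq_matI)
    fix i j assume "i < dim_row (if n = 0 then 1\<^sub>m n else 0\<^sub>m n n :: 'k mat)"
      "j < dim_col (if n = 0 then 1\<^sub>m n else 0\<^sub>m n n :: 'k mat)"
    then have ij: "i < n" "j < n" by (auto split: if_splits)
    have "- (\<Sum>l<n. M $$ (l, j) * coeff (D $$ (i, l)) 0) = coeff (if i = j then monom 1 n else 0) 0"
      using arg_cong[OF entry[OF ij], of "\<lambda>p. coeff p 0"] by (simp add: coeff_sum)
    then show "(C 0 * M) $$ (i, j) = (if n = 0 then 1\<^sub>m n else 0\<^sub>m n n) $$ (i, j)"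
      using ij CM[OF ij, of 0] by (auto split: if_splits)
  qed (use M C in auto)
  obtain d where d: "\<And>k. k \<ge> d \<Longrightarrow> C k = 0\<^sub>m n n"
  proof
    let ?d = "Suc (Max (insert 0 ((\<lambda>(i, j). degree (D $$ (i, j))) ` ({..<n} \<times> {..<n}))))"
    have deg: "degree (D $$ (i, j)) < ?d" if "i < n" "j < n" for i j
      using that by (intro le_imp_less_Suc Max_ge) auto
    then show "C k = 0\<^sub>m n n" if "k \<ge> ?d" for k
      using coeff_eq_0[OF less_le_trans[OF deg that]] by (intro eq_matI) (simp_all add: C_def)
  qed
  \<comment> \<open>The coefficients vanish beyond all degrees of the entries, and the recursion
    carries this down to \<open>k = n\<close>, the last index before the identity matrix
    enters.\<close>
  have high: "C k = 0\<^sub>m n n" if "k \<ge> n" for k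
  proof -
    have "C k = 0\<^sub>m n n" if "k \<ge> n" "k + i \<ge> d" for i k
      using that
    proof (induct i arbitrary: k)
      case 0
      then show ?case by (simp add: d)
    next
      case (Suc i)
      then have "C (Suc k) = 0\<^sub>m n n" by simp
      then show ?case using rec[of k] Suc(2) M by simp
    qed
    from this[of k d] that show ?thesis by simp
  qed
  have low: "C (n - Suc i) = M ^\<^sub>m i" if "i < n" for i
    using that
  proof (induct i)
    case 0
    then have "Suc (n - Suc 0) = n" by simp
    then show ?case using rec[of "n - Suc 0"] high[of n] M 0 by (simp add: left_add_zero_mat)
  next
    case (Suc i)
    then have "Suc (n - Suc (Suc i)) = n - Suc i" by simp
    then show ?case using rec[of "n - Suc (Suc i)"] Suc M by (auto simp: left_add_zero_mat)
  qed
  show ?thesis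
  proof (cases n)
    case 0
    then show ?thesis using M by (intro eq_matI) auto
  next
    case (Suc i)
    then show ?thesis using low[of i] C0 by simp
  qed
qed

text \<open>The hypothesis speaks of values at scalars because the invariants come as one function
  on the representation for each \<open>t\<close>. Over an infinite field these values determine the
  characteristic polynomial.\<close>

lemma det_eq_imp_nilpotent:
  fixes M :: "'k::field_char_0 mat"
  assumes M: "M \<in> carrier_mat n n" and det: "\<And>t. det (t \<cdot>\<^sub>m 1\<^sub>m n - M) = t ^ n"
  shows "M ^\<^sub>m n = 0\<^sub>m n n"
proof (rule char_poly_monom_imp_nilpotent[OF M])
  have "poly (char_poly M) t = poly (monom 1 n) t" for t
  proof -
    have "- char_matrix M t = t \<cdot>\<^sub>m 1\<^sub>m n - M"
      using M by (intro eq_matI) (auto simp: char_matrix_def)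
    then show ?thesis using char_poly_matrix[OF M, of t] det[of t] by (simp add: poly_monom)
  qed
  then have "poly (char_poly M) = poly (monom 1 n)" by (rule ext)
  then show "char_poly M = monom 1 n" by (simp only: poly_eq_poly_eq_iff)
qed

subsection \<open>Linear maps and coordinates\<close>

lemma linear_mapI:
  assumes "vectorspace class_ring V" "vectorspace class_ring W"
    and "\<And>u. u \<in> carrier V \<Longrightarrow> f u \<in> carrier W"
    and "\<And>u v. u \<in> carrier V \<Longrightarrow> v \<in> carrier V \<Longrightarrow> f (u \<oplus>\<^bsub>V\<^esub> v) = f u \<oplus>\<^bsub>W\<^esub> f v"
    and "\<And>c v. v \<in> carrier V \<Longrightarrow> f (c \<odot>\<^bsub>V\<^esub> v) = c \<odot>\<^bsub>W\<^esub> f v"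
  shows "linear_map class_ring V W f"
  using assms
  by (simp add: linear_map_def mod_hom_def mod_hom_axioms_def vectorspace_def LinearCombinations.module_hom_def)

lemma linear_mapD:
  assumes "linear_map class_ring V W f"
  shows "vectorspace class_ring V" "vectorspace class_ring W"
    and "u \<in> carrier V \<Longrightarrow> f u \<in> carrier W"
    and "u \<in> carrier V \<Longrightarrow> v \<in> carrier V \<Longrightarrow> f (u \<oplus>\<^bsub>V\<^esub> v) = f u \<oplus>\<^bsub>W\<^esub> f v"
    and "u \<in> carrier V \<Longrightarrow> f (c \<odot>\<^bsub>V\<^esub> u) = c \<odot>\<^bsub>W\<^esub> f u"
    and "f \<zero>\<^bsub>V\<^esub> = \<zero>\<^bsub>W\<^esub>"
    and "u \<in> carrier V \<Longrightarrow> f (\<ominus>\<^bsub>V\<^esub> u) = \<ominus>\<^bsub>W\<^esub> f u"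
proof -
  interpret f: linear_map class_ring V W f by fact
  show "vectorspace class_ring V" "vectorspace class_ring W"
    by (rule f.V.vectorspace_axioms f.W.vectorspace_axioms)+
  show "u \<in> carrier V \<Longrightarrow> f u \<in> carrier W"
    "u \<in> carrier V \<Longrightarrow> v \<in> carrier V \<Longrightarrow> f (u \<oplus>\<^bsub>V\<^esub> v) = f u \<oplus>\<^bsub>W\<^esub> f v"
    "u \<in> carrier V \<Longrightarrow> f (c \<odot>\<^bsub>V\<^esub> u) = c \<odot>\<^bsub>W\<^esub> f u"
    "f \<zero>\<^bsub>V\<^esub> = \<zero>\<^bsub>W\<^esub>" "u \<in> carrier V \<Longrightarrow> f (\<ominus>\<^bsub>V\<^esub> u) = \<ominus>\<^bsub>W\<^esub> f u"
    by simp_all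
qed

lemma vs_smult:
  fixes V :: "('k::field, 'v) module"
  assumes "vectorspace class_ring V"
  shows "x \<in> carrier V \<Longrightarrow> 1 \<odot>\<^bsub>V\<^esub> x = x" "x \<in> carrier V \<Longrightarrow> 0 \<odot>\<^bsub>V\<^esub> x = \<zero>\<^bsub>V\<^esub>"
    and "x \<in> carrier V \<Longrightarrow> (a + b) \<odot>\<^bsub>V\<^esub> x = a \<odot>\<^bsub>V\<^esub> x \<oplus>\<^bsub>V\<^esub> b \<odot>\<^bsub>V\<^esub> x"
    and "x \<in> carrier V \<Longrightarrow> (a * b) \<odot>\<^bsub>V\<^esub> x = a \<odot>\<^bsub>V\<^esub> (b \<odot>\<^bsub>V\<^esub> x)"
    and "x \<in> carrier V \<Longrightarrow> y \<in> carrier V \<Longrightarrow> a \<odot>\<^bsub>V\<^esub> (x \<oplus>\<^bsub>V\<^esub> y) = a \<odot>\<^bsub>V\<^esub> x \<oplus>\<^bsub>V\<^esub> a \<odot>\<^bsub>V\<^esub> y"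
    and "a \<odot>\<^bsub>V\<^esub> \<zero>\<^bsub>V\<^esub> = \<zero>\<^bsub>V\<^esub>" "x \<in> carrier V \<Longrightarrow> (-1) \<odot>\<^bsub>V\<^esub> x = \<ominus>\<^bsub>V\<^esub> x"
    and "x \<in> carrier V \<Longrightarrow> a \<odot>\<^bsub>V\<^esub> x \<in> carrier V"
proof -
  interpret V: vectorspace class_ring V by fact
  show "x \<in> carrier V \<Longrightarrow> 1 \<odot>\<^bsub>V\<^esub> x = x" "x \<in> carrier V \<Longrightarrow> 0 \<odot>\<^bsub>V\<^esub> x = \<zero>\<^bsub>V\<^esub>"
    "x \<in> carrier V \<Longrightarrow> (a + b) \<odot>\<^bsub>V\<^esub> x = a \<odot>\<^bsub>V\<^esub> x \<oplus>\<^bsub>V\<^esub> b \<odot>\<^bsub>V\<^esub> x"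
    "x \<in> carrier V \<Longrightarrow> (a * b) \<odot>\<^bsub>V\<^esub> x = a \<odot>\<^bsub>V\<^esub> (b \<odot>\<^bsub>V\<^esub> x)"
    "x \<in> carrier V \<Longrightarrow> y \<in> carrier V \<Longrightarrow> a \<odot>\<^bsub>V\<^esub> (x \<oplus>\<^bsub>V\<^esub> y) = a \<odot>\<^bsub>V\<^esub> x \<oplus>\<^bsub>V\<^esub> a \<odot>\<^bsub>V\<^esub> y"
    "a \<odot>\<^bsub>V\<^esub> \<zero>\<^bsub>V\<^esub> = \<zero>\<^bsub>V\<^esub>" "x \<in> carrier V \<Longrightarrow> a \<odot>\<^bsub>V\<^esub> x \<in> carrier V"
    using V.smult_one[of x] V.lmult_0[of x] V.smult_l_distr[of a b x] V.smult_assoc1[of a b x]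
      V.smult_r_distr[of a x y] V.rmult_0[of a] by simp_all
  show "x \<in> carrier V \<Longrightarrow> (-1) \<odot>\<^bsub>V\<^esub> x = \<ominus>\<^bsub>V\<^esub> x"
    using V.smult_minus_1[of x] by (simp add: class_ring_simps)
qed

lemma linear_map_comp:
  assumes "linear_map class_ring V W f" "linear_map class_ring W X g"
  shows "linear_map class_ring V X (\<lambda>v. g (f v))"
  using linear_mapD[OF assms(1)] linear_mapD[OF assms(2)]
  by (intro linear_mapI) auto

lemma linear_map_cong:
  assumes "linear_map class_ring V W f" "\<And>v. v \<in> carrier V \<Longrightarrow> g v = f v"
  shows "linear_map class_ring V W g"
proof -
  interpret V: vectorspace class_ring V using linear_mapD[OF assms(1)] by simp
  show ?thesis
    using linear_mapD[OF assms(1)] assms(2) by (intro linear_mapI) auto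
qed

lemma linear_map_finsum:
  assumes f: "linear_map class_ring V W f" and g: "g \<in> A \<rightarrow> carrier V"
  shows "f (finsum V g A) = (\<Oplus>\<^bsub>W\<^esub>a\<in>A. f (g a))"
proof -
  interpret V: vectorspace class_ring V using linear_mapD[OF f] by simp
  interpret W: vectorspace class_ring W using linear_mapD[OF f] by simp
  show ?thesis
    using g
  proof (induct A rule: infinite_finite_induct)
    case (infinite A)
    then show ?case using linear_mapD[OF f] by simp
  next
    case empty
    then show ?case using linear_mapD[OF f] by simp
  next
    case (insert a A)
    have "finsum V g A \<in> carrier V" using insert by (intro V.module.M.finsum_closed) auto
    then have "f (finsum V g (insert a A)) = f (g a) \<oplus>\<^bsub>W\<^esub> f (finsum V g A)"
      using insert by (subst V.module.M.finsum_insert) (auto simp: linear_mapD[OF f])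
    moreover have "(\<Oplus>\<^bsub>W\<^esub>a\<in>insert a A. f (g a)) = f (g a) \<oplus>\<^bsub>W\<^esub> (\<Oplus>\<^bsub>W\<^esub>a\<in>A. f (g a))"
      using insert by (intro W.module.M.finsum_insert) (auto simp: Pi_iff linear_mapD(3)[OF f])
    ultimately show ?case using insert by auto
  qed
qed

definition scalars :: "('k::field, 'k) module" where
  "scalars = \<lparr>carrier = UNIV, mult = (*), one = 1, zero = 0, add = (+), smult = (*)\<rparr>"

lemma scalars_simps [simp]:
  "carrier scalars = UNIV" "zero scalars = 0" "add scalars = (+)" "smult scalars = (*)"
  by (simp_all add: scalars_def)

lemma vectorspace_scalars: "vectorspace class_ring scalars"
  by (rule vs_criteria) (auto simp: class_field algebra_simps intro: exI[of _ "- _"])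

lemma finsum_scalars [simp]: "finsum scalars f A = sum f A"
proof -
  interpret vectorspace class_ring scalars by (rule vectorspace_scalars)
  show ?thesis
    by (induct A rule: infinite_finite_induct) auto
qed

lemma linear_functional_finsum:
  assumes "linear_map class_ring V scalars f" "g \<in> A \<rightarrow> carrier V"
  shows "f (finsum V g A) = (\<Sum>a\<in>A. f (g a))"
  using linear_map_finsum[OF assms] by simp

text \<open>A basis together with its dual coordinate functionals, indexed by an initial segment of
  \<open>nat\<close> so that matrices can be read off.\<close>

definition coord_basis :: "('k::field, 'v) module \<Rightarrow> nat \<Rightarrow> (nat \<Rightarrow> 'v) \<Rightarrow> (nat \<Rightarrow> 'v \<Rightarrow> 'k) \<Rightarrow> bool" where
  "coord_basis V n b c \<longleftrightarrow> (\<forall>i<n. b i \<in> carrier V) \<and> (\<forall>i<n. linear_map class_ring V scalars (c i)) \<and>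
    (\<forall>i<n. \<forall>j<n. c i (b j) = (if i = j then 1 else 0)) \<and>
    (\<forall>v\<in>carrier V. v = (\<Oplus>\<^bsub>V\<^esub>i\<in>{..<n}. c i v \<odot>\<^bsub>V\<^esub> b i))"

lemma ex_coord_basis:
  fixes V :: "('k::field, 'v) module"
  assumes V: "vectorspace class_ring V" and fd: "vectorspace.fin_dim class_ring V"
  shows "\<exists>n b c. coord_basis V n b c"
proof -
  interpret V: vectorspace class_ring V by (rule V)
  obtain B where B: "finite B" "V.basis B" using V.finite_basis_exists[OF fd] by blast
  have BV: "B \<subseteq> carrier V" using B by (simp add: V.basis_def)
  have ex1: "\<exists>!a. a \<in> B \<rightarrow>\<^sub>E UNIV \<and> V.lincomb a B = v" if "v \<in> carrier V" for v
    using V.basis_criterion[OF B(1) BV] B(2) that by simp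
  \<comment> \<open>Coefficient functions extensional on \<open>B\<close> are unique, so additivity
    and homogeneity of \<open>rep\<close> follow by exhibiting the right coefficients.\<close>
  define rep where "rep v = (THE a. a \<in> B \<rightarrow>\<^sub>E UNIV \<and> V.lincomb a B = v)" for v
  have rep: "rep v \<in> B \<rightarrow>\<^sub>E UNIV" "V.lincomb (rep v) B = v" if "v \<in> carrier V" for v
    using theI'[OF ex1[OF that]] by (auto simp: rep_def)
  have rep_eq: "rep v = a" if "v \<in> carrier V" "a \<in> B \<rightarrow>\<^sub>E UNIV" "V.lincomb a B = v" for v a
    using ex1[OF that(1)] rep[OF that(1)] that by blast
  have restr: "V.lincomb (restrict a B) B = V.lincomb a B" for a
    using BV by (intro V.lincomb_cong) auto
  have radd: "rep (u \<oplus>\<^bsub>V\<^esub> v) = (\<lambda>x\<in>B. rep u x + rep v x)" if "u \<in> carrier V" "v \<in> carrier V" for u v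
  proof (rule rep_eq)
    have "V.lincomb (\<lambda>x. rep u x + rep v x) B = u \<oplus>\<^bsub>V\<^esub> v"
      using V.lincomb_sum[OF B(1) BV, of "rep u" "rep v"] rep that by simp
    then show "V.lincomb (\<lambda>x\<in>B. rep u x + rep v x) B = u \<oplus>\<^bsub>V\<^esub> v" by (simp only: restr)
  qed (use that in auto)
  have rsm: "rep (c \<odot>\<^bsub>V\<^esub> v) = (\<lambda>x\<in>B. c * rep v x)" if "v \<in> carrier V" for c v
  proof (rule rep_eq)
    have "V.lincomb (\<lambda>x. c * rep v x) B = c \<odot>\<^bsub>V\<^esub> v"
      using V.lincomb_smult[OF BV, of "rep v" c] rep that by simp
    then show "V.lincomb (\<lambda>x\<in>B. c * rep v x) B = c \<odot>\<^bsub>V\<^esub> v" by (simp only: restr)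
  qed (use that in auto)
  obtain f where f: "bij_betw f {..<card B} B"
    using ex_bij_betw_nat_finite[OF B(1)] by (auto simp: atLeast0LessThan)
  have fB: "f i \<in> B" if "i < card B" for i using f that by (auto simp: bij_betw_def)
  have rb: "rep x = (\<lambda>y\<in>B. if y = x then 1 else 0)" if "x \<in> B" for x
  proof (rule rep_eq)
    have "V.lincomb (\<lambda>y\<in>B. if y = x then 1 else 0) B = (\<Oplus>\<^bsub>V\<^esub>y\<in>B. if x = y then x else \<zero>\<^bsub>V\<^esub>)"
      unfolding V.lincomb_def using BV that vs_smult[OF V] by (intro V.module.M.finsum_cong') auto
    also have "\<dots> = x" using that BV B(1) V.module.M.finsum_singleton[of x B "\<lambda>_. x"] by auto
    finally show "V.lincomb (\<lambda>y\<in>B. if y = x then 1 else 0) B = x" .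
  qed (use that BV in auto)
  have "coord_basis V (card B) f (\<lambda>i v. rep v (f i))"
    unfolding coord_basis_def
  proof (intro conjI allI impI ballI)
    fix i assume i: "i < card B"
    show "f i \<in> carrier V" using fB[OF i] BV by auto
    show "linear_map class_ring V scalars (\<lambda>v. rep v (f i))"
      using fB[OF i] by (intro linear_mapI V vectorspace_scalars) (auto simp: radd rsm)
    fix j assume j: "j < card B"
    show "rep (f j) (f i) = (if i = j then 1 else 0)"
      using f i j fB by (auto simp: rb bij_betw_def inj_on_def)
  next
    fix v assume v: "v \<in> carrier V"
    have "(\<Oplus>\<^bsub>V\<^esub>i\<in>{..<card B}. rep v (f i) \<odot>\<^bsub>V\<^esub> f i) = (\<Oplus>\<^bsub>V\<^esub>x\<in>B. rep v x \<odot>\<^bsub>V\<^esub> x)"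
      using V.module.M.finsum_reindex[of "\<lambda>x. rep v x \<odot>\<^bsub>V\<^esub> x" f "{..<card B}"] f
        subsetD[OF BV fB] vs_smult(8)[OF V]
      by (auto simp: bij_betw_def Pi_iff)
    then show "v = (\<Oplus>\<^bsub>V\<^esub>i\<in>{..<card B}. rep v (f i) \<odot>\<^bsub>V\<^esub> f i)"
      using rep(2)[OF v] by (simp add: V.lincomb_def)
  qed
  then show ?thesis by blast
qed

lemma linear_map_from_vec:
  fixes V :: "('k::field, 'v) module"
  assumes V: "vectorspace class_ring V" and b: "\<And>i. i < n \<Longrightarrow> b i \<in> carrier V"
  shows "linear_map class_ring (module_vec TYPE('k) n) V (\<lambda>x. \<Oplus>\<^bsub>V\<^esub>i\<in>{..<n}. (x $ i) \<odot>\<^bsub>V\<^esub> b i)"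
proof -
  interpret V: vectorspace class_ring V by (rule V)
  show ?thesis
  proof (intro linear_mapI vec_vs V)
    fix x y c
    assume x: "x \<in> carrier (module_vec TYPE('k) n)"
    show "(\<Oplus>\<^bsub>V\<^esub>i\<in>{..<n}. (x $ i) \<odot>\<^bsub>V\<^esub> b i) \<in> carrier V"
      using b by (intro V.module.M.finsum_closed) auto
    show "(\<Oplus>\<^bsub>V\<^esub>i\<in>{..<n}. ((c \<odot>\<^bsub>module_vec TYPE('k) n\<^esub> x) $ i) \<odot>\<^bsub>V\<^esub> b i) =
        c \<odot>\<^bsub>V\<^esub> (\<Oplus>\<^bsub>V\<^esub>i\<in>{..<n}. (x $ i) \<odot>\<^bsub>V\<^esub> b i)"
      using b x V.smult_assoc1
      by (subst V.finsum_smult) (auto simp: module_vec_simps intro!: V.module.M.finsum_cong')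
    assume y: "y \<in> carrier (module_vec TYPE('k) n)"
    show "(\<Oplus>\<^bsub>V\<^esub>i\<in>{..<n}. ((x \<oplus>\<^bsub>module_vec TYPE('k) n\<^esub> y) $ i) \<odot>\<^bsub>V\<^esub> b i) =
        (\<Oplus>\<^bsub>V\<^esub>i\<in>{..<n}. (x $ i) \<odot>\<^bsub>V\<^esub> b i) \<oplus>\<^bsub>V\<^esub> (\<Oplus>\<^bsub>V\<^esub>i\<in>{..<n}. (y $ i) \<odot>\<^bsub>V\<^esub> b i)"
      (is "?L = ?R")
    proof -
      have "?L = (\<Oplus>\<^bsub>V\<^esub>i\<in>{..<n}. (x $ i) \<odot>\<^bsub>V\<^esub> b i \<oplus>\<^bsub>V\<^esub> (y $ i) \<odot>\<^bsub>V\<^esub> b i)"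
        using b x y by (intro V.module.M.finsum_cong') (auto simp: module_vec_simps vs_smult[OF V])
      also have "\<dots> = ?R"
        using b by (intro V.module.M.finsum_addf) auto
      finally show ?thesis .
    qed
  qed
qed

lemma fin_dim_vec: "vectorspace.fin_dim class_ring (module_vec TYPE('k::field) n)"
  and vdim_vec: "vdim (module_vec TYPE('k) n) = n"
proof -
  interpret vec_space "TYPE('k)" n .
  show "vectorspace.fin_dim class_ring (module_vec TYPE('k) n)" by (rule fin_dim)
  show "vdim (module_vec TYPE('k) n) = n" by (rule dim_is_n)
qed

lemma coord_basis_dim:
  fixes V :: "('k::field, 'v) module"
  assumes V: "vectorspace class_ring V" and c: "coord_basis V n b c"
  shows "vectorspace.fin_dim class_ring V" "vdim V = n"
proof -
  interpret V: vectorspace class_ring V by (rule V)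
  define T where "T x = (\<Oplus>\<^bsub>V\<^esub>i\<in>{..<n}. (x $ i) \<odot>\<^bsub>V\<^esub> b i)" for x
  have b: "\<And>i. i < n \<Longrightarrow> b i \<in> carrier V" using c by (simp add: coord_basis_def)
  have T: "linear_map class_ring (module_vec TYPE('k) n) V T"
    unfolding T_def by (rule linear_map_from_vec[OF V b])
  interpret T: linear_map class_ring "module_vec TYPE('k) n" V T by (rule T)
  have cT: "c j (T x) = x $ j" if "j < n" for j x
  proof -
    have cj: "linear_map class_ring V scalars (c j)" using c that by (simp add: coord_basis_def)
    have "c j (T x) = (\<Sum>i<n. c j ((x $ i) \<odot>\<^bsub>V\<^esub> b i))"
      unfolding T_def using b by (intro linear_functional_finsum[OF cj]) auto
    also have "\<dots> = (\<Sum>i<n. x $ i * (if j = i then 1 else 0))"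
      using c b that by (intro sum.cong) (auto simp: linear_mapD[OF cj] coord_basis_def)
    finally show ?thesis using that by (simp add: if_distrib cong: if_cong)
  qed
  have inj: "inj_on T (carrier (module_vec TYPE('k) n))"
    by (rule inj_onI) (auto simp: module_vec_simps intro!: eq_vecI simp flip: cT)
  have surj: "T ` carrier (module_vec TYPE('k) n) = carrier V"
  proof
    show "T ` carrier (module_vec TYPE('k) n) \<subseteq> carrier V" by auto
    show "carrier V \<subseteq> T ` carrier (module_vec TYPE('k) n)"
    proof
      fix v assume v: "v \<in> carrier V"
      have "T (vec n (\<lambda>i. c i v)) = (\<Oplus>\<^bsub>V\<^esub>i\<in>{..<n}. c i v \<odot>\<^bsub>V\<^esub> b i)"
        unfolding T_def using b by (intro V.module.M.finsum_cong') auto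
      then have "T (vec n (\<lambda>i. c i v)) = v" using c v by (simp add: coord_basis_def)
      then show "v \<in> T ` carrier (module_vec TYPE('k) n)"
        by (auto simp: module_vec_simps intro!: image_eqI[of _ _ "vec n (\<lambda>i. c i v)"])
    qed
  qed
  show "vectorspace.fin_dim class_ring V" by (rule T.surj_fin_dim[OF fin_dim_vec surj])
  show "vdim V = n" using T.dim_eq[OF fin_dim_vec inj surj] by (simp add: vdim_vec)
qed

subsection \<open>Dual spaces\<close>

lemma dual_simps:
  "carrier (dual V) = {\<xi> \<in> extensional (carrier V).
      (\<forall>u\<in>carrier V. \<forall>v\<in>carrier V. \<xi> (u \<oplus>\<^bsub>V\<^esub> v) = \<xi> u + \<xi> v) \<and>
      (\<forall>c. \<forall>v\<in>carrier V. \<xi> (c \<odot>\<^bsub>V\<^esub> v) = c * \<xi> v)}"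
  "zero (dual V) = (\<lambda>v\<in>carrier V. 0)"
  "add (dual V) = (\<lambda>f g. \<lambda>v\<in>carrier V. f v + g v)"
  "smult (dual V) = (\<lambda>c f. \<lambda>v\<in>carrier V. c * f v)"
  by (simp_all add: dual_def ring.func_space_def[OF class_ring.ring_axioms])

lemma mem_dual_iff:
  assumes "vectorspace class_ring V"
  shows "\<xi> \<in> carrier (dual V) \<longleftrightarrow> \<xi> \<in> extensional (carrier V) \<and> linear_map class_ring V scalars \<xi>"
proof
  assume "\<xi> \<in> carrier (dual V)"
  then show "\<xi> \<in> extensional (carrier V) \<and> linear_map class_ring V scalars \<xi>"
    by (intro conjI linear_mapI[OF assms vectorspace_scalars]) (simp_all add: dual_simps)
next
  assume "\<xi> \<in> extensional (carrier V) \<and> linear_map class_ring V scalars \<xi>"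
  then show "\<xi> \<in> carrier (dual V)"
    unfolding dual_simps using linear_mapD(4,5)[of V scalars \<xi>] by auto
qed

lemma restrict_mem_dual:
  assumes "linear_map class_ring V scalars f"
  shows "restrict f (carrier V) \<in> carrier (dual V)"
  using linear_mapD(1)[OF assms] linear_map_cong[OF assms, of "restrict f (carrier V)"]
  by (simp add: mem_dual_iff)

lemma vectorspace_dual:
  assumes "vectorspace class_ring V"
  shows "vectorspace class_ring (dual V)"
proof -
  interpret V: vectorspace class_ring V by fact
  have ext: "f = g" if "f \<in> extensional (carrier V)" "g \<in> extensional (carrier V)"
    "\<And>v. v \<in> carrier V \<Longrightarrow> f v = g v" for f g :: "'b \<Rightarrow> 'a"
    using that by (rule extensionalityI)
  show ?thesis
  proof (rule vs_criteria)
    show "\<forall>v\<in>carrier (dual V). \<exists>neg_v\<in>carrier (dual V). v \<oplus>\<^bsub>dual V\<^esub> neg_v = \<zero>\<^bsub>dual V\<^esub>"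
    proof
      fix f assume "f \<in> carrier (dual V)"
      then show "\<exists>g\<in>carrier (dual V). f \<oplus>\<^bsub>dual V\<^esub> g = \<zero>\<^bsub>dual V\<^esub>"
        by (intro bexI[of _ "\<lambda>v\<in>carrier V. - f v"]) (auto simp: dual_simps intro!: ext)
    qed
  qed (auto simp: dual_simps class_field algebra_simps intro!: ext)
qed

lemma linear_map_eval:
  assumes "vectorspace class_ring V" "u \<in> carrier V"
  shows "linear_map class_ring (dual V) scalars (\<lambda>\<xi>. \<xi> u)"
  by (rule linear_mapI) (use assms in \<open>auto simp: vectorspace_dual vectorspace_scalars dual_simps\<close>)

lemma coord_basis_dual:
  assumes V: "vectorspace class_ring V" and c: "coord_basis V n b c"
  shows "coord_basis (dual V) n (\<lambda>i. restrict (c i) (carrier V)) (\<lambda>i \<xi>. \<xi> (b i))"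
proof -
  interpret V: vectorspace class_ring V by fact
  interpret D: vectorspace class_ring "dual V" using V by (rule vectorspace_dual)
  have b: "b i \<in> carrier V" and ci: "linear_map class_ring V scalars (c i)" if "i < n" for i
    using c that by (auto simp: coord_basis_def)
  have ci': "restrict (c i) (carrier V) \<in> carrier (dual V)" if "i < n" for i
    by (rule restrict_mem_dual[OF ci[OF that]])
  show ?thesis
    unfolding coord_basis_def
  proof (intro conjI allI impI ballI)
    fix i assume i: "i < n"
    show "restrict (c i) (carrier V) \<in> carrier (dual V)" by (rule ci'[OF i])
    show "linear_map class_ring (dual V) scalars (\<lambda>\<xi>. \<xi> (b i))"
      by (rule linear_map_eval[OF V b[OF i]])
    fix j assume "j < n"
    then show "restrict (c j) (carrier V) (b i) = (if i = j then 1 else 0)"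
      using c b i by (auto simp: coord_basis_def)
  next
    fix \<xi> assume xi: "\<xi> \<in> carrier (dual V)"
    let ?s = "\<Oplus>\<^bsub>dual V\<^esub>i\<in>{..<n}. \<xi> (b i) \<odot>\<^bsub>dual V\<^esub> restrict (c i) (carrier V)"
    have s: "?s \<in> carrier (dual V)"
      using ci' by (intro D.module.M.finsum_closed) (auto intro: vs_smult(8)[OF vectorspace_dual[OF V]])
    have lin: "linear_map class_ring V scalars \<xi>" using xi V by (simp add: mem_dual_iff)
    show "\<xi> = ?s"
    proof (rule extensionalityI)
      show "\<xi> \<in> extensional (carrier V)" "?s \<in> extensional (carrier V)"
        using xi s by (simp_all add: dual_simps(1))
      fix u assume u: "u \<in> carrier V"
      have "?s u = (\<Sum>i<n. (\<xi> (b i) \<odot>\<^bsub>dual V\<^esub> restrict (c i) (carrier V)) u)"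
        using ci' by (intro linear_functional_finsum[OF linear_map_eval[OF V u]])
          (auto intro: vs_smult(8)[OF vectorspace_dual[OF V]])
      also have "\<dots> = (\<Sum>i<n. c i u * \<xi> (b i))"
        using u by (simp add: dual_simps mult.commute)
      also have "\<dots> = (\<Sum>i<n. \<xi> (c i u \<odot>\<^bsub>V\<^esub> b i))"
        using b by (intro sum.cong) (auto simp: linear_mapD[OF lin])
      also have "\<dots> = \<xi> (\<Oplus>\<^bsub>V\<^esub>i\<in>{..<n}. c i u \<odot>\<^bsub>V\<^esub> b i)"
        using b by (intro linear_functional_finsum[OF lin, symmetric]) auto
      also have "\<dots> = \<xi> u" using c u by (simp add: coord_basis_def)
      finally show "\<xi> u = ?s u" by simp
    qed
  qed
qed

lemma
  assumes V: "vectorspace class_ring V" and fd: "vectorspace.fin_dim class_ring V"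
  shows fin_dim_dual: "vectorspace.fin_dim class_ring (dual V)"
    and vdim_dual: "vdim (dual V) = vdim V"
proof -
  obtain n b c where c: "coord_basis V n b c" using ex_coord_basis[OF V fd] by blast
  show "vectorspace.fin_dim class_ring (dual V)" "vdim (dual V) = vdim V"
    using coord_basis_dim[OF vectorspace_dual[OF V] coord_basis_dual[OF V c]]
      coord_basis_dim[OF V c] by auto
qed

lemma dual_separates:
  assumes V: "vectorspace class_ring V" and fd: "vectorspace.fin_dim class_ring V"
    and u: "u \<in> carrier V" and z: "\<And>\<xi>. \<xi> \<in> carrier (dual V) \<Longrightarrow> \<xi> u = 0"
  shows "u = \<zero>\<^bsub>V\<^esub>"
proof -
  interpret V: vectorspace class_ring V by fact
  obtain n b c where c: "coord_basis V n b c" using ex_coord_basis[OF V fd] by blast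
  have "c i u = 0" if "i < n" for i
    using z[OF restrict_mem_dual[of V "c i"]] c that u by (simp add: coord_basis_def)
  then have "(\<Oplus>\<^bsub>V\<^esub>i\<in>{..<n}. c i u \<odot>\<^bsub>V\<^esub> b i) = (\<Oplus>\<^bsub>V\<^esub>i\<in>{..<n}. \<zero>\<^bsub>V\<^esub>)"
    using c by (intro V.module.M.finsum_cong') (auto simp: coord_basis_def vs_smult[OF V])
  then show ?thesis using c u by (simp add: coord_basis_def)
qed

subsection \<open>The index of a module with a trivial generic stabiliser\<close>

lemma linear_map_dual_lie_action:
  fixes U :: "('k::field, 'u) module"
  assumes act: "linear_map class_ring U U (act x)"
  shows "linear_map class_ring (dual U) (dual U) (dual_lie_action U act x)"
proof -
  note a = linear_mapD[OF act] and D = vectorspace_dual[OF linear_mapD(1)[OF act]]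
  interpret U: vectorspace class_ring U by (rule a(1))
  show ?thesis
    by (rule linear_mapI[OF D D]) (auto simp: dual_simps dual_lie_action_def a intro!: restrict_ext)
qed

text \<open>
  The Lie algebra is the image of a vector space \<open>P\<close> under a map \<open>p\<close>, which makes its
  vector space structure available without a separate record.
\<close>

lemma linear_map_dual_lie_orbit:
  fixes P :: "('k::field, 'p) module" and U :: "('k, 'u) module"
  assumes P: "vectorspace class_ring P" and U: "vectorspace class_ring U"
    and act: "\<And>x. x \<in> carrier P \<Longrightarrow> linear_map class_ring U U (act (p x))"
    and orb: "\<And>u. u \<in> carrier U \<Longrightarrow> linear_map class_ring P U (\<lambda>x. act (p x) u)"
    and xi: "\<xi> \<in> carrier (dual U)"
  shows "linear_map class_ring P (dual U) (\<lambda>x. dual_lie_action U act (p x) \<xi>)"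
proof -
  have lin: "linear_map class_ring U scalars \<xi>" using xi U by (simp add: mem_dual_iff)
  show ?thesis
  proof (rule linear_mapI[OF P vectorspace_dual[OF U]])
    fix x c assume x: "x \<in> carrier P"
    show "dual_lie_action U act (p x) \<xi> \<in> carrier (dual U)"
      using linear_mapD(3)[OF linear_map_dual_lie_action[where act = act and x = "p x", OF act[OF x]] xi] .
    have "\<xi> (act (p (c \<odot>\<^bsub>P\<^esub> x)) w) = c * \<xi> (act (p x) w)" if "w \<in> carrier U" for w
      using linear_mapD[OF orb[OF that]] linear_mapD[OF lin] x by simp
    then show "dual_lie_action U act (p (c \<odot>\<^bsub>P\<^esub> x)) \<xi> = c \<odot>\<^bsub>dual U\<^esub> dual_lie_action U act (p x) \<xi>"
      by (auto simp: dual_lie_action_def dual_simps intro!: restrict_ext)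
    fix y assume y: "y \<in> carrier P"
    have "\<xi> (act (p (x \<oplus>\<^bsub>P\<^esub> y)) w) = \<xi> (act (p x) w) + \<xi> (act (p y) w)" if "w \<in> carrier U" for w
      using linear_mapD[OF orb[OF that]] linear_mapD[OF lin] x y by simp
    then show "dual_lie_action U act (p (x \<oplus>\<^bsub>P\<^esub> y)) \<xi> =
        dual_lie_action U act (p x) \<xi> \<oplus>\<^bsub>dual U\<^esub> dual_lie_action U act (p y) \<xi>"
      by (auto simp: dual_lie_action_def dual_simps intro!: restrict_ext)
  qed
qed

text \<open>By rank-nullity no orbit exceeds \<open>vdim P\<close>, and an injective orbit map
  attains it. Functionals on the dual correspond to vectors of \<open>U\<close>, so the vector
  \<open>u\<close> with trivial stabiliser supplies such a map.\<close>

lemma index_dual_trivial_stabiliser: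
  fixes P :: "('k::field, 'p) module" and U :: "('k, 'u) module"
  assumes P: "vectorspace class_ring P" "vectorspace.fin_dim class_ring P"
    and U: "vectorspace class_ring U" "vectorspace.fin_dim class_ring U"
    and q: "q = p ` carrier P"
    and act: "\<And>x. x \<in> carrier P \<Longrightarrow> linear_map class_ring U U (act (p x))"
    and orb: "\<And>u. u \<in> carrier U \<Longrightarrow> linear_map class_ring P U (\<lambda>x. act (p x) u)"
    and u: "u \<in> carrier U" "\<And>x. x \<in> carrier P \<Longrightarrow> act (p x) u = \<zero>\<^bsub>U\<^esub> \<Longrightarrow> x = \<zero>\<^bsub>P\<^esub>"
  shows "index q (dual U) (dual_lie_action U act) = int (vdim U) - int (vdim P)"
proof -
  let ?D = "dual U" and ?DD = "dual (dual U)"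
  let ?a = "dual_lie_action (dual U) (dual_lie_action U act)"
  note D = vectorspace_dual[OF U(1)] and DD = vectorspace_dual[OF vectorspace_dual[OF U(1)]]
  interpret P: vectorspace class_ring P by (rule P)
  interpret DD: vectorspace class_ring ?DD by (rule DD)
  have dact: "linear_map class_ring ?D ?D (dual_lie_action U act (p x))" if "x \<in> carrier P" for x
    by (rule linear_map_dual_lie_action[where act = act, OF act[OF that]])
  have S: "linear_map class_ring P ?DD (\<lambda>x. ?a (p x) \<xi>)" if xi: "\<xi> \<in> carrier ?DD" for \<xi>
    by (rule linear_map_dual_lie_orbit[where p = p and act = "dual_lie_action U act",
          OF P(1) D dact _ xi], assumption)
      (rule linear_map_dual_lie_orbit[where p = p and act = act, OF P(1) U(1) act orb])
  have rn: "vdim (?DD\<lparr>carrier := lie_orbit q ?a \<xi>\<rparr>) \<le> vdim P"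
    and rn_eq: "(\<And>x. x \<in> carrier P \<Longrightarrow> ?a (p x) \<xi> = \<zero>\<^bsub>?DD\<^esub> \<Longrightarrow> x = \<zero>\<^bsub>P\<^esub>) \<Longrightarrow>
      vdim (?DD\<lparr>carrier := lie_orbit q ?a \<xi>\<rparr>) = vdim P"
    if xi: "\<xi> \<in> carrier ?DD" for \<xi>
  proof -
    interpret S: linear_map class_ring P ?DD "\<lambda>x. ?a (p x) \<xi>" by (rule S[OF xi])
    have im: "S.im = lie_orbit q ?a \<xi>"
      by (auto simp: S.im_def lie_orbit_def q)
    have e: "vdim (?DD\<lparr>carrier := lie_orbit q ?a \<xi>\<rparr>) + vdim (P\<lparr>carrier := S.ker\<rparr>) = vdim P"
      using S.rank_nullity[OF P(2)] unfolding im .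
    then show "vdim (?DD\<lparr>carrier := lie_orbit q ?a \<xi>\<rparr>) \<le> vdim P" by simp
    assume inj: "\<And>x. x \<in> carrier P \<Longrightarrow> ?a (p x) \<xi> = \<zero>\<^bsub>?DD\<^esub> \<Longrightarrow> x = \<zero>\<^bsub>P\<^esub>"
    have "S.ker = {\<zero>\<^bsub>P\<^esub>}" using inj linear_mapD(6)[OF S[OF xi]] by (auto simp: S.ker_def)
    then have "inj_on (\<lambda>x. ?a (p x) \<xi>) (carrier P)" by (intro S.Ke0_imp_inj) simp
    from S.inj_imp_dim_ker0[OF this] e show "vdim (?DD\<lparr>carrier := lie_orbit q ?a \<xi>\<rparr>) = vdim P" by simp
  qed
  have Max: "Max ((\<lambda>\<xi>. vdim (?DD\<lparr>carrier := lie_orbit q ?a \<xi>\<rparr>)) ` carrier ?DD) = vdim P"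
  proof (rule Max_eqI)
    show "finite ((\<lambda>\<xi>. vdim (?DD\<lparr>carrier := lie_orbit q ?a \<xi>\<rparr>)) ` carrier ?DD)"
      by (rule finite_subset[OF image_subsetI finite_atMost[of "vdim P"]]) (simp add: rn)
    show "k \<le> vdim P" if "k \<in> (\<lambda>\<xi>. vdim (?DD\<lparr>carrier := lie_orbit q ?a \<xi>\<rparr>)) ` carrier ?DD" for k
      using that by (elim imageE) (simp add: rn)
    \<comment> \<open>Evaluation at \<open>u\<close>. The two signs of the iterated dual action
      cancel, so acting on it gives evaluation at \<open>act (p x) u\<close>, which is detected by
      functionals.\<close>
    define \<xi> where "\<xi> = restrict (\<lambda>\<eta>. \<eta> u) (carrier ?D)"
    have xi: "\<xi> \<in> carrier ?DD"
      unfolding \<xi>_def by (rule restrict_mem_dual[OF linear_map_eval[OF U(1) u(1)]])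
    have "x = \<zero>\<^bsub>P\<^esub>" if x: "x \<in> carrier P" and z: "?a (p x) \<xi> = \<zero>\<^bsub>?DD\<^esub>" for x
    proof (rule u(2)[OF x])
      show "act (p x) u = \<zero>\<^bsub>U\<^esub>"
      proof (rule dual_separates[OF U])
        show "act (p x) u \<in> carrier U" using linear_mapD(3)[OF act[OF x] u(1)] .
        fix \<eta> assume eta: "\<eta> \<in> carrier ?D"
        have "?a (p x) \<xi> \<eta> = \<eta> (act (p x) u)"
          using eta u(1) linear_mapD(3)[OF dact[OF x] eta]
          by (simp add: dual_lie_action_def[of "dual U"] \<xi>_def) (simp add: dual_lie_action_def)
        moreover have "?a (p x) \<xi> \<eta> = 0" using z eta by (simp add: dual_simps(2))
        ultimately show "\<eta> (act (p x) u) = 0" by simp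
      qed
    qed
    then show "vdim P \<in> (\<lambda>\<xi>. vdim (?DD\<lparr>carrier := lie_orbit q ?a \<xi>\<rparr>)) ` carrier ?DD"
      by (intro image_eqI[where x = \<xi>] rn_eq[OF xi, symmetric] xi)
  qed
  show ?thesis
    unfolding index_def Max using vdim_dual[OF U] by simp
qed

subsection \<open>Quotient spaces\<close>

lemma subspaceI:
  fixes V :: "('k::field, 'v) module"
  assumes "vectorspace class_ring V" "W \<subseteq> carrier V" "\<zero>\<^bsub>V\<^esub> \<in> W"
    and "\<And>u v. u \<in> W \<Longrightarrow> v \<in> W \<Longrightarrow> u \<oplus>\<^bsub>V\<^esub> v \<in> W" "\<And>c v. v \<in> W \<Longrightarrow> c \<odot>\<^bsub>V\<^esub> v \<in> W"
  shows "VectorSpace.subspace class_ring W V"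
  using assms by (auto simp: VectorSpace.subspace_def submodule_def vectorspace_def)

lemma subspaceD:
  fixes V :: "('k::field, 'v) module"
  assumes "VectorSpace.subspace class_ring W V"
  shows "vectorspace class_ring V" "u \<in> W \<Longrightarrow> u \<in> carrier V" "\<zero>\<^bsub>V\<^esub> \<in> W"
    and "u \<in> W \<Longrightarrow> v \<in> W \<Longrightarrow> u \<oplus>\<^bsub>V\<^esub> v \<in> W" "v \<in> W \<Longrightarrow> c \<odot>\<^bsub>V\<^esub> v \<in> W"
    "v \<in> W \<Longrightarrow> \<ominus>\<^bsub>V\<^esub> v \<in> W"
proof -
  interpret W: submodule class_ring W V using assms by (simp add: VectorSpace.subspace_def)
  show V: "vectorspace class_ring V" using assms by (simp add: VectorSpace.subspace_def)
  show sub: "u \<in> W \<Longrightarrow> u \<in> carrier V" for u using W.subset by blast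
  show "\<zero>\<^bsub>V\<^esub> \<in> W" "u \<in> W \<Longrightarrow> v \<in> W \<Longrightarrow> u \<oplus>\<^bsub>V\<^esub> v \<in> W" by simp_all
  show sm: "v \<in> W \<Longrightarrow> c \<odot>\<^bsub>V\<^esub> v \<in> W" for c v by simp
  show "v \<in> W \<Longrightarrow> \<ominus>\<^bsub>V\<^esub> v \<in> W" using sm[of v "-1"] vs_smult(7)[OF V sub, of v] by simp
qed

lemma the_elem_image_const:
  assumes "x \<in> X" "\<And>y. y \<in> X \<Longrightarrow> f y = f x"
  shows "the_elem (f ` X) = f x"
proof -
  have "f ` X = (\<lambda>_. f x) ` X" by (rule image_cong[OF refl assms(2)])
  also have "\<dots> = {f x}" by (rule image_constant[OF assms(1)])
  finally show ?thesis by simp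
qed

context
  fixes V :: "('k::field, 'v) module" and W :: "'v set"
  assumes W: "VectorSpace.subspace class_ring W V"
begin

interpretation V: vectorspace class_ring V by (rule subspaceD(1)[OF W])

lemma abelian_subgroup_subspace: "abelian_subgroup W V"
proof (rule abelian_subgroupI3)
  show "abelian_group V" by (rule V.module.M.abelian_group_axioms)
  show "additive_subgroup W V"
    using subspaceD[OF W]
    by (auto simp: additive_subgroup_def subgroup_def simp flip: a_inv_def)
qed

interpretation S: abelian_subgroup W V by (rule abelian_subgroup_subspace)

lemma mem_coset_iff:
  assumes "u \<in> carrier V"
  shows "v \<in> W +>\<^bsub>V\<^esub> u \<longleftrightarrow> v \<in> carrier V \<and> W +>\<^bsub>V\<^esub> v = W +>\<^bsub>V\<^esub> u"
proof
  assume v: "v \<in> W +>\<^bsub>V\<^esub> u"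
  show "v \<in> carrier V \<and> W +>\<^bsub>V\<^esub> v = W +>\<^bsub>V\<^esub> u"
    using S.a_elemrcos_carrier[OF assms v] S.a_repr_independence'[OF v assms] by simp
next
  assume v: "v \<in> carrier V \<and> W +>\<^bsub>V\<^esub> v = W +>\<^bsub>V\<^esub> u"
  then show "v \<in> W +>\<^bsub>V\<^esub> u" using S.a_rcos_self[of v] by simp
qed

lemma coset_eq_iff:
  assumes "u \<in> carrier V" "v \<in> carrier V"
  shows "W +>\<^bsub>V\<^esub> u = W +>\<^bsub>V\<^esub> v \<longleftrightarrow> u \<ominus>\<^bsub>V\<^esub> v \<in> W"
  using mem_coset_iff[OF assms(2), of u] S.a_rcos_module[OF assms(2,1)] assms(1)
  by (simp add: V.module.M.minus_eq)

lemma quot_space_simps: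
  "carrier (quot_space V W) = (\<lambda>u. W +>\<^bsub>V\<^esub> u) ` carrier V"
  "zero (quot_space V W) = W" "W +>\<^bsub>V\<^esub> \<zero>\<^bsub>V\<^esub> = W"
  "u \<in> carrier V \<Longrightarrow> v \<in> carrier V \<Longrightarrow>
    add (quot_space V W) (W +>\<^bsub>V\<^esub> u) (W +>\<^bsub>V\<^esub> v) = W +>\<^bsub>V\<^esub> (u \<oplus>\<^bsub>V\<^esub> v)"
  by (auto simp: quot_space_def A_RCOSETS_def' S.a_rcos_sum S.a_subset)

text \<open>Two representatives differ by an element of \<open>W\<close>, which \<open>f\<close>
  keeps in \<open>W\<close>; so the map is constant on the coset. This serves both scalar
  multiplication and the induced Lie action on the quotient.\<close>

lemma the_elem_coset_image:
  assumes f: "linear_map class_ring V V f" "\<And>w. w \<in> W \<Longrightarrow> f w \<in> W" and u: "u \<in> carrier V"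
  shows "the_elem ((\<lambda>v. W +>\<^bsub>V\<^esub> f v) ` (W +>\<^bsub>V\<^esub> u)) = W +>\<^bsub>V\<^esub> f u"
proof (rule the_elem_image_const)
  show "u \<in> W +>\<^bsub>V\<^esub> u" using u by (simp add: mem_coset_iff)
  fix v assume "v \<in> W +>\<^bsub>V\<^esub> u"
  then have v: "v \<in> carrier V" "v \<ominus>\<^bsub>V\<^esub> u \<in> W" using u by (auto simp: mem_coset_iff coset_eq_iff)
  then have "f (v \<ominus>\<^bsub>V\<^esub> u) \<in> W" using f(2) by blast
  then show "W +>\<^bsub>V\<^esub> f v = W +>\<^bsub>V\<^esub> f u"
    using v u linear_mapD[OF f(1)] by (simp add: coset_eq_iff V.module.M.minus_eq)
qed

lemma quot_space_smult:
  assumes "u \<in> carrier V"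
  shows "smult (quot_space V W) c (W +>\<^bsub>V\<^esub> u) = W +>\<^bsub>V\<^esub> (c \<odot>\<^bsub>V\<^esub> u)"
proof -
  have "linear_map class_ring V V (\<lambda>v. c \<odot>\<^bsub>V\<^esub> v)"
    using vs_smult[OF V.vectorspace_axioms]
    by (intro linear_mapI V.vectorspace_axioms) (auto simp flip: vs_smult(4)[OF V.vectorspace_axioms] simp: mult.commute)
  from the_elem_coset_image[OF this _ assms] show ?thesis
    using subspaceD(5)[OF W] by (simp add: quot_space_def)
qed

lemma vectorspace_quot_space: "vectorspace class_ring (quot_space V W)"
proof (rule vs_criteria)
  note simps = quot_space_simps quot_space_smult vs_smult[OF V.vectorspace_axioms]
  have closed: "W +>\<^bsub>V\<^esub> u \<in> carrier (quot_space V W)" if "u \<in> carrier V" for u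
    using that by (auto simp: simps)
  show "\<forall>X\<in>carrier (quot_space V W). \<exists>Y\<in>carrier (quot_space V W). X \<oplus>\<^bsub>quot_space V W\<^esub> Y = \<zero>\<^bsub>quot_space V W\<^esub>"
  proof
    fix X assume "X \<in> carrier (quot_space V W)"
    then obtain u where "u \<in> carrier V" "X = W +>\<^bsub>V\<^esub> u" by (auto simp: simps)
    then show "\<exists>Y\<in>carrier (quot_space V W). X \<oplus>\<^bsub>quot_space V W\<^esub> Y = \<zero>\<^bsub>quot_space V W\<^esub>"
      using closed by (intro bexI[of _ "W +>\<^bsub>V\<^esub> (\<ominus>\<^bsub>V\<^esub> u)"]) (auto simp: simps V.module.M.r_neg)
  qed
  show "\<forall>X\<in>carrier (quot_space V W). X \<oplus>\<^bsub>quot_space V W\<^esub> \<zero>\<^bsub>quot_space V W\<^esub> = X"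
  proof
    fix X assume "X \<in> carrier (quot_space V W)"
    then obtain u where "u \<in> carrier V" "X = W +>\<^bsub>V\<^esub> u" by (auto simp: simps)
    then show "X \<oplus>\<^bsub>quot_space V W\<^esub> \<zero>\<^bsub>quot_space V W\<^esub> = X"
      using quot_space_simps(4)[of u "\<zero>\<^bsub>V\<^esub>"] by (simp add: simps)
  qed
  show "\<zero>\<^bsub>quot_space V W\<^esub> \<in> carrier (quot_space V W)"
    using closed[of "\<zero>\<^bsub>V\<^esub>"] by (simp add: simps)
qed (auto simp: quot_space_simps quot_space_smult vs_smult[OF V.vectorspace_axioms] class_field
    V.module.M.a_ac intro!: imageI)

lemma linear_map_proj: "linear_map class_ring V (quot_space V W) (\<lambda>u. W +>\<^bsub>V\<^esub> u)"
  by (rule linear_mapI[OF V.vectorspace_axioms vectorspace_quot_space])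
    (auto simp: quot_space_simps quot_space_smult)

lemma proj_eq_zero_iff:
  assumes "u \<in> carrier V"
  shows "W +>\<^bsub>V\<^esub> u = \<zero>\<^bsub>quot_space V W\<^esub> \<longleftrightarrow> u \<in> W"
  using coset_eq_iff[OF assms V.module.M.zero_closed] assms
    vs_smult(6)[OF V.vectorspace_axioms, of "-1"]
    vs_smult(7)[OF V.vectorspace_axioms V.module.M.zero_closed]
  by (simp add: quot_space_simps V.module.M.minus_eq)

lemma quot_space_dim:
  assumes "vectorspace.fin_dim class_ring V"
  shows "vectorspace.fin_dim class_ring (quot_space V W)"
    and "vdim (quot_space V W) + vdim (V\<lparr>carrier := W\<rparr>) = vdim V"
proof -
  interpret p: linear_map class_ring V "quot_space V W" "\<lambda>u. W +>\<^bsub>V\<^esub> u" by (rule linear_map_proj)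
  have surj: "(\<lambda>u. W +>\<^bsub>V\<^esub> u) ` carrier V = carrier (quot_space V W)" by (simp add: quot_space_simps)
  show "vectorspace.fin_dim class_ring (quot_space V W)" by (rule p.surj_fin_dim[OF assms surj])
  have "p.ker = W" unfolding p.ker_def using subspaceD(2)[OF W] proj_eq_zero_iff by blast
  moreover have "p.im = carrier (quot_space V W)" by (simp add: p.im_def surj)
  ultimately show "vdim (quot_space V W) + vdim (V\<lparr>carrier := W\<rparr>) = vdim V"
    using p.rank_nullity[OF assms] by simp
qed

lemma linear_map_induced:
  assumes f: "linear_map class_ring V V (act x)" "\<And>w. w \<in> W \<Longrightarrow> act x w \<in> W"
  shows "u \<in> carrier V \<Longrightarrow> quot_lie_action V W act x (W +>\<^bsub>V\<^esub> u) = W +>\<^bsub>V\<^esub> act x u"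
    and "linear_map class_ring (quot_space V W) (quot_space V W) (quot_lie_action V W act x)"
proof -
  show eq: "quot_lie_action V W act x (W +>\<^bsub>V\<^esub> u) = W +>\<^bsub>V\<^esub> act x u" if "u \<in> carrier V" for u
    unfolding quot_lie_action_def by (rule the_elem_coset_image[OF f that])
  show "linear_map class_ring (quot_space V W) (quot_space V W) (quot_lie_action V W act x)"
    by (rule linear_mapI[OF vectorspace_quot_space vectorspace_quot_space])
      (use linear_mapD[OF f(1)] in \<open>auto simp: quot_space_simps quot_space_smult eq\<close>)
qed

text \<open>Factorisation of a map through the quotient by a subspace of its kernel, in the form in
  which \<open>sym_lift\<close> is written.\<close>

lemma the_elem_factor:
  fixes X :: "('k, 'x) module"
  assumes f: "linear_map class_ring V X f" "\<And>w. w \<in> W \<Longrightarrow> f w = \<zero>\<^bsub>X\<^esub>"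
  shows "u \<in> carrier V \<Longrightarrow> the_elem (f ` (W +>\<^bsub>V\<^esub> u)) = f u"
    and "linear_map class_ring (quot_space V W) X (\<lambda>Y. the_elem (f ` Y))"
proof -
  interpret X: vectorspace class_ring X by (rule linear_mapD(2)[OF f(1)])
  note fD = linear_mapD[OF f(1)]
  show eq: "the_elem (f ` (W +>\<^bsub>V\<^esub> u)) = f u" if u: "u \<in> carrier V" for u
  proof (rule the_elem_image_const)
    show "u \<in> W +>\<^bsub>V\<^esub> u" using u by (simp add: mem_coset_iff)
    fix v assume "v \<in> W +>\<^bsub>V\<^esub> u"
    then have v: "v \<in> carrier V" "v \<ominus>\<^bsub>V\<^esub> u \<in> W" using u by (auto simp: mem_coset_iff coset_eq_iff)
    then have "f v \<ominus>\<^bsub>X\<^esub> f u = \<zero>\<^bsub>X\<^esub>"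
      using f(2)[OF v(2)] u by (simp add: V.module.M.minus_eq X.module.M.minus_eq fD)
    then show "f v = f u" using v u by (simp add: fD)
  qed
  show "linear_map class_ring (quot_space V W) X (\<lambda>Y. the_elem (f ` Y))"
    by (rule linear_mapI[OF vectorspace_quot_space fD(2)])
      (auto simp: quot_space_simps quot_space_smult eq fD)
qed

end

lemma kernel_subspace:
  fixes V :: "('k::field, 'v) module"
  assumes f: "linear_map class_ring V W f"
  shows "VectorSpace.subspace class_ring {v \<in> carrier V. f v = \<zero>\<^bsub>W\<^esub>} V"
proof -
  interpret f: linear_map class_ring V W f by (rule f)
  show ?thesis using f.kerT_is_subspace by (simp add: f.ker_def)
qed

lemma image_subspace:
  fixes V :: "('k::field, 'v) module"
  assumes f: "linear_map class_ring V W f"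
  shows "VectorSpace.subspace class_ring (f ` carrier V) W"
proof -
  interpret f: linear_map class_ring V W f by (rule f)
  show ?thesis using f.imT_is_subspace by (simp add: f.im_def)
qed

text \<open>Independent sets of \<open>W\<close> stay independent in \<open>V\<close>, so their size
  is bounded; a maximal one exists and generates \<open>W\<close>.\<close>

lemma fin_dim_subspace:
  fixes V :: "('k::field, 'v) module"
  assumes W: "VectorSpace.subspace class_ring W V" and fd: "vectorspace.fin_dim class_ring V"
  shows "vectorspace.fin_dim class_ring (V\<lparr>carrier := W\<rparr>)"
proof -
  interpret V: vectorspace class_ring V by (rule subspaceD(1)[OF W])
  interpret W: vectorspace class_ring "V\<lparr>carrier := W\<rparr>" by (rule V.subspace_is_vs[OF W])
  have sub: "submodule class_ring W V" using W by (simp add: VectorSpace.subspace_def)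
  have WV: "W \<subseteq> carrier V" using subspaceD(2)[OF W] by blast
  have bound: "finite A \<and> card A \<le> V.dim" if "A \<subseteq> carrier (V\<lparr>carrier := W\<rparr>) \<and> W.lin_indpt A" for A
  proof -
    have "A \<subseteq> W" "V.lin_indpt A" using that V.span_li_not_depend(2)[OF _ sub, of A] by auto
    then show ?thesis using V.li_le_dim[OF fd, of A] WV by auto
  qed
  have "W.lin_indpt {}" by (rule W.finite_lin_indpt2) auto
  then obtain A where A: "finite A" "maximal A (\<lambda>A. A \<subseteq> carrier (V\<lparr>carrier := W\<rparr>) \<and> W.lin_indpt A)"
    using maximal_exists[of "\<lambda>A. A \<subseteq> carrier (V\<lparr>carrier := W\<rparr>) \<and> W.lin_indpt A" V.dim "{}"] bound by auto
  have "A \<subseteq> carrier (V\<lparr>carrier := W\<rparr>)" using A(2) by (simp add: maximal_def)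
  then show ?thesis using A(1) W.max_li_is_gen[OF A(2)] unfolding W.fin_dim_def by blast
qed

subsection \<open>Free vector spaces\<close>

lemma free_space_simps:
  "carrier (free_space S) = {f \<in> extensional S. finite {s \<in> S. f s \<noteq> 0}}"
  "zero (free_space S) = (\<lambda>s\<in>S. 0)"
  "add (free_space S) = (\<lambda>f g. \<lambda>s\<in>S. f s + g s)"
  "smult (free_space S) = (\<lambda>c f. \<lambda>s\<in>S. c * f s)"
  by (simp_all add: free_space_def ring.func_space_def[OF class_ring.ring_axioms])

lemma vectorspace_free_space: "vectorspace class_ring (free_space S :: ('k::field, 's \<Rightarrow> 'k) module)"
proof -
  have ext: "f = g" if "f \<in> extensional S" "g \<in> extensional S"
    "\<And>v. v \<in> S \<Longrightarrow> f v = g v" for f g :: "'s \<Rightarrow> 'k"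
    using that by (rule extensionalityI)
  have fin_add: "finite {s \<in> S. f s + g s \<noteq> 0}"
    if "finite {s \<in> S. f s \<noteq> 0}" "finite {s \<in> S. g s \<noteq> 0}" for f g :: "'s \<Rightarrow> 'k"
    by (rule finite_subset[OF _ finite_UnI[OF that]]) auto
  have restr: "{s \<in> S. restrict f S s \<noteq> 0} = {s \<in> S. f s \<noteq> 0}" for f :: "'s \<Rightarrow> 'k" by auto
  have restr': "{s. (s \<in> S \<longrightarrow> P s) \<and> s \<in> S} = {s \<in> S. P s}" for P by auto
  show ?thesis
  proof (rule vs_criteria)
    show "\<forall>f\<in>carrier (free_space S :: ('k, 's \<Rightarrow> 'k) module). \<exists>g\<in>carrier (free_space S).
        f \<oplus>\<^bsub>free_space S\<^esub> g = \<zero>\<^bsub>free_space S\<^esub>"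
    proof
      fix f :: "'s \<Rightarrow> 'k" assume "f \<in> carrier (free_space S)"
      then show "\<exists>g\<in>carrier (free_space S). f \<oplus>\<^bsub>free_space S\<^esub> g = \<zero>\<^bsub>free_space S\<^esub>"
        using restr[of "\<lambda>v. - f v"]
        by (intro bexI[of _ "\<lambda>v\<in>S. - f v"])
          (simp_all only: free_space_simps mem_Collect_eq, auto intro!: ext)
    qed
    show "\<forall>f g. f \<in> carrier (free_space S :: ('k, 's \<Rightarrow> 'k) module) \<and> g \<in> carrier (free_space S) \<longrightarrow>
        f \<oplus>\<^bsub>free_space S\<^esub> g \<in> carrier (free_space S)"
      by (auto simp: free_space_simps restr' fin_add)
    show "\<forall>c f. c \<in> carrier class_ring \<and> f \<in> carrier (free_space S :: ('k, 's \<Rightarrow> 'k) module) \<longrightarrow>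
        c \<odot>\<^bsub>free_space S\<^esub> f \<in> carrier (free_space S)"
      by (auto simp: free_space_simps restr' elim: finite_subset[rotated])
  qed (auto simp: free_space_simps restr class_field algebra_simps intro!: ext)
qed

lemma free_gen_carrier: "s \<in> S \<Longrightarrow> free_gen S s \<in> carrier (free_space S)"
proof -
  have "{t \<in> S. free_gen S s t \<noteq> (0::'b::field)} \<subseteq> {s}" by (auto simp: free_gen_def)
  then show "free_gen S s \<in> carrier (free_space S :: ('b, 'a \<Rightarrow> 'b) module)"
    using finite_subset by (auto simp: free_space_simps free_gen_def)
qed

text \<open>Induction on a finite set containing the support: the coordinate at one point is
  removed, and it is a multiple of a generator.\<close>

lemma free_space_generated:
  fixes S :: "'s set"
  assumes Q: "VectorSpace.subspace class_ring Q (free_space S :: ('k::field, 's \<Rightarrow> 'k) module)"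
    and gen: "\<And>s. s \<in> S \<Longrightarrow> free_gen S s \<in> Q" and f: "f \<in> carrier (free_space S)"
  shows "f \<in> Q"
proof -
  have "f \<in> Q" if "finite A" "f \<in> carrier (free_space S)" "{s \<in> S. f s \<noteq> 0} \<subseteq> A" for A f
    using that
  proof (induct A arbitrary: f)
    case empty
    then have "f = \<zero>\<^bsub>free_space S\<^esub>"
      by (intro extensionalityI[of _ S]) (auto simp: free_space_simps)
    then show ?case using subspaceD(3)[OF Q] by simp
  next
    case (insert a A)
    show ?case
    proof (cases "a \<in> S")
      case False
      then show ?thesis using insert by (intro insert(3)) auto
    next
      case True
      let ?g = "f(a := 0)"
      have "{s \<in> S. ?g s \<noteq> 0} \<subseteq> {s \<in> S. f s \<noteq> 0}" by auto
      then have "finite {s \<in> S. ?g s \<noteq> 0}"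
        using insert(4) by (rule_tac finite_subset) (auto simp: free_space_simps)
      moreover have "?g \<in> extensional S"
        using insert(4) True by (auto simp: free_space_simps extensional_def)
      ultimately have "?g \<in> carrier (free_space S)"
        by (simp only: free_space_simps mem_Collect_eq)
      moreover have "{s \<in> S. ?g s \<noteq> 0} \<subseteq> A" using insert(5) by auto
      ultimately have g: "?g \<in> Q" by (rule insert(3))
      have "f = ?g \<oplus>\<^bsub>free_space S\<^esub> (f a \<odot>\<^bsub>free_space S\<^esub> free_gen S a)"
        using insert(4) True
        by (intro extensionalityI[of _ S]) (auto simp: free_space_simps free_gen_def)
      then show ?thesis using subspaceD(4,5)[OF Q] g gen[OF True] by metis
    qed
  qed
  from this[of "{s \<in> S. f s \<noteq> 0}" f] f show ?thesis by (simp add: free_space_simps)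
qed

text \<open>The sum may run over any finite set containing the support, which gives a common index
  set when functions with different supports are added.\<close>

lemma free_lift_eq:
  fixes W :: "('k::field, 'w) module"
  assumes W: "vectorspace class_ring W" and b: "\<And>s. s \<in> S \<Longrightarrow> b s \<in> carrier W"
    and A: "finite A" "A \<subseteq> S" "{s \<in> S. f s \<noteq> 0} \<subseteq> A"
  shows "free_lift S W b f = (\<Oplus>\<^bsub>W\<^esub>s\<in>A. f s \<odot>\<^bsub>W\<^esub> b s)"
proof -
  interpret W: vectorspace class_ring W by (rule W)
  have c: "f s \<odot>\<^bsub>W\<^esub> b s \<in> carrier W" if "s \<in> S" for s using b[OF that] vs_smult[OF W] by simp
  show ?thesis
    unfolding free_lift_def
    by (rule W.module.M.add.finprod_mono_neutral_cong_left)
      (use A b c vs_smult[OF W] in \<open>auto simp: subset_iff\<close>)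
qed

lemma linear_map_free_lift:
  fixes W :: "('k::field, 'w) module"
  assumes W: "vectorspace class_ring W" and b: "\<And>s. s \<in> S \<Longrightarrow> b s \<in> carrier W"
  shows "linear_map class_ring (free_space S) W (free_lift S W b)"
proof -
  interpret W: vectorspace class_ring W by (rule W)
  have c: "k \<odot>\<^bsub>W\<^esub> b s \<in> carrier W" if "s \<in> S" for s k using b[OF that] vs_smult[OF W] by simp
  show ?thesis
  proof (rule linear_mapI[OF vectorspace_free_space W])
    fix f g :: "'a \<Rightarrow> 'k" and k
    assume f: "f \<in> carrier (free_space S)"
    show "free_lift S W b f \<in> carrier W"
      unfolding free_lift_def using c by (intro W.module.M.finsum_closed) auto
    define A where "A = {s \<in> S. f s \<noteq> 0}"
    have A: "finite A" "A \<subseteq> S" using f by (auto simp: A_def free_space_simps)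
    have "free_lift S W b (k \<odot>\<^bsub>free_space S\<^esub> f) = (\<Oplus>\<^bsub>W\<^esub>s\<in>A. (k \<odot>\<^bsub>free_space S\<^esub> f) s \<odot>\<^bsub>W\<^esub> b s)"
      by (rule free_lift_eq[OF W b A]) (auto simp: A_def free_space_simps)
    also have "\<dots> = (\<Oplus>\<^bsub>W\<^esub>s\<in>A. k \<odot>\<^bsub>W\<^esub> (f s \<odot>\<^bsub>W\<^esub> b s))"
      using A c b by (intro W.module.M.finsum_cong') (auto simp: free_space_simps vs_smult[OF W] subset_iff)
    also have "\<dots> = k \<odot>\<^bsub>W\<^esub> (\<Oplus>\<^bsub>W\<^esub>s\<in>A. f s \<odot>\<^bsub>W\<^esub> b s)"
      using A c by (subst W.finsum_smult) auto
    also have "(\<Oplus>\<^bsub>W\<^esub>s\<in>A. f s \<odot>\<^bsub>W\<^esub> b s) = free_lift S W b f"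
      by (rule free_lift_eq[OF W b A, symmetric]) (auto simp: A_def)
    finally show "free_lift S W b (k \<odot>\<^bsub>free_space S\<^esub> f) = k \<odot>\<^bsub>W\<^esub> free_lift S W b f" .
    assume g: "g \<in> carrier (free_space S)"
    define B where "B = A \<union> {s \<in> S. g s \<noteq> 0}"
    have B: "finite B" "B \<subseteq> S" using A g by (auto simp: B_def free_space_simps)
    have "free_lift S W b (f \<oplus>\<^bsub>free_space S\<^esub> g) = (\<Oplus>\<^bsub>W\<^esub>s\<in>B. (f \<oplus>\<^bsub>free_space S\<^esub> g) s \<odot>\<^bsub>W\<^esub> b s)"
      by (rule free_lift_eq[OF W b B]) (auto simp: A_def B_def free_space_simps)
    also have "\<dots> = (\<Oplus>\<^bsub>W\<^esub>s\<in>B. f s \<odot>\<^bsub>W\<^esub> b s \<oplus>\<^bsub>W\<^esub> g s \<odot>\<^bsub>W\<^esub> b s)"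
      using B c b by (intro W.module.M.finsum_cong') (auto simp: free_space_simps vs_smult[OF W] subset_iff)
    also have "\<dots> = (\<Oplus>\<^bsub>W\<^esub>s\<in>B. f s \<odot>\<^bsub>W\<^esub> b s) \<oplus>\<^bsub>W\<^esub> (\<Oplus>\<^bsub>W\<^esub>s\<in>B. g s \<odot>\<^bsub>W\<^esub> b s)"
      using B c by (intro W.module.M.finsum_addf) auto
    also have "(\<Oplus>\<^bsub>W\<^esub>s\<in>B. f s \<odot>\<^bsub>W\<^esub> b s) = free_lift S W b f"
      by (rule free_lift_eq[OF W b B, symmetric]) (auto simp: A_def B_def)
    also have "(\<Oplus>\<^bsub>W\<^esub>s\<in>B. g s \<odot>\<^bsub>W\<^esub> b s) = free_lift S W b g"
      by (rule free_lift_eq[OF W b B, symmetric]) (auto simp: B_def)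
    finally show "free_lift S W b (f \<oplus>\<^bsub>free_space S\<^esub> g) = free_lift S W b f \<oplus>\<^bsub>W\<^esub> free_lift S W b g" .
  qed
qed

lemma free_lift_gen:
  fixes W :: "('k::field, 'w) module"
  assumes W: "vectorspace class_ring W" and b: "\<And>s. s \<in> S \<Longrightarrow> b s \<in> carrier W" and s: "s \<in> S"
  shows "free_lift S W b (free_gen S s) = b s"
proof -
  interpret W: vectorspace class_ring W by (rule W)
  have "free_lift S W b (free_gen S s) = (\<Oplus>\<^bsub>W\<^esub>t\<in>{s}. free_gen S s t \<odot>\<^bsub>W\<^esub> b t)"
    by (rule free_lift_eq[OF W b]) (use s in \<open>auto simp: free_gen_def\<close>)
  also have "\<dots> = b s"
    using s b[OF s] vs_smult[OF W] by (subst W.module.M.finsum_insert) (auto simp: free_gen_def)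
  finally show ?thesis .
qed

subsection \<open>The universal property of the symmetric square\<close>

text \<open>Linearity is demanded in the first argument and passes to the second by
  symmetry.\<close>

definition sym_bilinear :: "('k::field, 'v) module \<Rightarrow> ('k, 'w) module \<Rightarrow> ('v \<Rightarrow> 'v \<Rightarrow> 'w) \<Rightarrow> bool" where
  "sym_bilinear V W b \<longleftrightarrow>
    (\<forall>u\<in>carrier V. \<forall>v\<in>carrier V. b u v \<in> carrier W \<and> b u v = b v u \<and>
      (\<forall>u'\<in>carrier V. b (u \<oplus>\<^bsub>V\<^esub> u') v = b u v \<oplus>\<^bsub>W\<^esub> b u' v) \<and>
      (\<forall>c. b (c \<odot>\<^bsub>V\<^esub> u) v = c \<odot>\<^bsub>W\<^esub> b u v))"

context
  fixes V :: "('k::field, 'v) module"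
  assumes V: "vectorspace class_ring V"
begin

interpretation V: vectorspace class_ring V by (rule V)
interpretation F: vectorspace class_ring "free_space (carrier V \<times> carrier V) :: ('k, 'v \<times> 'v \<Rightarrow> 'k) module"
  by (rule vectorspace_free_space)

private abbreviation (input) "F \<equiv> free_space (carrier V \<times> carrier V) :: ('k, 'v \<times> 'v \<Rightarrow> 'k) module"
private abbreviation (input) "gen \<equiv> \<lambda>u v. free_gen (carrier V \<times> carrier V) (u, v) :: 'v \<times> 'v \<Rightarrow> 'k"

definition sym_relators :: "('v \<times> 'v \<Rightarrow> 'k) set" where
  "sym_relators =
       {gen (u \<oplus>\<^bsub>V\<^esub> u') v \<ominus>\<^bsub>F\<^esub> (gen u v \<oplus>\<^bsub>F\<^esub> gen u' v) | u u' v.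
           u \<in> carrier V \<and> u' \<in> carrier V \<and> v \<in> carrier V} \<union>
        {gen (c \<odot>\<^bsub>V\<^esub> u) v \<ominus>\<^bsub>F\<^esub> (c \<odot>\<^bsub>F\<^esub> gen u v) | c u v. u \<in> carrier V \<and> v \<in> carrier V} \<union>
        {gen u v \<ominus>\<^bsub>F\<^esub> gen v u | u v. u \<in> carrier V \<and> v \<in> carrier V}"

lemma gen_carrier: "u \<in> carrier V \<Longrightarrow> v \<in> carrier V \<Longrightarrow> gen u v \<in> carrier F"
  by (simp add: free_gen_carrier)

lemma sym_relations_eq: "sym_relations V = F.span sym_relators"
  by (simp add: sym_relations_def sym_relators_def Let_def)

lemma sym_relators_carrier: "sym_relators \<subseteq> carrier F"
  unfolding sym_relators_def
  using gen_carrier vs_smult(8)[OF vectorspace_free_space[of "carrier V \<times> carrier V"]]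
    vs_smult(8)[OF V]
  by (auto intro!: F.module.M.minus_closed F.module.M.a_closed)

lemma subspace_sym_relations: "VectorSpace.subspace class_ring (sym_relations V) F"
  unfolding sym_relations_eq by (rule F.span_is_subspace[OF sym_relators_carrier])

lemma relator_in: "x \<in> sym_relators \<Longrightarrow> x \<in> sym_relations V"
  unfolding sym_relations_eq using F.in_own_span[OF sym_relators_carrier] by blast

lemma vectorspace_sym_square: "vectorspace class_ring (sym_square V)"
  unfolding sym_square_def by (rule vectorspace_quot_space[OF subspace_sym_relations])

lemma sym_bilinear_sym_mult: "sym_bilinear V (sym_square V) (sym_mult V)"
  unfolding sym_bilinear_def
proof (intro ballI conjI allI)
  note Q = quot_space_simps[OF subspace_sym_relations] quot_space_smult[OF subspace_sym_relations]
  note eq = coset_eq_iff[OF subspace_sym_relations]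
  note sm = vs_smult(8)[OF V] vs_smult(8)[OF vectorspace_free_space[of "carrier V \<times> carrier V"]]
  fix u v u' c assume u: "u \<in> carrier V" and v: "v \<in> carrier V"
  show "sym_mult V u v \<in> carrier (sym_square V)"
    using u v by (auto simp: sym_square_def sym_mult_def Q gen_carrier)
  have "gen u v \<ominus>\<^bsub>F\<^esub> gen v u \<in> sym_relators"
    unfolding sym_relators_def using u v by blast
  then show "sym_mult V u v = sym_mult V v u"
    unfolding sym_mult_def using u v by (simp add: eq gen_carrier relator_in)
  have "gen (c \<odot>\<^bsub>V\<^esub> u) v \<ominus>\<^bsub>F\<^esub> (c \<odot>\<^bsub>F\<^esub> gen u v) \<in> sym_relators"
    unfolding sym_relators_def using u v by blast
  then show "sym_mult V (c \<odot>\<^bsub>V\<^esub> u) v = c \<odot>\<^bsub>sym_square V\<^esub> sym_mult V u v"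
    unfolding sym_mult_def sym_square_def using u v by (simp add: Q eq gen_carrier relator_in sm)
  assume u': "u' \<in> carrier V"
  have "gen (u \<oplus>\<^bsub>V\<^esub> u') v \<ominus>\<^bsub>F\<^esub> (gen u v \<oplus>\<^bsub>F\<^esub> gen u' v) \<in> sym_relators"
    unfolding sym_relators_def using u v u' by blast
  then show "sym_mult V (u \<oplus>\<^bsub>V\<^esub> u') v = sym_mult V u v \<oplus>\<^bsub>sym_square V\<^esub> sym_mult V u' v"
    unfolding sym_mult_def sym_square_def using u v u'
    by (simp add: Q eq gen_carrier relator_in sm)
qed

text \<open>The preimage of \<open>Q\<close> in the free space is a subspace containing all
  generators.\<close>

lemma sym_square_generated:
  assumes Q: "VectorSpace.subspace class_ring Q (sym_square V)"
    and gen: "\<And>u v. u \<in> carrier V \<Longrightarrow> v \<in> carrier V \<Longrightarrow> sym_mult V u v \<in> Q"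
    and s: "s \<in> carrier (sym_square V)"
  shows "s \<in> Q"
proof -
  let ?p = "\<lambda>f. sym_relations V +>\<^bsub>F\<^esub> f"
  have p: "linear_map class_ring F (sym_square V) ?p"
    unfolding sym_square_def by (rule linear_map_proj[OF subspace_sym_relations])
  obtain f where f: "f \<in> carrier F" "s = ?p f"
    using s by (auto simp: sym_square_def quot_space_simps[OF subspace_sym_relations])
  have "f \<in> {f \<in> carrier F. ?p f \<in> Q}"
  proof (rule free_space_generated[OF _ _ f(1)])
    show "VectorSpace.subspace class_ring {f \<in> carrier F. ?p f \<in> Q} F"
      using subspaceD[OF Q] linear_mapD[OF p] vs_smult(8)[OF vectorspace_free_space]
      by (intro subspaceI vectorspace_free_space) auto
    show "free_gen (carrier V \<times> carrier V) s \<in> {f \<in> carrier F. ?p f \<in> Q}"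
      if "s \<in> carrier V \<times> carrier V" for s
      using that gen by (auto simp: free_gen_carrier sym_mult_def)
  qed
  then show ?thesis using f by simp
qed

text \<open>The lift to the free space kills the relators by symmetry and bilinearity, hence their
  span, and so it factors through the quotient.\<close>

lemma
  fixes W :: "('k, 'w) module"
  assumes W: "vectorspace class_ring W" and b: "sym_bilinear V W b"
  shows linear_map_sym_lift: "linear_map class_ring (sym_square V) W (sym_lift V W b)"
    and sym_lift_mult: "u \<in> carrier V \<Longrightarrow> v \<in> carrier V \<Longrightarrow> sym_lift V W b (sym_mult V u v) = b u v"
proof -
  interpret W: vectorspace class_ring W by (rule W)
  let ?b = "\<lambda>(u, v). b u v" and ?S = "carrier V \<times> carrier V"
  have bc: "?b s \<in> carrier W" if "s \<in> ?S" for s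
    using b that by (auto simp: sym_bilinear_def)
  define f where "f = free_lift ?S W ?b"
  have f: "linear_map class_ring F W f"
    unfolding f_def by (rule linear_map_free_lift[OF W bc])
  have fgen: "f (gen u v) = b u v" if "u \<in> carrier V" "v \<in> carrier V" for u v
    unfolding f_def using free_lift_gen[where S = ?S and b = ?b and s = "(u, v)", OF W bc] that by simp
  note fD = linear_mapD[OF f]
  note sm = vs_smult(8)[OF V] vs_smult(8)[OF vectorspace_free_space[of "carrier V \<times> carrier V"]]
    vs_smult(8)[OF W]
  have bD: "b u v \<in> carrier W" "b u v = b v u" "b (u \<oplus>\<^bsub>V\<^esub> u') v = b u v \<oplus>\<^bsub>W\<^esub> b u' v"
    "b (c \<odot>\<^bsub>V\<^esub> u) v = c \<odot>\<^bsub>W\<^esub> b u v"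
    if "u \<in> carrier V" "v \<in> carrier V" "u' \<in> carrier V" for u v u' c
    using b that unfolding sym_bilinear_def by blast+
  have fm: "f (x \<ominus>\<^bsub>F\<^esub> y) = f x \<ominus>\<^bsub>W\<^esub> f y" if "x \<in> carrier F" "y \<in> carrier F" for x y
    using that by (simp add: F.module.M.minus_eq W.module.M.minus_eq fD)
  have rel: "f x = \<zero>\<^bsub>W\<^esub>" if "x \<in> sym_relators" for x
  proof -
    from that consider
      (add) u u' v where "x = gen (u \<oplus>\<^bsub>V\<^esub> u') v \<ominus>\<^bsub>F\<^esub> (gen u v \<oplus>\<^bsub>F\<^esub> gen u' v)"
        "u \<in> carrier V" "u' \<in> carrier V" "v \<in> carrier V"
    | (smult) c u v where "x = gen (c \<odot>\<^bsub>V\<^esub> u) v \<ominus>\<^bsub>F\<^esub> (c \<odot>\<^bsub>F\<^esub> gen u v)" "u \<in> carrier V" "v \<in> carrier V"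
    | (swap) u v where "x = gen u v \<ominus>\<^bsub>F\<^esub> gen v u" "u \<in> carrier V" "v \<in> carrier V"
      unfolding sym_relators_def by blast
    then show ?thesis
    proof cases
      case add
      then show ?thesis by (simp add: fm gen_carrier fD fgen bD(1,3) W.module.M.minus_eq W.module.M.r_neg)
    next
      case smult
      then show ?thesis by (simp add: fm gen_carrier sm fD fgen bD(1,4) W.module.M.minus_eq W.module.M.r_neg)
    next
      case swap
      then show ?thesis using bD(1)[of u v u] bD(2)[of u v u]
        by (simp add: fm gen_carrier fgen W.module.M.minus_eq W.module.M.r_neg)
    qed
  qed
  have kill: "f x = \<zero>\<^bsub>W\<^esub>" if "x \<in> sym_relations V" for x
  proof -
    have "VectorSpace.subspace class_ring {f' \<in> carrier F. f f' = \<zero>\<^bsub>W\<^esub>} F" by (rule kernel_subspace[OF f])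
    then have "F.span sym_relators \<subseteq> {f' \<in> carrier F. f f' = \<zero>\<^bsub>W\<^esub>}"
      using rel sym_relators_carrier by (intro F.span_is_subset) (auto simp: VectorSpace.subspace_def)
    then show ?thesis using that unfolding sym_relations_eq by blast
  qed
  note fac = the_elem_factor[OF subspace_sym_relations f kill]
  have eq: "sym_lift V W b = (\<lambda>X. the_elem (f ` X))" by (simp add: sym_lift_def f_def fun_eq_iff)
  show "linear_map class_ring (sym_square V) W (sym_lift V W b)"
    unfolding eq sym_square_def by (rule fac(2))
  show "u \<in> carrier V \<Longrightarrow> v \<in> carrier V \<Longrightarrow> sym_lift V W b (sym_mult V u v) = b u v"
    unfolding eq sym_mult_def using fac(1) gen_carrier fgen by simp
qed

text \<open>The two maps agree on a subspace containing all products. Every identity between maps on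
  the symmetric square is reduced to products in this way, with no basis of the symmetric
  square.\<close>

lemma sym_square_map_eqI:
  fixes W :: "('k, 'w) module"
  assumes f: "linear_map class_ring (sym_square V) W f" and g: "linear_map class_ring (sym_square V) W g"
    and eq: "\<And>u v. u \<in> carrier V \<Longrightarrow> v \<in> carrier V \<Longrightarrow> f (sym_mult V u v) = g (sym_mult V u v)"
    and s: "s \<in> carrier (sym_square V)"
  shows "f s = g s"
proof -
  interpret Q: vectorspace class_ring "sym_square V" by (rule vectorspace_sym_square)
  have c: "sym_mult V u v \<in> carrier (sym_square V)" if "u \<in> carrier V" "v \<in> carrier V" for u v
    using sym_bilinear_sym_mult that by (simp add: sym_bilinear_def)
  have "s \<in> {s \<in> carrier (sym_square V). f s = g s}"
    by (rule sym_square_generated[OF _ _ s])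
      (use linear_mapD[OF f] linear_mapD[OF g] eq c vs_smult(6,8)[OF vectorspace_sym_square] in
        \<open>auto intro!: subspaceI Q.vectorspace_axioms\<close>)
  then show ?thesis by simp
qed

end

subsection \<open>Direct sums and pointwise operations on linear maps\<close>

lemma direct_sum_simps:
  "carrier (direct_sum V W) = carrier V \<times> carrier W"
  "zero (direct_sum V W) = (\<zero>\<^bsub>V\<^esub>, \<zero>\<^bsub>W\<^esub>)"
  "add (direct_sum V W) x y = (fst x \<oplus>\<^bsub>V\<^esub> fst y, snd x \<oplus>\<^bsub>W\<^esub> snd y)"
  "smult (direct_sum V W) c x = (c \<odot>\<^bsub>V\<^esub> fst x, c \<odot>\<^bsub>W\<^esub> snd x)"
  by (simp_all add: direct_sum_def)

lemma linear_map_Pair: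
  assumes "linear_map class_ring X V f" "linear_map class_ring X W g"
  shows "linear_map class_ring X (direct_sum V W) (\<lambda>x. (f x, g x))"
  using linear_mapD[OF assms(1)] linear_mapD[OF assms(2)]
  by (intro linear_mapI direct_sum_is_vs) (auto simp: direct_sum_simps)

lemma linear_map_fst:
  assumes "vectorspace class_ring V" "vectorspace class_ring W"
  shows "linear_map class_ring (direct_sum V W) V fst"
  using assms by (intro linear_mapI direct_sum_is_vs) (auto simp: direct_sum_simps)

lemma linear_map_snd:
  assumes "vectorspace class_ring V" "vectorspace class_ring W"
  shows "linear_map class_ring (direct_sum V W) W snd"
  using assms by (intro linear_mapI direct_sum_is_vs) (auto simp: direct_sum_simps)

lemma linear_map_map_prod:
  assumes "linear_map class_ring V V' f" "linear_map class_ring W W' g"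
  shows "linear_map class_ring (direct_sum V W) (direct_sum V' W') (map_prod f g)"
  using linear_mapD[OF assms(1)] linear_mapD[OF assms(2)]
  by (intro linear_mapI direct_sum_is_vs) (auto simp: direct_sum_simps)

lemma coord_basisD:
  assumes "coord_basis V n b c"
  shows "i < n \<Longrightarrow> b i \<in> carrier V" "i < n \<Longrightarrow> linear_map class_ring V scalars (c i)"
    and "i < n \<Longrightarrow> j < n \<Longrightarrow> c i (b j) = (if i = j then 1 else 0)"
    and "v \<in> carrier V \<Longrightarrow> (\<Oplus>\<^bsub>V\<^esub>i\<in>{..<n}. c i v \<odot>\<^bsub>V\<^esub> b i) = v"
proof -
  note c = assms[unfolded coord_basis_def]
  show "i < n \<Longrightarrow> b i \<in> carrier V" "i < n \<Longrightarrow> linear_map class_ring V scalars (c i)"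
    "i < n \<Longrightarrow> j < n \<Longrightarrow> c i (b j) = (if i = j then 1 else 0)"
    using c by blast+
  assume "v \<in> carrier V"
  with c have "v = (\<Oplus>\<^bsub>V\<^esub>i\<in>{..<n}. c i v \<odot>\<^bsub>V\<^esub> b i)" by blast
  then show "(\<Oplus>\<^bsub>V\<^esub>i\<in>{..<n}. c i v \<odot>\<^bsub>V\<^esub> b i) = v" by (rule sym)
qed

lemma preimage_subspace:
  fixes V :: "('k::field, 'v) module" and W :: "('k, 'w) module"
  assumes f: "linear_map class_ring V W f" and Q: "VectorSpace.subspace class_ring Q W"
  shows "VectorSpace.subspace class_ring {v \<in> carrier V. f v \<in> Q} V"
proof -
  interpret V: vectorspace class_ring V by (rule linear_mapD[OF f])
  show ?thesis
    by (rule subspaceI) (auto simp: linear_mapD[OF f] subspaceD[OF Q] vs_smult[OF V.vectorspace_axioms] V.vectorspace_axioms)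
qed

lemma generated_preimage:
  fixes V :: "('k::field, 'v) module" and W :: "('k, 'w) module"
  assumes f: "linear_map class_ring V W f" and Q: "VectorSpace.subspace class_ring Q W"
    and B: "B \<subseteq> carrier V" "LinearCombinations.module.span class_ring V B = carrier V"
    and fB: "\<And>u. u \<in> B \<Longrightarrow> f u \<in> Q" and v: "v \<in> carrier V"
  shows "f v \<in> Q"
proof -
  interpret V: vectorspace class_ring V by (rule linear_mapD[OF f])
  have "V.span B \<subseteq> {v \<in> carrier V. f v \<in> Q}"
    using preimage_subspace[OF f Q] B(1) fB
    by (intro V.span_is_subset) (auto simp: VectorSpace.subspace_def)
  then show ?thesis using B(2) v by blast
qed

lemma fin_dim_direct_sum:
  fixes V :: "('k::field, 'v) module" and W :: "('k, 'w) module"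
  assumes V: "vectorspace class_ring V" "vectorspace.fin_dim class_ring V"
    and W: "vectorspace class_ring W" "vectorspace.fin_dim class_ring W"
  shows "vectorspace.fin_dim class_ring (direct_sum V W)"
proof -
  interpret V: vectorspace class_ring V by (rule V)
  interpret W: vectorspace class_ring W by (rule W)
  interpret VW: vectorspace class_ring "direct_sum V W" by (rule direct_sum_is_vs[OF V(1) W(1)])
  obtain B where B: "finite B" "B \<subseteq> carrier V" "V.span B = carrier V" using V(2) unfolding V.fin_dim_def by blast
  obtain B' where B': "finite B'" "B' \<subseteq> carrier W" "W.span B' = carrier W" using W(2) unfolding W.fin_dim_def by blast
  define A where "A = inj1 V W ` B \<union> inj2 V W ` B'"
  have A: "finite A" "A \<subseteq> carrier (direct_sum V W)"
    using B B' by (auto simp: A_def direct_sum_simps inj1_def inj2_def)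
  have sub: "VectorSpace.subspace class_ring (VW.span A) (direct_sum V W)"
    by (rule VW.span_is_subspace[OF A(2)])
  have base: "x \<in> VW.span A" if "x \<in> A" for x using VW.in_own_span[OF A(2)] that by blast
  have "p \<in> VW.span A" if p: "p \<in> carrier (direct_sum V W)" for p
  proof -
    have "inj1 V W (fst p) \<in> VW.span A"
      by (rule generated_preimage[OF inj1_linear[OF V(1) W(1)] sub B(2,3)])
        (use p base in \<open>auto simp: A_def direct_sum_simps\<close>)
    moreover have "inj2 V W (snd p) \<in> VW.span A"
      by (rule generated_preimage[OF inj2_linear[OF V(1) W(1)] sub B'(2,3)])
        (use p base in \<open>auto simp: A_def direct_sum_simps\<close>)
    ultimately have "inj1 V W (fst p) \<oplus>\<^bsub>direct_sum V W\<^esub> inj2 V W (snd p) \<in> VW.span A"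
      by (rule subspaceD(4)[OF sub])
    then show ?thesis using p by (auto simp: direct_sum_simps inj1_def inj2_def)
  qed
  then have "VW.span A = carrier (direct_sum V W)" using subspaceD(2)[OF sub] by blast
  then show ?thesis using A unfolding VW.fin_dim_def by blast
qed

lemma linear_map_add:
  fixes V :: "('k::field, 'v) module" and W :: "('k, 'w) module"
  assumes f: "linear_map class_ring V W f" and g: "linear_map class_ring V W g"
  shows "linear_map class_ring V W (\<lambda>v. f v \<oplus>\<^bsub>W\<^esub> g v)"
proof -
  note fD = linear_mapD[OF f] and gD = linear_mapD[OF g]
  interpret W: vectorspace class_ring W by (rule fD)
  show ?thesis
    by (rule linear_mapI) (auto simp: fD gD W.module.M.a_ac vs_smult[OF fD(2)])
qed

lemma linear_map_smult:
  fixes V :: "('k::field, 'v) module" and W :: "('k, 'w) module"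
  assumes f: "linear_map class_ring V W f"
  shows "linear_map class_ring V W (\<lambda>v. k \<odot>\<^bsub>W\<^esub> f v)"
proof -
  note fD = linear_mapD[OF f]
  show ?thesis
    by (rule linear_mapI) (auto simp: fD vs_smult[OF fD(2)] mult.commute simp flip: vs_smult(4)[OF fD(2)])
qed

lemma linear_map_sum_scalars:
  fixes V :: "('k::field, 'v) module"
  assumes V: "vectorspace class_ring V" and f: "\<And>i. i \<in> A \<Longrightarrow> linear_map class_ring V scalars (f i)"
  shows "linear_map class_ring V scalars (\<lambda>v. \<Sum>i\<in>A. f i v)"
  using linear_mapD[OF f]
  by (intro linear_mapI V vectorspace_scalars) (auto simp: sum.distrib sum_distrib_left)

lemma subspace_finsum:
  fixes V :: "('k::field, 'v) module"
  assumes Q: "VectorSpace.subspace class_ring Q V" and g: "\<And>i. i \<in> A \<Longrightarrow> g i \<in> Q"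
  shows "finsum V g A \<in> Q"
proof -
  interpret V: vectorspace class_ring V by (rule subspaceD[OF Q])
  show ?thesis
    using g
  proof (induct A rule: infinite_finite_induct)
    case (insert a A)
    then have "finsum V g (insert a A) = g a \<oplus>\<^bsub>V\<^esub> finsum V g A"
      using subspaceD(2)[OF Q] by (intro V.module.M.finsum_insert) auto
    then show ?case using insert subspaceD(4)[OF Q] by simp
  qed (use subspaceD(3)[OF Q] in auto)
qed

lemma sym_bilinearD:
  assumes "sym_bilinear V W b" "vectorspace class_ring V"
    and "u \<in> carrier V" "v \<in> carrier V" "u' \<in> carrier V"
  shows "b u v \<in> carrier W" "b u v = b v u"
    and "b (u \<oplus>\<^bsub>V\<^esub> u') v = b u v \<oplus>\<^bsub>W\<^esub> b u' v" "b v (u \<oplus>\<^bsub>V\<^esub> u') = b v u \<oplus>\<^bsub>W\<^esub> b v u'"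
    and "b (c \<odot>\<^bsub>V\<^esub> u) v = c \<odot>\<^bsub>W\<^esub> b u v" "b v (c \<odot>\<^bsub>V\<^esub> u) = c \<odot>\<^bsub>W\<^esub> b v u"
proof -
  interpret V: vectorspace class_ring V by fact
  have bc: "b x y \<in> carrier W" "b x y = b y x" "b (x \<oplus>\<^bsub>V\<^esub> z) y = b x y \<oplus>\<^bsub>W\<^esub> b z y"
    "b (c \<odot>\<^bsub>V\<^esub> x) y = c \<odot>\<^bsub>W\<^esub> b x y"
    if "x \<in> carrier V" "y \<in> carrier V" "z \<in> carrier V" for x y z c
    using assms(1) that unfolding sym_bilinear_def by blast+
  show "b u v \<in> carrier W" "b u v = b v u" "b (u \<oplus>\<^bsub>V\<^esub> u') v = b u v \<oplus>\<^bsub>W\<^esub> b u' v"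
    "b (c \<odot>\<^bsub>V\<^esub> u) v = c \<odot>\<^bsub>W\<^esub> b u v" by (rule bc; use assms in simp)+
  show "b v (u \<oplus>\<^bsub>V\<^esub> u') = b v u \<oplus>\<^bsub>W\<^esub> b v u'"
    using bc(2)[of v "u \<oplus>\<^bsub>V\<^esub> u'" v] bc(3)[of u v u'] bc(2)[of v u v] bc(2)[of v u' v] assms by simp
  show "b v (c \<odot>\<^bsub>V\<^esub> u) = c \<odot>\<^bsub>W\<^esub> b v u"
    using bc(2)[of v "c \<odot>\<^bsub>V\<^esub> u" v] bc(4)[of u v u c] bc(2)[of v u v] assms by simp
qed

lemma gl_iff: "x \<in> gl V \<longleftrightarrow> x \<in> extensional (carrier V) \<and> linear_map class_ring V V x"
  if "vectorspace class_ring V"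
  using that by (auto simp: gl_def linear_map_def mod_hom_def mod_hom_axioms_def vectorspace_def)

section \<open>Coordinates on \<open>V\<close>, its endomorphisms and its symmetric square\<close>

locale coord_space =
  fixes V :: "('k::field_char_0, 'v) module" and n :: nat and b :: "nat \<Rightarrow> 'v"
    and c :: "nat \<Rightarrow> 'v \<Rightarrow> 'k"
  assumes V: "vectorspace class_ring V" and cb: "coord_basis V n b c"
begin

sublocale V: vectorspace class_ring V by (rule V)

abbreviation "S \<equiv> sym_square V"
abbreviation "m \<equiv> sym_mult V"
abbreviation "D \<equiv> dual S"
abbreviation "P \<equiv> module_vec TYPE('k) (n * n)"

sublocale S: vectorspace class_ring S by (rule vectorspace_sym_square[OF V])

lemmas vs_S = S.vectorspace_axioms
lemmas vs_D = vectorspace_dual[OF vs_S]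

lemma b_carrier: "i < n \<Longrightarrow> b i \<in> carrier V"
  and c_linear: "i < n \<Longrightarrow> linear_map class_ring V scalars (c i)"
  and c_b: "i < n \<Longrightarrow> j < n \<Longrightarrow> c i (b j) = (if i = j then 1 else 0)"
  and expand: "v \<in> carrier V \<Longrightarrow> (\<Oplus>\<^bsub>V\<^esub>i\<in>{..<n}. c i v \<odot>\<^bsub>V\<^esub> b i) = v"
  using coord_basisD[OF cb] by blast+

lemma basis_generated:
  assumes "VectorSpace.subspace class_ring Q V" "\<And>i. i < n \<Longrightarrow> b i \<in> Q" "v \<in> carrier V"
  shows "v \<in> Q"
proof -
  have "(\<Oplus>\<^bsub>V\<^esub>i\<in>{..<n}. c i v \<odot>\<^bsub>V\<^esub> b i) \<in> Q"
    by (rule subspace_finsum[OF assms(1)]) (use assms(2) subspaceD(5)[OF assms(1)] in auto)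
  then show ?thesis using expand assms(3) by simp
qed

lemma basis_map_eqI:
  assumes f: "linear_map class_ring V W f" and g: "linear_map class_ring V W g"
    and eq: "\<And>i. i < n \<Longrightarrow> f (b i) = g (b i)" and v: "v \<in> carrier V"
  shows "f v = g v"
proof -
  have "v \<in> {v \<in> carrier V. f v = g v}"
    by (rule basis_generated[OF _ _ v])
      (use linear_mapD[OF f] linear_mapD[OF g] eq b_carrier in \<open>auto intro!: subspaceI V\<close>)
  then show ?thesis by simp
qed

lemma coord_eqI:
  assumes "u \<in> carrier V" "v \<in> carrier V" "\<And>i. i < n \<Longrightarrow> c i u = c i v"
  shows "u = v"
proof -
  have "(\<Oplus>\<^bsub>V\<^esub>i\<in>{..<n}. c i u \<odot>\<^bsub>V\<^esub> b i) = (\<Oplus>\<^bsub>V\<^esub>i\<in>{..<n}. c i v \<odot>\<^bsub>V\<^esub> b i)"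
    using assms b_carrier by (intro V.module.M.finsum_cong') (auto simp: vs_smult[OF V])
  then show ?thesis using assms expand by simp
qed

lemma c_finsum:
  assumes "j < n"
  shows "c j (\<Oplus>\<^bsub>V\<^esub>i\<in>{..<n}. a i \<odot>\<^bsub>V\<^esub> b i) = a j"
proof -
  have "c j (\<Oplus>\<^bsub>V\<^esub>i\<in>{..<n}. a i \<odot>\<^bsub>V\<^esub> b i) = (\<Sum>i<n. c j (a i \<odot>\<^bsub>V\<^esub> b i))"
    using b_carrier by (intro linear_functional_finsum[OF c_linear[OF assms]]) (auto simp: vs_smult[OF V])
  also have "\<dots> = (\<Sum>i<n. if j = i then a i else 0)"
    using linear_mapD(5)[OF c_linear[OF assms]] b_carrier assms by (intro sum.cong) (auto simp: c_b)
  finally show ?thesis using assms by simp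
qed

subsection \<open>Endomorphisms as matrices\<close>

definition mat_of :: "('v \<Rightarrow> 'v) \<Rightarrow> 'k mat" where
  "mat_of x = mat n n (\<lambda>(i, j). c i (x (b j)))"

lemma mat_of_carrier: "mat_of x \<in> carrier_mat n n"
  by (simp add: mat_of_def)

lemma c_apply:
  assumes x: "linear_map class_ring V V x" and i: "i < n" and v: "v \<in> carrier V"
  shows "c i (x v) = (\<Sum>j<n. mat_of x $$ (i, j) * c j v)"
proof -
  have "linear_map class_ring V scalars (\<lambda>v. \<Sum>j<n. mat_of x $$ (i, j) * c j v)"
  proof (rule linear_map_sum_scalars[OF V])
    fix j assume "j \<in> {..<n}"
    then show "linear_map class_ring V scalars (\<lambda>v. mat_of x $$ (i, j) * c j v)"
      using linear_map_smult[OF c_linear[of j], of "mat_of x $$ (i, j)"] by simp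
  qed
  then show ?thesis
    using i
    by (intro basis_map_eqI[OF linear_map_comp[OF x c_linear[OF i]] _ _ v])
      (auto simp: mat_of_def c_b if_distrib cong: if_cong)
qed

lemma apply_b:
  assumes x: "linear_map class_ring V V x" and j: "j < n"
  shows "x (b j) = (\<Oplus>\<^bsub>V\<^esub>i\<in>{..<n}. mat_of x $$ (i, j) \<odot>\<^bsub>V\<^esub> b i)"
proof -
  have "x (b j) = (\<Oplus>\<^bsub>V\<^esub>i\<in>{..<n}. c i (x (b j)) \<odot>\<^bsub>V\<^esub> b i)"
    using expand linear_mapD(3)[OF x b_carrier[OF j]] by simp
  also have "\<dots> = (\<Oplus>\<^bsub>V\<^esub>i\<in>{..<n}. mat_of x $$ (i, j) \<odot>\<^bsub>V\<^esub> b i)"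
    using b_carrier j by (intro V.module.M.finsum_cong') (auto simp: vs_smult[OF V] mat_of_def)
  finally show ?thesis .
qed

text \<open>The Lie algebra is only a set of functions; \<open>par\<close> parametrises it by
  vectors of length \<open>n * n\<close>, the matrix written row by row, and so supplies its vector
  space structure.\<close>

definition par :: "'k vec \<Rightarrow> 'v \<Rightarrow> 'v" where
  "par z = (\<lambda>v\<in>carrier V. \<Oplus>\<^bsub>V\<^esub>i\<in>{..<n}. (\<Sum>j<n. z $ (i * n + j) * c j v) \<odot>\<^bsub>V\<^esub> b i)"

lemma c_par: "i < n \<Longrightarrow> v \<in> carrier V \<Longrightarrow> c i (par z v) = (\<Sum>j<n. z $ (i * n + j) * c j v)"
  by (simp add: par_def c_finsum)

lemma par_carrier: "v \<in> carrier V \<Longrightarrow> par z v \<in> carrier V"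
  using b_carrier by (simp add: par_def)

lemma linear_par: "linear_map class_ring V V (par z)"
proof (rule linear_mapI[OF V V])
  fix u v r assume u: "u \<in> carrier V"
  show "par z u \<in> carrier V" by (rule par_carrier[OF u])
  show "par z (r \<odot>\<^bsub>V\<^esub> u) = r \<odot>\<^bsub>V\<^esub> par z u"
    using u par_carrier linear_mapD[OF c_linear]
    by (intro coord_eqI) (auto simp: vs_smult[OF V] c_par sum_distrib_left mult_ac)
  assume v: "v \<in> carrier V"
  show "par z (u \<oplus>\<^bsub>V\<^esub> v) = par z u \<oplus>\<^bsub>V\<^esub> par z v"
    using u v par_carrier linear_mapD[OF c_linear]
    by (intro coord_eqI) (auto simp: c_par distrib_left sum.distrib)
qed

lemma par_gl: "par z \<in> gl V"
  using linear_par by (simp add: gl_iff[OF V] par_def)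

lemma index_less: "i < n \<Longrightarrow> j < n \<Longrightarrow> i * n + j < n * n"
  by (metis add.commute add_less_cancel_left less_le_trans mult_Suc mult_le_mono1 Suc_leI)

lemma gl_eq_par: "gl V = par ` carrier P"
proof
  show "par ` carrier P \<subseteq> gl V" using par_gl by auto
  show "gl V \<subseteq> par ` carrier P"
  proof
    fix x assume "x \<in> gl V"
    then have x: "x \<in> extensional (carrier V)" "linear_map class_ring V V x" by (auto simp: gl_iff[OF V])
    let ?z = "vec (n * n) (\<lambda>k. mat_of x $$ (k div n, k mod n))"
    have "x = par ?z"
    proof (rule extensionalityI[OF x(1)])
      fix v assume v: "v \<in> carrier V"
      show "x v = par ?z v"
      proof (rule coord_eqI)
        fix i assume i: "i < n"
        show "c i (x v) = c i (par ?z v)"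
          unfolding c_apply[OF x(2) i v] c_par[OF i v]
          using i by (intro sum.cong) (auto simp: index_less)
      qed (use v x par_carrier in \<open>auto simp: linear_mapD\<close>)
    qed (simp add: par_def)
    then show "x \<in> par ` carrier P" by (auto simp: module_vec_simps)
  qed
qed

lemma par_eq_zero:
  assumes z: "z \<in> carrier P" and 0: "mat_of (par z) = 0\<^sub>m n n"
  shows "z = \<zero>\<^bsub>P\<^esub>"
proof -
  have entry: "z $ (i * n + j) = 0" if ij: "i < n" "j < n" for i j
  proof -
    have "mat_of (par z) $$ (i, j) = (\<Sum>k<n. z $ (i * n + k) * c k (b j))"
      using ij b_carrier by (simp add: mat_of_def c_par)
    also have "\<dots> = (\<Sum>k<n. if k = j then z $ (i * n + k) else 0)"
      using ij by (intro sum.cong) (auto simp: c_b)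
    finally show ?thesis using 0 ij by simp
  qed
  show ?thesis
  proof (rule eq_vecI)
    fix k assume "k < dim_vec \<zero>\<^bsub>P\<^esub>"
    then have k: "k < n * n" by (simp add: module_vec_simps)
    then have "0 < n" by (cases n) auto
    moreover have "k div n < n" using k by (simp add: less_mult_imp_div_less)
    ultimately have "z $ (k div n * n + k mod n) = 0" by (intro entry) auto
    then show "z $ k = \<zero>\<^bsub>P\<^esub> $ k" using k by (simp add: module_vec_simps)
  qed (use z in \<open>simp add: module_vec_simps\<close>)
qed

lemma linear_par_arg: "v \<in> carrier V \<Longrightarrow> linear_map class_ring P V (\<lambda>z. par z v)"
proof (rule linear_mapI[OF vec_vs V])
  assume v: "v \<in> carrier V"
  fix z w :: "'k vec" and r
  assume z: "z \<in> carrier P"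
  show "par z v \<in> carrier V" by (rule par_carrier[OF v])
  show "par (r \<odot>\<^bsub>P\<^esub> z) v = r \<odot>\<^bsub>V\<^esub> par z v"
    using z v par_carrier linear_mapD(5)[OF c_linear]
    by (intro coord_eqI)
      (auto simp: vs_smult[OF V] c_par module_vec_simps index_less sum_distrib_left mult_ac intro!: sum.cong)
  assume w: "w \<in> carrier P"
  show "par (z \<oplus>\<^bsub>P\<^esub> w) v = par z v \<oplus>\<^bsub>V\<^esub> par w v"
    using z w v par_carrier linear_mapD(4)[OF c_linear]
    by (intro coord_eqI)
      (auto simp: c_par module_vec_simps index_less distrib_right sum.distrib intro!: sum.cong)
qed

end

context coord_space
begin

subsection \<open>The action on the symmetric square in coordinates\<close>

lemmas m_bilinear = sym_bilinear_sym_mult[OF V]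
lemmas mD = sym_bilinearD[OF m_bilinear V]

lemma m_carrier: "u \<in> carrier V \<Longrightarrow> v \<in> carrier V \<Longrightarrow> m u v \<in> carrier S"
  and m_commute: "u \<in> carrier V \<Longrightarrow> v \<in> carrier V \<Longrightarrow> m u v = m v u"
  using mD(1,2)[of u v u] by simp_all

lemma m_linear: "v \<in> carrier V \<Longrightarrow> linear_map class_ring V S (\<lambda>u. m u v)"
  by (rule linear_mapI[OF V vs_S]) (auto simp: mD)

lemma products_generate:
  assumes Q: "VectorSpace.subspace class_ring Q S"
    and b: "\<And>i j. i < n \<Longrightarrow> j < n \<Longrightarrow> m (b i) (b j) \<in> Q" and s: "s \<in> carrier S"
  shows "s \<in> Q"
proof -
  have 1: "m u (b j) \<in> Q" if "j < n" "u \<in> carrier V" for j u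
  proof -
    have "u \<in> {u \<in> carrier V. m u (b j) \<in> Q}"
      by (rule basis_generated[OF preimage_subspace[OF m_linear Q]])
        (use that b b_carrier in auto)
    then show ?thesis by simp
  qed
  have "m u v \<in> Q" if "v \<in> carrier V" "u \<in> carrier V" for u v
  proof -
    have "v \<in> {v \<in> carrier V. m v u \<in> Q}"
      by (rule basis_generated[OF preimage_subspace[OF m_linear Q]])
        (use that 1 b_carrier m_commute in auto)
    then show ?thesis using that m_commute by simp
  qed
  then show ?thesis using sym_square_generated[OF V Q _ s] by simp
qed

lemma fin_dim_S: "vectorspace.fin_dim class_ring S"
proof -
  define A where "A = (\<lambda>(i, j). m (b i) (b j)) ` ({..<n} \<times> {..<n})"
  have A: "finite A" "A \<subseteq> carrier S" using m_carrier b_carrier by (auto simp: A_def)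
  have sub: "VectorSpace.subspace class_ring (S.span A) S" by (rule S.span_is_subspace[OF A(2)])
  have "m (b i) (b j) \<in> S.span A" if "i < n" "j < n" for i j
    using S.in_own_span[OF A(2)] that by (auto simp: A_def)
  then have "S.span A = carrier S" using products_generate[OF sub] subspaceD(2)[OF sub] by blast
  then show ?thesis using A unfolding S.fin_dim_def by blast
qed

abbreviation "act \<equiv> sym_square_gl_action V"

lemma sym_bilinear_act:
  assumes x: "linear_map class_ring V V x"
  shows "sym_bilinear V S (\<lambda>u v. m (x u) v \<oplus>\<^bsub>S\<^esub> m u (x v))"
  unfolding sym_bilinear_def
proof (intro ballI conjI allI)
  note xD = linear_mapD[OF x]
  fix u v u' k assume u: "u \<in> carrier V" and v: "v \<in> carrier V"
  show "m (x u) v \<oplus>\<^bsub>S\<^esub> m u (x v) \<in> carrier S" using u v by (simp add: m_carrier xD)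
  show "m (x u) v \<oplus>\<^bsub>S\<^esub> m u (x v) = m (x v) u \<oplus>\<^bsub>S\<^esub> m v (x u)"
    using m_commute[of "x u" v] m_commute[of u "x v"] u v
    by (simp add: m_carrier xD S.module.M.a_comm)
  show "m (x (k \<odot>\<^bsub>V\<^esub> u)) v \<oplus>\<^bsub>S\<^esub> m (k \<odot>\<^bsub>V\<^esub> u) (x v) = k \<odot>\<^bsub>S\<^esub> (m (x u) v \<oplus>\<^bsub>S\<^esub> m u (x v))"
    using u v by (simp add: m_carrier xD mD vs_smult[OF vs_S])
  assume u': "u' \<in> carrier V"
  show "m (x (u \<oplus>\<^bsub>V\<^esub> u')) v \<oplus>\<^bsub>S\<^esub> m (u \<oplus>\<^bsub>V\<^esub> u') (x v) =
      (m (x u) v \<oplus>\<^bsub>S\<^esub> m u (x v)) \<oplus>\<^bsub>S\<^esub> (m (x u') v \<oplus>\<^bsub>S\<^esub> m u' (x v))"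
    using u v u' by (simp add: m_carrier xD mD S.module.M.a_ac)
qed

lemma act_linear: "linear_map class_ring V V x \<Longrightarrow> linear_map class_ring S S (act x)"
  unfolding sym_square_gl_action_def by (rule linear_map_sym_lift[OF V vs_S sym_bilinear_act])

lemma act_m:
  "linear_map class_ring V V x \<Longrightarrow> u \<in> carrier V \<Longrightarrow> v \<in> carrier V \<Longrightarrow>
    act x (m u v) = m (x u) v \<oplus>\<^bsub>S\<^esub> m u (x v)"
  unfolding sym_square_gl_action_def by (rule sym_lift_mult[OF V vs_S sym_bilinear_act])

lemma act_orbit_linear:
  assumes s: "s \<in> carrier S"
  shows "linear_map class_ring P S (\<lambda>z. act (par z) s)"
proof (rule linear_mapI[OF vec_vs vs_S])
  fix z w :: "'k vec" and r
  note A = act_linear[OF linear_par]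
  assume z: "z \<in> carrier P"
  show "act (par z) s \<in> carrier S" using linear_mapD(3)[OF A s] .
  note pD = linear_mapD[OF linear_par_arg]
  show "act (par (r \<odot>\<^bsub>P\<^esub> z)) s = r \<odot>\<^bsub>S\<^esub> act (par z) s"
    by (rule sym_square_map_eqI[OF V A linear_map_smult[OF A] _ s])
      (use z in \<open>simp add: act_m linear_par pD mD par_carrier m_carrier vs_smult[OF vs_S]\<close>)
  assume w: "w \<in> carrier P"
  show "act (par (z \<oplus>\<^bsub>P\<^esub> w)) s = act (par z) s \<oplus>\<^bsub>S\<^esub> act (par w) s"
    by (rule sym_square_map_eqI[OF V A linear_map_add[OF A A] _ s])
      (use z w in \<open>simp add: act_m linear_par pD mD par_carrier m_carrier S.module.M.a_ac\<close>)
qed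

text \<open>The commutator, restricted so that it is an element of \<open>gl V\<close>.\<close>

definition bracket :: "('v \<Rightarrow> 'v) \<Rightarrow> ('v \<Rightarrow> 'v) \<Rightarrow> 'v \<Rightarrow> 'v" where
  "bracket x y = (\<lambda>v\<in>carrier V. x (y v) \<oplus>\<^bsub>V\<^esub> (-1) \<odot>\<^bsub>V\<^esub> y (x v))"

lemma bracket_gl:
  assumes x: "linear_map class_ring V V x" and y: "linear_map class_ring V V y"
  shows "bracket x y \<in> gl V"
proof -
  have "linear_map class_ring V V (\<lambda>v. x (y v) \<oplus>\<^bsub>V\<^esub> (-1) \<odot>\<^bsub>V\<^esub> y (x v))"
    by (intro linear_map_add linear_map_smult linear_map_comp[OF x y] linear_map_comp[OF y x])
  from linear_map_cong[OF this, of "bracket x y"] show ?thesis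
    by (simp add: gl_iff[OF V] bracket_def)
qed

text \<open>Compatibility with brackets, checked on products by the derivation rule and arranged as
  a sum so that no difference has to be rewritten.\<close>

lemma act_bracket:
  assumes x: "linear_map class_ring V V x" and y: "linear_map class_ring V V y"
    and s: "s \<in> carrier S"
  shows "act x (act y s) = act y (act x s) \<oplus>\<^bsub>S\<^esub> act (bracket x y) s"
proof -
  have l: "linear_map class_ring V V (bracket x y)" using bracket_gl[OF x y] by (simp add: gl_iff[OF V])
  note xD = linear_mapD[OF x] and yD = linear_mapD[OF y] and lD = linear_mapD[OF l]
  note X = act_linear[OF x] and Y = act_linear[OF y] and L = act_linear[OF l]
  have e: "x (y u) = y (x u) \<oplus>\<^bsub>V\<^esub> bracket x y u" if u: "u \<in> carrier V" for u
  proof -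
    have "y (x u) \<oplus>\<^bsub>V\<^esub> ((-1) \<odot>\<^bsub>V\<^esub> y (x u) \<oplus>\<^bsub>V\<^esub> x (y u)) = x (y u)"
      using u by (simp add: xD yD vs_smult[OF V] V.module.M.r_neg flip: V.module.M.a_assoc)
    then show ?thesis using u by (simp add: bracket_def xD yD vs_smult[OF V] V.module.M.a_comm)
  qed
  show ?thesis
  proof (rule sym_square_map_eqI[OF V linear_map_comp[OF Y X]
        linear_map_add[OF linear_map_comp[OF X Y] L] _ s])
    fix u v assume uv: "u \<in> carrier V" "v \<in> carrier V"
    have "act x (act y (m u v)) = (m (x (y u)) v \<oplus>\<^bsub>S\<^esub> m (y u) (x v)) \<oplus>\<^bsub>S\<^esub> (m (x u) (y v) \<oplus>\<^bsub>S\<^esub> m u (x (y v)))"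
      using uv by (simp add: act_m x y yD linear_mapD[OF X] m_carrier)
    also have "m (x (y u)) v = m (y (x u)) v \<oplus>\<^bsub>S\<^esub> m (bracket x y u) v"
      using uv by (simp add: e xD yD lD mD)
    also have "m u (x (y v)) = m u (y (x v)) \<oplus>\<^bsub>S\<^esub> m u (bracket x y v)"
      using uv by (simp add: e xD yD lD mD)
    finally show "act x (act y (m u v)) = act y (act x (m u v)) \<oplus>\<^bsub>S\<^esub> act (bracket x y) (m u v)"
      using uv by (simp add: act_m x y l xD yD lD linear_mapD[OF Y] m_carrier S.module.M.a_ac)
  qed
qed

text \<open>Symmetrised without the factor 1/2, so \<open>phi i j\<close> reads off twice the entry
  of the symmetric tensor: the product of \<open>b k\<close> and \<open>b l\<close> becomes the sum
  of two matrix units, \<open>(k, l)\<close> and \<open>(l, k)\<close>.\<close>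

definition phi_form :: "nat \<Rightarrow> nat \<Rightarrow> 'v \<Rightarrow> 'v \<Rightarrow> 'k" where
  "phi_form i j u v = c i u * c j v + c j u * c i v"

lemma sym_bilinear_phi: "i < n \<Longrightarrow> j < n \<Longrightarrow> sym_bilinear V scalars (phi_form i j)"
  unfolding sym_bilinear_def phi_form_def
  using linear_mapD[OF c_linear[of i]] linear_mapD[OF c_linear[of j]]
  by (auto simp: algebra_simps)

definition phi :: "nat \<Rightarrow> nat \<Rightarrow> ('v \<times> 'v \<Rightarrow> 'k) set \<Rightarrow> 'k" where
  "phi i j = sym_lift V scalars (phi_form i j)"

lemma phi_linear: "i < n \<Longrightarrow> j < n \<Longrightarrow> linear_map class_ring S scalars (phi i j)"
  unfolding phi_def by (rule linear_map_sym_lift[OF V vectorspace_scalars sym_bilinear_phi])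

lemma phi_m: "i < n \<Longrightarrow> j < n \<Longrightarrow> u \<in> carrier V \<Longrightarrow> v \<in> carrier V \<Longrightarrow>
    phi i j (m u v) = c i u * c j v + c j u * c i v"
  unfolding phi_def using sym_lift_mult[OF V vectorspace_scalars sym_bilinear_phi]
  by (simp add: phi_form_def)

lemma phi_commute: "phi i j = phi j i"
proof -
  have "phi_form i j = phi_form j i" by (simp add: phi_form_def fun_eq_iff add.commute)
  then show ?thesis by (simp add: phi_def)
qed

definition phi_mat :: "('v \<times> 'v \<Rightarrow> 'k) set \<Rightarrow> 'k mat" where
  "phi_mat s = mat n n (\<lambda>(i, j). phi i j s)"

text \<open>The Gram matrix of the symmetric bilinear form on \<open>V\<close> that corresponds to a
  functional on the symmetric square.\<close>

definition psi_mat :: "(('v \<times> 'v \<Rightarrow> 'k) set \<Rightarrow> 'k) \<Rightarrow> 'k mat" where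
  "psi_mat \<eta> = mat n n (\<lambda>(i, j). \<eta> (m (b i) (b j)))"

lemma mat_carrier: "phi_mat s \<in> carrier_mat n n" "psi_mat \<eta> \<in> carrier_mat n n"
  by (simp_all add: phi_mat_def psi_mat_def)

lemma mat_symmetric: "transpose_mat (phi_mat s) = phi_mat s" "transpose_mat (psi_mat \<eta>) = psi_mat \<eta>"
proof -
  show "transpose_mat (phi_mat s) = phi_mat s"
    by (rule eq_matI) (auto simp: phi_mat_def intro: fun_cong[OF phi_commute])
  show "transpose_mat (psi_mat \<eta>) = psi_mat \<eta>"
    by (rule eq_matI) (auto simp: psi_mat_def b_carrier m_commute)
qed

lemma linear_sum_smult:
  fixes a :: "nat \<Rightarrow> 'k" and X :: "('k, 'x) module"
  assumes "vectorspace class_ring X" "\<And>k. k < n \<Longrightarrow> linear_map class_ring X scalars (f k)"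
  shows "linear_map class_ring X scalars (\<lambda>v. \<Sum>k<n. a k * f k v)"
proof (rule linear_map_sum_scalars[OF assms(1)])
  fix k assume "k \<in> {..<n}"
  then show "linear_map class_ring X scalars (\<lambda>v. a k * f k v)"
    using linear_map_smult[OF assms(2)[of k], of "a k"] by simp
qed

lemma linear_scalars_add:
  fixes X :: "('k, 'x) module"
  assumes "linear_map class_ring X scalars f" "linear_map class_ring X scalars g"
  shows "linear_map class_ring X scalars (\<lambda>v. f v + g v)"
  using linear_map_add[OF assms] by simp

lemma phi_act:
  assumes x: "linear_map class_ring V V x" and s: "s \<in> carrier S" and ij: "i < n" "j < n"
  shows "phi i j (act x s) = (\<Sum>k<n. mat_of x $$ (i, k) * phi k j s) + (\<Sum>k<n. mat_of x $$ (j, k) * phi i k s)"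
proof (rule sym_square_map_eqI[OF V linear_map_comp[OF act_linear[OF x] phi_linear[OF ij]] _ _ s])
  show "linear_map class_ring S scalars
      (\<lambda>s. (\<Sum>k<n. mat_of x $$ (i, k) * phi k j s) + (\<Sum>k<n. mat_of x $$ (j, k) * phi i k s))"
    by (intro linear_scalars_add linear_sum_smult vs_S phi_linear ij)
  fix u v assume uv: "u \<in> carrier V" "v \<in> carrier V"
  note xD = linear_mapD[OF x]
  have "(\<Sum>k<n. mat_of x $$ (i, k) * phi k j (m u v)) = c i (x u) * c j v + c j u * c i (x v)"
    using ij uv
    by (simp add: phi_m c_apply[OF x] distrib_left sum.distrib sum_distrib_left sum_distrib_right mult_ac)
  moreover have "(\<Sum>k<n. mat_of x $$ (j, k) * phi i k (m u v)) = c j (x u) * c i v + c i u * c j (x v)"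
    using ij uv
    by (simp add: phi_m c_apply[OF x] distrib_left sum.distrib sum_distrib_left sum_distrib_right mult_ac)
  moreover have "phi i j (act x (m u v)) = (c i (x u) * c j v + c j (x u) * c i v) + (c i u * c j (x v) + c j u * c i (x v))"
    using ij uv by (simp add: act_m[OF x] linear_mapD[OF phi_linear] phi_m xD m_carrier)
  ultimately show "phi i j (act x (m u v)) = (\<Sum>k<n. mat_of x $$ (i, k) * phi k j (m u v)) +
      (\<Sum>k<n. mat_of x $$ (j, k) * phi i k (m u v))" by simp
qed

lemma phi_mat_act:
  assumes x: "linear_map class_ring V V x" and s: "s \<in> carrier S"
  shows "phi_mat (act x s) = mat_of x * phi_mat s + phi_mat s * transpose_mat (mat_of x)"
  using mat_of_carrier[of x] mat_carrier(1)[of s] mat_carrier(1)[of "act x s"]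
  by (intro eq_matI)
    (auto simp: scalar_prod_def phi_mat_def phi_act[OF x s] atLeast0LessThan mult.commute)

lemma eta_linear: "\<eta> \<in> carrier D \<Longrightarrow> linear_map class_ring S scalars \<eta>"
  by (simp add: mem_dual_iff[OF vs_S])

lemma eta_expand:
  assumes eta: "\<eta> \<in> carrier D" and x: "linear_map class_ring V V x" and i: "i < n" and v: "v \<in> carrier V"
  shows "\<eta> (m (x (b i)) v) = (\<Sum>k<n. mat_of x $$ (k, i) * \<eta> (m (b k) v))"
proof -
  have f: "linear_map class_ring V scalars (\<lambda>u. \<eta> (m u v))"
    by (rule linear_map_comp[OF m_linear[OF v] eta_linear[OF eta]])
  have "\<eta> (m (x (b i)) v) = (\<Sum>k<n. \<eta> (m (mat_of x $$ (k, i) \<odot>\<^bsub>V\<^esub> b k) v))"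
    unfolding apply_b[OF x i] using b_carrier
    by (intro linear_functional_finsum[OF f]) (auto simp: vs_smult[OF V])
  also have "\<dots> = (\<Sum>k<n. mat_of x $$ (k, i) * \<eta> (m (b k) v))"
    using linear_mapD(5)[OF f] b_carrier by simp
  finally show ?thesis .
qed

lemma psi_mat_act:
  assumes x: "linear_map class_ring V V x" and eta: "\<eta> \<in> carrier D"
  shows "psi_mat (dual_lie_action S act x \<eta>) =
    - (transpose_mat (mat_of x) * psi_mat \<eta> + psi_mat \<eta> * mat_of x)"
proof (rule eq_matI)
  fix i j
  assume "i < dim_row (- (transpose_mat (mat_of x) * psi_mat \<eta> + psi_mat \<eta> * mat_of x))"
    "j < dim_col (- (transpose_mat (mat_of x) * psi_mat \<eta> + psi_mat \<eta> * mat_of x))"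
  then have ij: "i < n" "j < n" using mat_carrier(2)[of \<eta>] mat_of_carrier[of x] by auto
  note xb = linear_mapD(3)[OF x b_carrier]
  have "psi_mat (dual_lie_action S act x \<eta>) $$ (i, j) = - \<eta> (m (x (b i)) (b j) \<oplus>\<^bsub>S\<^esub> m (b i) (x (b j)))"
    using ij b_carrier by (simp add: psi_mat_def dual_lie_action_def m_carrier act_m[OF x])
  also have "\<dots> = - (\<eta> (m (x (b i)) (b j)) + \<eta> (m (x (b j)) (b i)))"
    using ij b_carrier xb m_commute[of "b i" "x (b j)"]
    by (simp add: linear_mapD[OF eta_linear[OF eta]] m_carrier)
  also have "\<dots> = - ((\<Sum>k<n. mat_of x $$ (k, i) * \<eta> (m (b k) (b j))) + (\<Sum>k<n. mat_of x $$ (k, j) * \<eta> (m (b i) (b k))))"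
    using ij b_carrier m_commute[of "b i"] by (simp add: eta_expand[OF eta x])
  also have "\<dots> = (- (transpose_mat (mat_of x) * psi_mat \<eta> + psi_mat \<eta> * mat_of x)) $$ (i, j)"
    using ij mat_carrier(2)[of \<eta>] mat_of_carrier[of x]
    by (simp add: scalar_prod_def atLeast0LessThan psi_mat_def mult.commute)
  finally show "psi_mat (dual_lie_action S act x \<eta>) $$ (i, j) =
    (- (transpose_mat (mat_of x) * psi_mat \<eta> + psi_mat \<eta> * mat_of x)) $$ (i, j)" .
qed (use mat_carrier(2) mat_of_carrier[of x] in \<open>auto simp: psi_mat_def\<close>)

lemma phi_mat_surj:
  assumes Q: "Q \<in> carrier_mat n n" "transpose_mat Q = Q"
  shows "\<exists>s\<in>carrier S. phi_mat s = Q"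
proof -
  let ?I = "{..<n} \<times> {..<n}"
  \<comment> \<open>Each ordered pair contributes two matrix units, the diagonal ones twice the
    same; summing over all ordered pairs counts every entry of \<open>Q\<close> twice, hence the
    division by 2.\<close>
  let ?g = "\<lambda>p. (Q $$ p / 2) \<odot>\<^bsub>S\<^esub> m (b (fst p)) (b (snd p))"
  have g: "?g p \<in> carrier S" if "p \<in> ?I" for p
    using that m_carrier b_carrier by (auto simp: vs_smult[OF vs_S])
  define s where "s = finsum S ?g ?I"
  have s: "s \<in> carrier S" unfolding s_def using g by (intro S.module.M.finsum_closed) auto
  have "phi i j s = Q $$ (i, j)" if ij: "i < n" "j < n" for i j
  proof -
    have sym: "Q $$ (j, i) = Q $$ (i, j)" using Q ij by (metis carrier_matD index_transpose_mat(1))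
    have "phi i j s = (\<Sum>p\<in>?I. phi i j (?g p))"
      unfolding s_def using g by (intro linear_functional_finsum[OF phi_linear[OF ij]]) auto
    also have "\<dots> = (\<Sum>p\<in>?I. (if p = (i, j) then Q $$ p / 2 else 0) + (if p = (j, i) then Q $$ p / 2 else 0))"
    proof (rule sum.cong[OF refl])
      fix p assume "p \<in> ?I"
      then obtain k l where p: "p = (k, l)" "k < n" "l < n" by auto
      have e: "phi i j (?g p) = Q $$ p / 2 * (c i (b k) * c j (b l) + c j (b k) * c i (b l))"
        using p ij b_carrier m_carrier by (simp add: linear_mapD[OF phi_linear] phi_m)
      have "c i (b k) = (if i = k then 1 else 0)" "c j (b l) = (if j = l then 1 else 0)"
        "c j (b k) = (if j = k then 1 else 0)" "c i (b l) = (if i = l then 1 else 0)"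
        using p ij by (simp_all add: c_b)
      then have "Q $$ p / 2 * (c i (b k) * c j (b l) + c j (b k) * c i (b l)) =
          (if p = (i, j) then Q $$ p / 2 else 0) + (if p = (j, i) then Q $$ p / 2 else 0)"
        unfolding p(1) by (cases "i = k"; cases "j = l"; cases "j = k"; cases "i = l") simp_all
      with e show "phi i j (?g p) = (if p = (i, j) then Q $$ p / 2 else 0) + (if p = (j, i) then Q $$ p / 2 else 0)"
        by (rule trans)
    qed
    also have "\<dots> = Q $$ (i, j)" using ij sym by (simp add: sum.distrib)
    finally show ?thesis .
  qed
  then have "phi_mat s = Q" using Q by (intro eq_matI) (auto simp: phi_mat_def)
  then show ?thesis using s by blast
qed

lemma psi_mat_surj:
  assumes Q: "Q \<in> carrier_mat n n" "transpose_mat Q = Q"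
  shows "\<exists>\<eta>\<in>carrier D. psi_mat \<eta> = Q"
proof -
  \<comment> \<open>The symmetric bilinear form with Gram matrix \<open>Q\<close>; the functional is
    its lift to the symmetric square.\<close>
  define f where "f u v = (\<Sum>k<n. (\<Sum>l<n. Q $$ (k, l) * c l v) * c k u)" for u v
  have lin: "linear_map class_ring V scalars (\<lambda>u. f u v)" for v
    unfolding f_def by (rule linear_sum_smult[OF V c_linear])
  have comm: "f u v = f v u" for u v
  proof -
    have "f u v = (\<Sum>k<n. \<Sum>l<n. Q $$ (k, l) * c l v * c k u)" by (simp add: f_def sum_distrib_right)
    also have "\<dots> = (\<Sum>l<n. \<Sum>k<n. Q $$ (k, l) * c l v * c k u)" by (rule sum.swap)
    also have "\<dots> = (\<Sum>l<n. \<Sum>k<n. Q $$ (l, k) * c k u * c l v)"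
    proof (intro sum.cong refl)
      fix k l assume "l \<in> {..<n}" "k \<in> {..<n}"
      then have "Q $$ (k, l) = Q $$ (l, k)" using Q by (metis carrier_matD index_transpose_mat(1) lessThan_iff)
      then show "Q $$ (k, l) * c l v * c k u = Q $$ (l, k) * c k u * c l v" by simp
    qed
    also have "\<dots> = f v u" by (simp add: f_def sum_distrib_right)
    finally show ?thesis .
  qed
  have bil: "sym_bilinear V scalars f"
    unfolding sym_bilinear_def using linear_mapD(4,5)[OF lin] comm by simp
  define \<eta> where "\<eta> = restrict (sym_lift V scalars f) (carrier S)"
  have "\<eta> \<in> carrier D"
    unfolding \<eta>_def by (rule restrict_mem_dual[OF linear_map_sym_lift[OF V vectorspace_scalars bil]])
  moreover have "\<eta> (m (b i) (b j)) = Q $$ (i, j)" if ij: "i < n" "j < n" for i j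
  proof -
    have "\<eta> (m (b i) (b j)) = f (b i) (b j)"
      using ij b_carrier m_carrier sym_lift_mult[OF V vectorspace_scalars bil] by (simp add: \<eta>_def)
    also have "\<dots> = Q $$ (i, j)"
      using ij by (simp add: f_def c_b if_distrib sum.delta' cong: if_cong)
    finally show ?thesis .
  qed
  then have "psi_mat \<eta> = Q" using Q by (intro eq_matI) (auto simp: psi_mat_def)
  ultimately show ?thesis by blast
qed

end

subsection \<open>Polynomial invariants of nilpotent vectors\<close>

lemma poly_functions_sum:
  "(\<And>i. i \<in> A \<Longrightarrow> f i \<in> poly_functions U) \<Longrightarrow> (\<lambda>u. \<Sum>i\<in>A. f i u) \<in> poly_functions U"
  by (induct A rule: infinite_finite_induct) (auto intro: poly_functions.intros)

lemma poly_functions_prod: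
  "(\<And>i. i \<in> A \<Longrightarrow> f i \<in> poly_functions U) \<Longrightarrow> (\<lambda>u. \<Prod>i\<in>A. f i u) \<in> poly_functions U"
  by (induct A rule: infinite_finite_induct) (auto intro: poly_functions.intros)

text \<open>The Leibniz formula writes the determinant as sums and products of the entries.\<close>

lemma poly_functions_det:
  assumes "\<And>i j. i < n \<Longrightarrow> j < n \<Longrightarrow> e i j \<in> poly_functions U"
  shows "(\<lambda>u. det (mat n n (\<lambda>(i, j). e i j u))) \<in> poly_functions U"
proof -
  have less: "p i < n" if "p permutes {0..<n}" "i < n" for p i
    using permutes_in_image[OF that(1), of i] that(2) by simp
  have "det (mat n n (\<lambda>(i, j). e i j u)) =
      (\<Sum>p\<in>{p. p permutes {0..<n}}. signof p * (\<Prod>i\<in>{0..<n}. e i (p i) u))" for u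
    unfolding det_def by (auto intro!: sum.cong prod.cong simp: less)
  then show ?thesis
    using assms
    by (auto intro!: poly_functions_sum poly_functions_prod poly_functions.mult poly_functions.const
        simp: less)
qed

section \<open>The group action and the nilpotency of \<open>A B\<close> at nilpotent
  vectors\<close>

context coord_space
begin

abbreviation "grp \<equiv> sym_square_GL_action V"

lemma sym_bilinear_grp:
  assumes g: "linear_map class_ring V V g"
  shows "sym_bilinear V S (\<lambda>u v. m (g u) (g v))"
  unfolding sym_bilinear_def
  using linear_mapD[OF g] by (auto simp: m_carrier mD intro: m_commute)

lemma grp_linear: "linear_map class_ring V V g \<Longrightarrow> linear_map class_ring S S (grp g)"
  unfolding sym_square_GL_action_def by (rule linear_map_sym_lift[OF V vs_S sym_bilinear_grp])

lemma grp_m: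
  "linear_map class_ring V V g \<Longrightarrow> u \<in> carrier V \<Longrightarrow> v \<in> carrier V \<Longrightarrow> grp g (m u v) = m (g u) (g v)"
  unfolding sym_square_GL_action_def by (rule sym_lift_mult[OF V vs_S sym_bilinear_grp])

lemma phi_grp:
  assumes g: "linear_map class_ring V V g" and s: "s \<in> carrier S" and ij: "i < n" "j < n"
  shows "phi i j (grp g s) = (\<Sum>k<n. mat_of g $$ (i, k) * (\<Sum>l<n. mat_of g $$ (j, l) * phi k l s))"
proof (rule sym_square_map_eqI[OF V linear_map_comp[OF grp_linear[OF g] phi_linear[OF ij]] _ _ s])
  show "linear_map class_ring S scalars
      (\<lambda>s. \<Sum>k<n. mat_of g $$ (i, k) * (\<Sum>l<n. mat_of g $$ (j, l) * phi k l s))"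
    by (intro linear_sum_smult vs_S phi_linear)
  fix u v assume uv: "u \<in> carrier V" "v \<in> carrier V"
  note gD = linear_mapD[OF g]
  have prod: "c i (g x) * c j (g y) = (\<Sum>k<n. mat_of g $$ (i, k) * (\<Sum>l<n. mat_of g $$ (j, l) * (c k x * c l y)))"
    if "x \<in> carrier V" "y \<in> carrier V" for x y
    unfolding c_apply[OF g ij(1) that(1)] c_apply[OF g ij(2) that(2)] sum_product
    by (simp add: sum_distrib_left mult_ac)
  have "phi i j (grp g (m u v)) = c i (g u) * c j (g v) + c i (g v) * c j (g u)"
    using ij uv by (simp add: grp_m[OF g] phi_m gD mult.commute)
  also have "\<dots> = (\<Sum>k<n. mat_of g $$ (i, k) * (\<Sum>l<n. mat_of g $$ (j, l) * (c k u * c l v + c l u * c k v)))"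
    unfolding prod[OF uv] prod[OF uv(2,1)]
    by (simp add: distrib_left sum.distrib mult.commute[of "c _ v"])
  also have "\<dots> = (\<Sum>k<n. mat_of g $$ (i, k) * (\<Sum>l<n. mat_of g $$ (j, l) * phi k l (m u v)))"
    using uv by (intro sum.cong arg_cong2[where f = "(*)"] refl) (simp add: phi_m)
  finally show "phi i j (grp g (m u v)) =
      (\<Sum>k<n. mat_of g $$ (i, k) * (\<Sum>l<n. mat_of g $$ (j, l) * phi k l (m u v)))" .
qed

lemma phi_mat_grp:
  assumes g: "linear_map class_ring V V g" and s: "s \<in> carrier S"
  shows "phi_mat (grp g s) = mat_of g * (phi_mat s * transpose_mat (mat_of g))"
proof (rule eq_matI)
  fix i j assume "i < dim_row (mat_of g * (phi_mat s * transpose_mat (mat_of g)))"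
    "j < dim_col (mat_of g * (phi_mat s * transpose_mat (mat_of g)))"
  then have ij: "i < n" "j < n" using mat_of_carrier[of g] by auto
  have "(mat_of g * (phi_mat s * transpose_mat (mat_of g))) $$ (i, j) =
      (\<Sum>k<n. mat_of g $$ (i, k) * (\<Sum>l<n. phi_mat s $$ (k, l) * mat_of g $$ (j, l)))"
    using ij mat_of_carrier[of g] mat_carrier(1)[of s] by (simp add: scalar_prod_def atLeast0LessThan)
  also have "\<dots> = phi i j (grp g s)"
    unfolding phi_grp[OF g s ij]
    by (rule sum.cong[OF refl], rule arg_cong2[where f = "(*)", OF refl], rule sum.cong[OF refl])
      (simp add: phi_mat_def)
  finally show "phi_mat (grp g s) $$ (i, j) = (mat_of g * (phi_mat s * transpose_mat (mat_of g))) $$ (i, j)"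
    using ij by (simp add: phi_mat_def)
qed (use mat_of_carrier[of g] mat_carrier(1) in \<open>auto simp: phi_mat_def\<close>)

text \<open>Bilinear forms are pulled back along \<open>h\<close>, which will be the inverse of a
  group element; \<open>\<xi>\<close> is given only by its values on the carrier.\<close>

lemma psi_mat_grp:
  assumes h: "linear_map class_ring V V h" and eta: "\<eta> \<in> carrier D"
    and xi: "\<And>u. u \<in> carrier S \<Longrightarrow> \<xi> u = \<eta> (grp h u)"
  shows "psi_mat \<xi> = transpose_mat (mat_of h) * (psi_mat \<eta> * mat_of h)"
proof (rule eq_matI)
  fix i j assume "i < dim_row (transpose_mat (mat_of h) * (psi_mat \<eta> * mat_of h))"
    "j < dim_col (transpose_mat (mat_of h) * (psi_mat \<eta> * mat_of h))"
  then have ij: "i < n" "j < n" using mat_of_carrier[of h] by auto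
  note hb = linear_mapD(3)[OF h b_carrier]
  have "psi_mat \<xi> $$ (i, j) = \<eta> (m (h (b i)) (h (b j)))"
    using ij b_carrier by (simp add: psi_mat_def xi m_carrier grp_m[OF h])
  also have "\<dots> = (\<Sum>k<n. mat_of h $$ (k, i) * \<eta> (m (b k) (h (b j))))"
    by (rule eta_expand[OF eta h ij(1) hb[OF ij(2)]])
  also have "\<dots> = (\<Sum>k<n. mat_of h $$ (k, i) * (\<Sum>l<n. mat_of h $$ (l, j) * \<eta> (m (b l) (b k))))"
  proof (intro sum.cong arg_cong2[where f = "(*)"] refl)
    fix k assume "k \<in> {..<n}"
    then show "\<eta> (m (b k) (h (b j))) = (\<Sum>l<n. mat_of h $$ (l, j) * \<eta> (m (b l) (b k)))"
      using m_commute[OF b_carrier hb[OF ij(2)], of k] eta_expand[OF eta h ij(2) b_carrier, of k] by simp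
  qed
  also have "\<dots> = (\<Sum>k<n. mat_of h $$ (k, i) * (\<Sum>l<n. psi_mat \<eta> $$ (k, l) * mat_of h $$ (l, j)))"
    by (rule sum.cong[OF refl], rule arg_cong2[where f = "(*)", OF refl], rule sum.cong[OF refl])
      (simp add: psi_mat_def mult.commute m_commute b_carrier)
  also have "\<dots> = (transpose_mat (mat_of h) * (psi_mat \<eta> * mat_of h)) $$ (i, j)"
    using ij mat_of_carrier[of h] mat_carrier(2)[of \<eta>] by (simp add: scalar_prod_def atLeast0LessThan)
  finally show "psi_mat \<xi> $$ (i, j) = (transpose_mat (mat_of h) * (psi_mat \<eta> * mat_of h)) $$ (i, j)" .
qed (use mat_of_carrier[of h] mat_carrier(2) in \<open>auto simp: psi_mat_def\<close>)

text \<open>The inverse in the record \<open>GL V\<close> is a definite description over its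
  carrier, so it is identified with the inverse function, which is first shown to be linear.\<close>

lemma GL_inverse:
  assumes g: "g \<in> carrier (GL V)"
  shows "linear_map class_ring V V g" "linear_map class_ring V V (inv\<^bsub>GL V\<^esub> g)"
    and "v \<in> carrier V \<Longrightarrow> (inv\<^bsub>GL V\<^esub> g) (g v) = v"
proof -
  have gB: "g \<in> Bij (carrier V)" and gl: "g \<in> gl V" using g by (auto simp: GL_def)
  show lin: "linear_map class_ring V V g" using gl by (simp add: gl_iff[OF V])
  note gD = linear_mapD[OF lin]
  have bij: "bij_betw g (carrier V) (carrier V)" using gB by (simp add: Bij_def)
  define h where "h = (\<lambda>x\<in>carrier V. inv_into (carrier V) g x)"
  have hB: "h \<in> Bij (carrier V)" unfolding h_def by (rule restrict_inv_into_Bij[OF gB])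
  have hg: "h (g v) = v" if "v \<in> carrier V" for v
    using that bij gD(3) by (simp add: h_def bij_betw_def)
  have gh: "g (h v) = v" "h v \<in> carrier V" if "v \<in> carrier V" for v
    using that bij by (auto simp: h_def bij_betw_def f_inv_into_f inv_into_into)
  have hlin: "linear_map class_ring V V h"
  proof (rule linear_mapI[OF V V])
    fix u v k assume u: "u \<in> carrier V"
    show "h u \<in> carrier V" by (rule gh(2)[OF u])
    show "h (k \<odot>\<^bsub>V\<^esub> u) = k \<odot>\<^bsub>V\<^esub> h u"
      using hg[of "k \<odot>\<^bsub>V\<^esub> h u"] gh[OF u] gD by (simp add: vs_smult[OF V])
    assume v: "v \<in> carrier V"
    show "h (u \<oplus>\<^bsub>V\<^esub> v) = h u \<oplus>\<^bsub>V\<^esub> h v"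
      using hg[of "h u \<oplus>\<^bsub>V\<^esub> h v"] gh[OF u] gh[OF v] gD by simp
  qed
  have hc: "h \<in> carrier (GL V)" using hB hlin by (simp add: GL_def gl_iff[OF V] h_def)
  have mult: "x \<otimes>\<^bsub>GL V\<^esub> y = compose (carrier V) x y" if "x \<in> Bij (carrier V)" "y \<in> Bij (carrier V)" for x y
    using that by (simp add: GL_def BijGroup_def)
  have one: "\<one>\<^bsub>GL V\<^esub> = (\<lambda>x\<in>carrier V. x)" by (simp add: GL_def BijGroup_def)
  have "inv\<^bsub>GL V\<^esub> g = h"
    unfolding m_inv_def
  proof (rule the_equality)
    show "h \<in> carrier (GL V) \<and> g \<otimes>\<^bsub>GL V\<^esub> h = \<one>\<^bsub>GL V\<^esub> \<and> h \<otimes>\<^bsub>GL V\<^esub> g = \<one>\<^bsub>GL V\<^esub>"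
      using hc by (auto simp: mult gB hB one compose_def hg gh intro!: restrict_ext)
    fix y assume y: "y \<in> carrier (GL V) \<and> g \<otimes>\<^bsub>GL V\<^esub> y = \<one>\<^bsub>GL V\<^esub> \<and> y \<otimes>\<^bsub>GL V\<^esub> g = \<one>\<^bsub>GL V\<^esub>"
    then have yB: "y \<in> Bij (carrier V)" and yl: "y \<in> extensional (carrier V)"
      by (auto simp: GL_def gl_def)
    have yg: "y (g v) = v" if "v \<in> carrier V" for v
    proof -
      have "compose (carrier V) y g = (\<lambda>x\<in>carrier V. x)"
        using y by (simp add: mult[OF yB gB] one)
      from fun_cong[OF this, of v] that show ?thesis by (simp add: compose_def)
    qed
    show "y = h"
    proof (rule extensionalityI[OF yl])
      show "h \<in> extensional (carrier V)" by (simp add: h_def)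
      show "y v = h v" if "v \<in> carrier V" for v
        using yg[OF gh(2)[OF that]] gh(1)[OF that] by simp
    qed
  qed
  then show "linear_map class_ring V V (inv\<^bsub>GL V\<^esub> g)" "v \<in> carrier V \<Longrightarrow> (inv\<^bsub>GL V\<^esub> g) (g v) = v"
    using hlin hg by simp_all
qed

lemma mat_of_inverse:
  assumes g: "linear_map class_ring V V g" and h: "linear_map class_ring V V h"
    and hg: "\<And>v. v \<in> carrier V \<Longrightarrow> h (g v) = v"
  shows "mat_of h * mat_of g = 1\<^sub>m n"
proof (rule eq_matI)
  fix i j assume "i < dim_row (1\<^sub>m n :: 'k mat)" "j < dim_col (1\<^sub>m n :: 'k mat)"
  then have ij: "i < n" "j < n" by auto
  have "(mat_of h * mat_of g) $$ (i, j) = (\<Sum>k<n. mat_of h $$ (i, k) * c k (g (b j)))"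
    using ij mat_of_carrier[of h] mat_of_carrier[of g]
    by (simp add: scalar_prod_def atLeast0LessThan) (simp add: mat_of_def[of g])
  also have "\<dots> = c i (h (g (b j)))"
    by (rule c_apply[OF h ij(1) linear_mapD(3)[OF g b_carrier[OF ij(2)]], symmetric])
  finally show "(mat_of h * mat_of g) $$ (i, j) = 1\<^sub>m n $$ (i, j)"
    using ij by (simp add: hg b_carrier c_b)
qed (use mat_of_carrier[of h] mat_of_carrier[of g] in auto)

lemma det_conjugate:
  fixes G H M :: "'k mat"
  assumes G: "G \<in> carrier_mat n n" and H: "H \<in> carrier_mat n n" and M: "M \<in> carrier_mat n n"
    and HG: "H * G = 1\<^sub>m n"
  shows "det (t \<cdot>\<^sub>m 1\<^sub>m n - G * M * H) = det (t \<cdot>\<^sub>m 1\<^sub>m n - M)"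
proof -
  have GH: "G * H = 1\<^sub>m n" by (rule mat_mult_left_right_inverse[OF H G HG])
  let ?T = "t \<cdot>\<^sub>m 1\<^sub>m n :: 'k mat"
  have T: "?T \<in> carrier_mat n n" by simp
  have "G * ?T = t \<cdot>\<^sub>m G" using mult_smult_distrib[OF G one_carrier_mat] G by simp
  then have "G * ?T * H = t \<cdot>\<^sub>m (G * H)" using mult_smult_assoc_mat[OF G H] by simp
  then have "?T - G * M * H = G * ?T * H - G * M * H" by (simp add: GH)
  also have "\<dots> = (G * ?T - G * M) * H"
    using G H M T by (intro minus_mult_distrib_mat[symmetric, of _ n n]) auto
  also have "G * ?T - G * M = G * (?T - M)"
    using G M T by (intro mult_minus_distrib_mat[symmetric, of _ n n]) auto
  finally have eq: "?T - G * M * H = G * (?T - M) * H" .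
  have TM: "?T - M \<in> carrier_mat n n" by (rule minus_carrier_mat[OF M])
  have "det (?T - G * M * H) = det G * det (?T - M) * det H"
    unfolding eq det_mult[OF mult_carrier_mat[OF G TM] H] det_mult[OF G TM] ..
  moreover have "det H * det G = 1" using det_mult[OF H G] HG by simp
  ultimately show ?thesis by (metis mult.assoc mult.commute mult_1)
qed

abbreviation "U \<equiv> direct_sum S D"
abbreviation "rep \<equiv> sum_action grp (dual_group_action (GL V) S grp)"
abbreviation "rho \<equiv> sum_action act (dual_lie_action S act)"

lemmas vs_U = direct_sum_is_vs[OF vs_S vs_D]
lemmas fin_dim_U = fin_dim_direct_sum[OF vs_S fin_dim_S vs_D fin_dim_dual[OF vs_S fin_dim_S]]

lemma m_bb: "i < n \<Longrightarrow> j < n \<Longrightarrow> m (b i) (b j) \<in> carrier S"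
  by (simp add: m_carrier b_carrier)

text \<open>With \<open>G\<close> the matrix of \<open>g\<close> and \<open>H\<close> its inverse,
  \<open>A\<close> becomes \<open>G * A * transpose_mat G\<close> and \<open>B\<close> becomes
  \<open>transpose_mat H * B * H\<close>. In the product the transposes cancel, leaving a conjugate
  of \<open>A * B\<close>.\<close>

lemma char_det_invariant:
  assumes s: "s \<in> carrier S" and eta: "\<eta> \<in> carrier D" and g: "g \<in> carrier (GL V)"
  shows "rep g (s, \<eta>) \<in> carrier U"
    and "det (t \<cdot>\<^sub>m 1\<^sub>m n - phi_mat (fst (rep g (s, \<eta>))) * psi_mat (snd (rep g (s, \<eta>)))) =
      det (t \<cdot>\<^sub>m 1\<^sub>m n - phi_mat s * psi_mat \<eta>)"
proof -
  define h where "h = inv\<^bsub>GL V\<^esub> g"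
  have gl: "linear_map class_ring V V g" and hl: "linear_map class_ring V V h"
    and hg: "\<And>v. v \<in> carrier V \<Longrightarrow> h (g v) = v"
    unfolding h_def using GL_inverse[OF g] by blast+
  define \<xi> where "\<xi> = (\<lambda>u\<in>carrier S. \<eta> (grp h u))"
  have rep: "rep g (s, \<eta>) = (grp g s, \<xi>)"
    by (simp add: sum_action_def dual_group_action_def \<xi>_def h_def)
  have "\<xi> \<in> carrier D"
    unfolding \<xi>_def by (rule restrict_mem_dual[OF linear_map_comp[OF grp_linear[OF hl] eta_linear[OF eta]]])
  then show "rep g (s, \<eta>) \<in> carrier U"
    unfolding rep using linear_mapD(3)[OF grp_linear[OF gl] s] by (simp add: direct_sum_simps)
  let ?G = "mat_of g" and ?H = "mat_of h" and ?A = "phi_mat s" and ?B = "psi_mat \<eta>"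
  note car = mat_of_carrier[of g] mat_of_carrier[of h] mat_carrier(1)[of s] mat_carrier(2)[of \<eta>]
  have HG: "?H * ?G = 1\<^sub>m n" by (rule mat_of_inverse[OF gl hl hg])
  have GtHt: "transpose_mat ?G * transpose_mat ?H = 1\<^sub>m n"
    using transpose_mult[OF car(2,1)] HG by simp
  have "phi_mat (grp g s) * psi_mat \<xi> =
      ?G * (?A * transpose_mat ?G) * (transpose_mat ?H * (?B * ?H))"
    using phi_mat_grp[OF gl s] psi_mat_grp[OF hl eta, of \<xi>] by (simp add: \<xi>_def)
  also have "\<dots> = ?G * (?A * ((transpose_mat ?G * transpose_mat ?H) * (?B * ?H)))"
    using car by (simp add: assoc_mult_mat[of _ n n _ n _ n])
  also have "\<dots> = ?G * (?A * ?B) * ?H"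
    unfolding GtHt using car by (simp add: assoc_mult_mat[of _ n n _ n _ n])
  finally show "det (t \<cdot>\<^sub>m 1\<^sub>m n - phi_mat (fst (rep g (s, \<eta>))) * psi_mat (snd (rep g (s, \<eta>)))) =
      det (t \<cdot>\<^sub>m 1\<^sub>m n - ?A * ?B)"
    unfolding rep using det_conjugate[OF car(1,2) _ HG, of "?A * ?B" t] car by simp
qed

text \<open>For each \<open>t\<close>, the value of the characteristic polynomial of the matrix
  product is constant on the orbit, hence takes the same value at the origin of the orbit closure,
  namely \<open>t ^ n\<close>.\<close>

lemma nilpotent_vector_imp:
  assumes nil: "nilpotent_vector (GL V) rep U x"
  shows "(phi_mat (fst x) * psi_mat (snd x)) ^\<^sub>m n = 0\<^sub>m n n"
proof (rule det_eq_imp_nilpotent)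
  show "phi_mat (fst x) * psi_mat (snd x) \<in> carrier_mat n n"
    using mat_carrier(1)[of "fst x"] mat_carrier(2)[of "snd x"] by simp
  fix t :: 'k
  have x: "fst x \<in> carrier S" "snd x \<in> carrier D" "x = (fst x, snd x)"
    using nil by (auto simp: nilpotent_vector_def direct_sum_simps)
  \<comment> \<open>Linear generators among the polynomial functions are elements of the dual, hence
    extensional; this forces the restriction.\<close>
  define fA where "fA i j = restrict (\<lambda>u. phi i j (fst u)) (carrier U)" for i j
  define fB where "fB i j = restrict (\<lambda>u. snd u (m (b i) (b j))) (carrier U)" for i j
  have fA: "fA i j \<in> poly_functions U" if "i < n" "j < n" for i j
    unfolding fA_def
    by (intro poly_functions.linear restrict_mem_dual linear_map_comp[OF linear_map_fst[OF vs_S vs_D] phi_linear[OF that]])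
  have fB: "fB i j \<in> poly_functions U" if "i < n" "j < n" for i j
    unfolding fB_def
    by (intro poly_functions.linear restrict_mem_dual
        linear_map_comp[OF linear_map_snd[OF vs_S vs_D] linear_map_eval[OF vs_S m_bb[OF that]]])
  define r where "r = det (t \<cdot>\<^sub>m 1\<^sub>m n - phi_mat (fst x) * psi_mat (snd x))"
  define e where "e i j u = (if i = j then t else 0) + (-1) * (\<Sum>k<n. fA i k u * fB k j u)" for i j u
  \<comment> \<open>Subtracting the value \<open>r\<close> at \<open>x\<close> produces a polynomial
    vanishing on the orbit, as the definition of the closure requires.\<close>
  define p where "p u = det (mat n n (\<lambda>(i, j). e i j u)) + (- r)" for u
  have "e i j \<in> poly_functions U" if "i < n" "j < n" for i j
    unfolding e_def using that fA fB
    by (intro poly_functions.add poly_functions.mult poly_functions.const poly_functions_sum) auto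
  then have p: "p \<in> poly_functions U"
    unfolding p_def by (intro poly_functions.add poly_functions.const poly_functions_det)
  have p_eq: "p u = det (t \<cdot>\<^sub>m 1\<^sub>m n - phi_mat (fst u) * psi_mat (snd u)) - r" if u: "u \<in> carrier U" for u
  proof -
    have "mat n n (\<lambda>(i, j). e i j u) = t \<cdot>\<^sub>m 1\<^sub>m n - phi_mat (fst u) * psi_mat (snd u)"
      using mat_carrier(1)[of "fst u"] mat_carrier(2)[of "snd u"] u
      by (intro eq_matI)
        (auto simp: e_def fA_def fB_def scalar_prod_def atLeast0LessThan phi_mat_def psi_mat_def)
    then show ?thesis by (simp add: p_def)
  qed
  have "p y = 0" if y: "y \<in> (\<lambda>g. rep g x) ` carrier (GL V)" for y
  proof -
    obtain g where g: "g \<in> carrier (GL V)" "y = rep g x" using y by blast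
    have "y \<in> carrier U" using char_det_invariant(1)[OF x(1,2) g(1)] x(3) g(2) by simp
    then show ?thesis
      using p_eq[of y] char_det_invariant(2)[OF x(1,2) g(1), of t] x(3) g(2) by (simp add: r_def)
  qed
  then have "p \<zero>\<^bsub>U\<^esub> = 0"
    using nil p unfolding nilpotent_vector_def zariski_closure_def by blast
  moreover have "\<zero>\<^bsub>U\<^esub> \<in> carrier U"
    using vs_U vectorspace.fin_dim_def[OF vs_U] subspaceD(3)[OF image_subspace[OF linear_map_fst]]
    using nil unfolding nilpotent_vector_def zariski_closure_def by blast
  moreover have "phi_mat \<zero>\<^bsub>S\<^esub> = 0\<^sub>m n n"
    by (rule eq_matI) (auto simp: phi_mat_def linear_mapD(6)[OF phi_linear])
  moreover have "det (t \<cdot>\<^sub>m 1\<^sub>m n - 0\<^sub>m n n * psi_mat \<eta>) = t ^ n" for \<eta>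
  proof -
    have "t \<cdot>\<^sub>m 1\<^sub>m n - 0\<^sub>m n n * psi_mat \<eta> = t \<cdot>\<^sub>m 1\<^sub>m n"
      using mat_carrier(2)[of \<eta>] by (intro eq_matI) auto
    then show ?thesis by (simp add: det_smult)
  qed
  ultimately show "det (t \<cdot>\<^sub>m 1\<^sub>m n - phi_mat (fst x) * psi_mat (snd x)) = t ^ n"
    using p_eq[of "\<zero>\<^bsub>U\<^esub>"] by (simp add: r_def direct_sum_simps)
qed

subsection \<open>Good nilpotent index behaviour\<close>

lemma rho_linear: "linear_map class_ring V V x \<Longrightarrow> linear_map class_ring U U (rho x)"
  unfolding sum_action_def
  by (intro linear_map_map_prod act_linear linear_map_dual_lie_action)

lemma rho_orbit_linear:
  assumes u: "u \<in> carrier U"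
  shows "linear_map class_ring P U (\<lambda>z. rho (par z) u)"
proof -
  have "linear_map class_ring P U (\<lambda>z. (act (par z) (fst u), dual_lie_action S act (par z) (snd u)))"
  proof (rule linear_map_Pair)
    show "linear_map class_ring P S (\<lambda>z. act (par z) (fst u))"
      using u by (intro act_orbit_linear) (auto simp: direct_sum_simps)
    show "linear_map class_ring P D (\<lambda>z. dual_lie_action S act (par z) (snd u))"
      by (rule linear_map_dual_lie_orbit[where p = par and act = act, OF vec_vs vs_S])
        (use u act_linear[OF linear_par] act_orbit_linear in \<open>auto simp: direct_sum_simps\<close>)
  qed
  then show ?thesis by (simp add: sum_action_def map_prod_def split_beta)
qed

text \<open>On the dual summand the order of the operators is reversed and two signs appear; the
  identity there follows from \<open>act_bracket\<close> inside the functional.\<close>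

lemma rho_bracket:
  assumes x: "linear_map class_ring V V x" and y: "linear_map class_ring V V y" and u: "u \<in> carrier U"
  shows "rho x (rho y u) = rho y (rho x u) \<oplus>\<^bsub>U\<^esub> rho (bracket x y) u"
proof -
  obtain s \<eta> where u': "u = (s, \<eta>)" "s \<in> carrier S" "\<eta> \<in> carrier D"
    using u by (auto simp: direct_sum_simps)
  note etaD = linear_mapD[OF eta_linear[OF u'(3)]]
  have l: "linear_map class_ring V V (bracket x y)" using bracket_gl[OF x y] by (simp add: gl_iff[OF V])
  note XD = linear_mapD(3)[OF act_linear[OF x]] and YD = linear_mapD(3)[OF act_linear[OF y]]
    and LD = linear_mapD(3)[OF act_linear[OF l]]
  have "dual_lie_action S act x (dual_lie_action S act y \<eta>) =
      dual_lie_action S act y (dual_lie_action S act x \<eta>) \<oplus>\<^bsub>D\<^esub> dual_lie_action S act (bracket x y) \<eta>"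
    by (auto simp: dual_lie_action_def dual_simps XD YD LD etaD act_bracket[OF x y] intro!: restrict_ext)
  then show ?thesis
    by (simp add: u' sum_action_def direct_sum_simps act_bracket[OF x y])
qed

text \<open>\<open>matrix_pair_rigid\<close> translated back: the matrices \<open>Pm\<close> and
  \<open>Q\<close> are realised by a symmetric tensor and a functional, which together form the
  vector \<open>w\<close> of the overview.\<close>

lemma ex_trivial_stabiliser:
  assumes v: "v \<in> carrier U" and nil: "(phi_mat (fst v) * psi_mat (snd v)) ^\<^sub>m k = 0\<^sub>m n n"
  shows "\<exists>w\<in>carrier U. \<forall>z\<in>carrier P. rho (par z) v = \<zero>\<^bsub>U\<^esub> \<longrightarrow>
    rho (par z) w \<in> lie_orbit (gl V) rho v \<longrightarrow> z = \<zero>\<^bsub>P\<^esub>"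
proof -
  obtain s \<eta> where v': "v = (s, \<eta>)" "s \<in> carrier S" "\<eta> \<in> carrier D"
    using v by (auto simp: direct_sum_simps)
  let ?A = "phi_mat s" and ?B = "psi_mat \<eta>"
  note car = mat_carrier(1)[of s] mat_carrier(2)[of \<eta>]
  obtain Pm Q where PQ: "Pm \<in> carrier_mat n n" "Q \<in> carrier_mat n n" "transpose_mat Pm = Pm" "transpose_mat Q = Q"
    and rigid: "\<And>X Y. X \<in> carrier_mat n n \<Longrightarrow> Y \<in> carrier_mat n n \<Longrightarrow>
      X * ?A + ?A * transpose_mat X = 0\<^sub>m n n \<Longrightarrow> transpose_mat X * ?B + ?B * X = 0\<^sub>m n n \<Longrightarrow>
      X * Pm + Pm * transpose_mat X = Y * ?A + ?A * transpose_mat Y \<Longrightarrow>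
      transpose_mat X * Q + Q * X = transpose_mat Y * ?B + ?B * Y \<Longrightarrow> X = 0\<^sub>m n n"
    using matrix_pair_rigid[OF car(1) mat_symmetric(1) car(2) mat_symmetric(2), of k] nil v' by auto
  obtain s' where s': "s' \<in> carrier S" "phi_mat s' = Pm" using phi_mat_surj PQ by blast
  obtain \<eta>' where eta': "\<eta>' \<in> carrier D" "psi_mat \<eta>' = Q" using psi_mat_surj PQ by blast
  show ?thesis
  proof (intro bexI[of _ "(s', \<eta>')"] ballI impI)
    show "(s', \<eta>') \<in> carrier U" using s' eta' by (simp add: direct_sum_simps)
    fix z assume z: "z \<in> carrier P" and z0: "rho (par z) v = \<zero>\<^bsub>U\<^esub>"
      and orb: "rho (par z) (s', \<eta>') \<in> lie_orbit (gl V) rho v"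
    let ?x = "par z"
    let ?X = "mat_of ?x"
    have x: "linear_map class_ring V V ?x" by (rule linear_par)
    obtain y where y: "y \<in> gl V" "rho ?x (s', \<eta>') = rho y v" using orb by (auto simp: lie_orbit_def)
    have yl: "linear_map class_ring V V y" using y by (simp add: gl_iff[OF V])
    let ?Y = "mat_of y"
    have X: "?X \<in> carrier_mat n n" and Y: "?Y \<in> carrier_mat n n" by (rule mat_of_carrier)+
    \<comment> \<open>The dual action carries a minus sign on both sides of each equation.\<close>
    have neg: "M = N" if "- M = - N" "M \<in> carrier_mat n n" "N \<in> carrier_mat n n" for M N :: "'k mat"
      using that by (metis uminus_uminus_mat)
    have "?X = 0\<^sub>m n n"
    proof (rule rigid[OF X Y])
      have "act ?x s = \<zero>\<^bsub>S\<^esub>" and d0: "dual_lie_action S act ?x \<eta> = \<zero>\<^bsub>D\<^esub>"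
        using z0 v' by (auto simp: sum_action_def direct_sum_simps)
      moreover have "phi_mat \<zero>\<^bsub>S\<^esub> = 0\<^sub>m n n"
        by (rule eq_matI) (auto simp: phi_mat_def linear_mapD(6)[OF phi_linear])
      ultimately show "?X * ?A + ?A * transpose_mat ?X = 0\<^sub>m n n" using phi_mat_act[OF x v'(2)] by simp
      have "psi_mat \<zero>\<^bsub>D\<^esub> = 0\<^sub>m n n"
        by (rule eq_matI) (auto simp: psi_mat_def dual_simps m_bb)
      then have "- (transpose_mat ?X * ?B + ?B * ?X) = 0\<^sub>m n n"
        using psi_mat_act[OF x v'(3)] d0 by simp
      also have "0\<^sub>m n n = - (0\<^sub>m n n :: 'k mat)" by (rule eq_matI) auto
      finally have "- (transpose_mat ?X * ?B + ?B * ?X) = - (0\<^sub>m n n)" .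
      then show "transpose_mat ?X * ?B + ?B * ?X = 0\<^sub>m n n"
        by (rule neg) (use X car in auto)
      have e: "act ?x s' = act y s" "dual_lie_action S act ?x \<eta>' = dual_lie_action S act y \<eta>"
        using y(2) v' by (auto simp: sum_action_def)
      show "?X * Pm + Pm * transpose_mat ?X = ?Y * ?A + ?A * transpose_mat ?Y"
        using phi_mat_act[OF x s'(1)] phi_mat_act[OF yl v'(2)] e s' by simp
      have "- (transpose_mat ?X * Q + Q * ?X) = - (transpose_mat ?Y * ?B + ?B * ?Y)"
        using psi_mat_act[OF x eta'(1)] psi_mat_act[OF yl v'(3)] e eta' by simp
      then show "transpose_mat ?X * Q + Q * ?X = transpose_mat ?Y * ?B + ?B * ?Y"
        by (rule neg) (use X Y PQ car in auto)
    qed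
    then show "z = \<zero>\<^bsub>P\<^esub>" by (rule par_eq_zero[OF z])
  qed
qed

text \<open>The case of the zero vector: its orbit is 0 and its stabiliser is everything, so the
  vector \<open>w\<close> has trivial stabiliser in \<open>gl V\<close>.\<close>

lemma index_dual_U: "index (gl V) (dual U) (dual_lie_action U rho) = int (vdim U) - int (vdim P)"
proof -
  have z: "\<zero>\<^bsub>U\<^esub> \<in> carrier U"
    by (rule subspaceD(2)[OF kernel_subspace[OF linear_map_fst[OF vs_S vs_D]]])
      (rule subspaceD(3)[OF kernel_subspace[OF linear_map_fst[OF vs_S vs_D]]])
  have "phi_mat (fst \<zero>\<^bsub>U\<^esub>) = 0\<^sub>m n n"
    by (rule eq_matI) (auto simp: phi_mat_def linear_mapD(6)[OF phi_linear] direct_sum_simps)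
  then have "(phi_mat (fst \<zero>\<^bsub>U\<^esub>) * psi_mat (snd \<zero>\<^bsub>U\<^esub>)) ^\<^sub>m 1 = 0\<^sub>m n n"
    using mat_carrier(2)[of "snd \<zero>\<^bsub>U\<^esub>"] by simp
  from ex_trivial_stabiliser[OF z this] obtain w where w: "w \<in> carrier U"
    "\<And>u. u \<in> carrier P \<Longrightarrow> rho (par u) \<zero>\<^bsub>U\<^esub> = \<zero>\<^bsub>U\<^esub> \<Longrightarrow>
      rho (par u) w \<in> lie_orbit (gl V) rho \<zero>\<^bsub>U\<^esub> \<Longrightarrow> u = \<zero>\<^bsub>P\<^esub>" by blast
  have r0: "rho (par u) \<zero>\<^bsub>U\<^esub> = \<zero>\<^bsub>U\<^esub>" for u by (rule linear_mapD(6)[OF rho_linear[OF linear_par]])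
  show ?thesis
  proof (rule index_dual_trivial_stabiliser[where p = par and u = w and act = rho,
        OF vec_vs fin_dim_vec vs_U fin_dim_U gl_eq_par rho_linear[OF linear_par] rho_orbit_linear w(1)])
    fix u assume u: "u \<in> carrier P" "rho (par u) w = \<zero>\<^bsub>U\<^esub>"
    have "\<zero>\<^bsub>U\<^esub> \<in> lie_orbit (gl V) rho \<zero>\<^bsub>U\<^esub>"
      unfolding lie_orbit_def gl_eq_par using u(1) r0[of u] by (auto intro!: image_eqI[of _ _ "par u"])
    then show "u = \<zero>\<^bsub>P\<^esub>" using w(2)[OF u(1) r0] u(2) by simp
  qed
qed

text \<open>The image of \<open>w\<close> in the quotient has trivial stabiliser, so the index is
  the dimension of the quotient minus that of the stabiliser. Rank-nullity for the orbit map of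
  \<open>v\<close> makes this independent of \<open>v\<close>.\<close>

lemma index_dual_normal:
  assumes v: "v \<in> carrier U" and nil: "(phi_mat (fst v) * psi_mat (snd v)) ^\<^sub>m k = 0\<^sub>m n n"
  defines "W \<equiv> lie_orbit (gl V) rho v"
  shows "index (lie_stabiliser (gl V) U rho v) (dual (quot_space U W))
      (dual_lie_action (quot_space U W) (quot_lie_action U W rho)) = int (vdim U) - int (vdim P)"
proof -
  define T where "T z = rho (par z) v" for z
  have T: "linear_map class_ring P U T" unfolding T_def by (rule rho_orbit_linear[OF v])
  interpret T: linear_map class_ring P U T by (rule T)
  have W_eq: "W = T ` carrier P" by (auto simp: W_def lie_orbit_def gl_eq_par T_def)
  have W: "VectorSpace.subspace class_ring W U" unfolding W_eq by (rule image_subspace[OF T])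
  define K where "K = {z \<in> carrier P. T z = \<zero>\<^bsub>U\<^esub>}"
  have K: "VectorSpace.subspace class_ring K P" unfolding K_def by (rule kernel_subspace[OF T])
  let ?P = "P\<lparr>carrier := K\<rparr>"
  have vsK: "vectorspace class_ring ?P" by (rule T.V.subspace_is_vs[OF K])
  have fdK: "vectorspace.fin_dim class_ring ?P" by (rule fin_dim_subspace[OF K fin_dim_vec])
  have dims: "vdim (U\<lparr>carrier := W\<rparr>) + vdim ?P = vdim P"
    using T.rank_nullity[OF fin_dim_vec] by (simp add: T.im_def T.ker_def W_eq K_def)
  note N = vectorspace_quot_space[OF W] and Ndim = quot_space_dim[OF W fin_dim_U]
  have stab: "lie_stabiliser (gl V) U rho v = par ` carrier ?P"
    by (auto simp: lie_stabiliser_def gl_eq_par K_def T_def)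
  \<comment> \<open>For \<open>x\<close> in the stabiliser,
    \<open>x y v = y x v + [x, y] v = [x, y] v\<close>, so the orbit is stable and the quotient
    action is defined.\<close>
  have inv: "rho (par z) w \<in> W" if z: "z \<in> K" and w: "w \<in> W" for z w
  proof -
    obtain y where y: "y \<in> gl V" "w = rho y v" using w by (auto simp: W_def lie_orbit_def)
    have yl: "linear_map class_ring V V y" using y by (simp add: gl_iff[OF V])
    have "rho (par z) w = rho y \<zero>\<^bsub>U\<^esub> \<oplus>\<^bsub>U\<^esub> rho (bracket (par z) y) v"
      using rho_bracket[OF linear_par yl v, of z] z y by (simp add: K_def T_def)
    moreover have "rho y \<zero>\<^bsub>U\<^esub> = \<zero>\<^bsub>U\<^esub>" by (rule linear_mapD(6)[OF rho_linear[OF yl]])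
    moreover have "rho (bracket (par z) y) v \<in> W"
      using bracket_gl[OF linear_par yl] by (auto simp: W_def lie_orbit_def)
    ultimately show ?thesis using subspaceD(3,4)[OF W] by simp
  qed
  have ind: "u \<in> carrier U \<Longrightarrow> quot_lie_action U W rho (par z) (W +>\<^bsub>U\<^esub> u) = W +>\<^bsub>U\<^esub> rho (par z) u"
    "linear_map class_ring (quot_space U W) (quot_space U W) (quot_lie_action U W rho (par z))"
    if "z \<in> K" for z u
    using linear_map_induced[where act = rho and x = "par z", OF W rho_linear[OF linear_par] inv[OF that]]
    by blast+
  obtain w where w: "w \<in> carrier U"
    "\<And>z. z \<in> carrier P \<Longrightarrow> rho (par z) v = \<zero>\<^bsub>U\<^esub> \<Longrightarrow> rho (par z) w \<in> W \<Longrightarrow> z = \<zero>\<^bsub>P\<^esub>"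
    using ex_trivial_stabiliser[OF v nil] unfolding W_def by blast
  have "index (par ` carrier ?P) (dual (quot_space U W))
      (dual_lie_action (quot_space U W) (quot_lie_action U W rho)) = int (vdim (quot_space U W)) - int (vdim ?P)"
  proof (rule index_dual_trivial_stabiliser[where p = par and u = "W +>\<^bsub>U\<^esub> w" and act = "quot_lie_action U W rho",
        OF vsK fdK N Ndim(1) refl])
    show "linear_map class_ring (quot_space U W) (quot_space U W) (quot_lie_action U W rho (par z))"
      if "z \<in> carrier ?P" for z
      using ind(2)[of z] that by simp
    show "W +>\<^bsub>U\<^esub> w \<in> carrier (quot_space U W)" using w(1) by (simp add: quot_space_simps[OF W])
    fix z assume z: "z \<in> carrier ?P" "quot_lie_action U W rho (par z) (W +>\<^bsub>U\<^esub> w) = \<zero>\<^bsub>quot_space U W\<^esub>"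
    then have "W +>\<^bsub>U\<^esub> rho (par z) w = \<zero>\<^bsub>quot_space U W\<^esub>" using ind(1)[of z w] w(1) by simp
    then have "rho (par z) w \<in> W"
      using proj_eq_zero_iff[OF W] linear_mapD(3)[OF rho_linear[OF linear_par] w(1)] by simp
    then show "z = \<zero>\<^bsub>?P\<^esub>" using w(2)[of z] z by (simp add: K_def T_def)
  next
    fix X assume "X \<in> carrier (quot_space U W)"
    then obtain u where u: "u \<in> carrier U" "X = W +>\<^bsub>U\<^esub> u" by (auto simp: quot_space_simps[OF W])
    have "linear_map class_ring P (quot_space U W) (\<lambda>z. W +>\<^bsub>U\<^esub> rho (par z) u)"
      by (rule linear_map_comp[OF rho_orbit_linear[OF u(1)] linear_map_proj[OF W]])
    from linear_mapD(3-5)[OF this]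
    show "linear_map class_ring ?P (quot_space U W) (\<lambda>z. quot_lie_action U W rho (par z) X)"
      using u ind(1) subspaceD[OF K] by (intro linear_mapI[OF vsK N]) auto
  qed
  then show ?thesis unfolding stab using Ndim(2) dims by simp
qed

end

theorem theorem4p2:
  fixes V :: "('k::{alg_closed_field, field_char_0}, 'v) module"
  assumes "vectorspace class_ring V"
    and "vectorspace.fin_dim class_ring V"
  shows "GNIB
    (GL V)
    (sum_action (sym_square_GL_action V)
       (dual_group_action (GL V) (sym_square V) (sym_square_GL_action V)))
    (gl V)
    (sum_action (sym_square_gl_action V)
       (dual_lie_action (sym_square V) (sym_square_gl_action V)))
    (direct_sum (sym_square V) (dual (sym_square V)))"
proof -
  obtain n b c where "coord_basis V n b c" using ex_coord_basis[OF assms] by blast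
  then interpret coord_space V n b c using assms(1) by (intro coord_space.intro)
  show ?thesis
    unfolding GNIB_def Let_def
  proof (intro allI impI)
    fix v assume nil: "nilpotent_vector (GL V) rep U v"
    then have "v \<in> carrier U" by (simp add: nilpotent_vector_def)
    from index_dual_normal[OF this nilpotent_vector_imp[OF nil]]
    show "index (gl V) (dual U) (dual_lie_action U rho) =
        index (lie_stabiliser (gl V) U rho v) (dual (quot_space U (lie_orbit (gl V) rho v)))
          (dual_lie_action (quot_space U (lie_orbit (gl V) rho v))
            (quot_lie_action U (lie_orbit (gl V) rho v) rho))"
      by (simp add: index_dual_U)
  qed
qed

end
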